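(* Suppose that $$\sum_{n=1}^{\infty} n^{-3/2}\sqrt{\ell(n)}\,\log(n)\,\|E(S_n\mid\mathcal{F}_0)\|<\infty\qquad\text{with }\ell(n)=\max(1,\log n).$$ Then $$\limsup_{n\to\infty}\frac{S_n}{\sqrt{2n\log_2(n)}}=\sigma\qquad\text{with probability }1,$$ where $0\le\sigma<\infty$ is given by $\sigma^2=\lim_{n\to\infty}\frac1n E(S_n^2)$.
   Context: Setting: $(W_k)_{k\in\mathbb{Z}}$ is a (strictly) stationary, ergodic Markov chain on a probability space $(\Omega,\mathcal{A},P)$ endowed with an ergodic, measure-preserving transformation $\theta$ such that $W_k\circ\theta=W_{k+1}$ for all $k$. $X_k=g(W_k)$, where $g$ is a real measurable function with $E(X_0)=0$ and $E(X_0^2)<\infty$; $S_n=X_1+\cdots+X_n$; $\mathcal{F}_k=\sigma(\ldots,W_{k-1},W_k)$; $\|\cdot\|$ is the norm in $L^2(P)$; $\log_2(n)=\log(\log(n))$. It is known that if $\sum_n n^{-3/2}\|E(S_n\mid\mathcal{F}_0)\|<\infty$ (which is implied by the hypothesis of the claim), then $\sigma^2:=\lim_{n\to\infty}\frac1nE(S_n^2)$ exists and is finite. *)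

theory Defs
  imports "HOL-Probability.Probability"
begin

definition measure_preserving_map :: "'a measure \<Rightarrow> ('a \<Rightarrow> 'a) \<Rightarrow> bool" where
  "measure_preserving_map M \<theta> \<longleftrightarrow> \<theta> \<in> measurable M M \<and> distr M M \<theta> = M"

definition ergodic_map :: "'a measure \<Rightarrow> ('a \<Rightarrow> 'a) \<Rightarrow> bool" where
  "ergodic_map M \<theta> \<longleftrightarrow> measure_preserving_map M \<theta> \<and>
     (\<forall>A\<in>sets M. \<theta> -` A \<inter> space M = A \<longrightarrow> A \<in> null_sets M \<or> space M - A \<in> null_sets M)"

(* In the following, N serves only as the measurable state space; its measure plays no role. *)

definition past :: "'a measure \<Rightarrow> 'b measure \<Rightarrow> (int \<Rightarrow> 'a \<Rightarrow> 'b) \<Rightarrow> int \<Rightarrow> 'a measure" where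
  "past M N W k = sigma (space M) (\<Union>j\<in>{..k}. {W j -` A \<inter> space M | A. A \<in> sets N})"

definition markov_chain :: "'a measure \<Rightarrow> 'b measure \<Rightarrow> (int \<Rightarrow> 'a \<Rightarrow> 'b) \<Rightarrow> bool" where
  "markov_chain M N W \<longleftrightarrow>
     (\<forall>k. W k \<in> measurable M N) \<and>
     (\<forall>k. \<forall>A\<in>sets N. AE \<omega> in M.
        real_cond_exp M (past M N W k) (\<lambda>\<omega>. indicator A (W (k + 1) \<omega>)) \<omega> =
        real_cond_exp M (vimage_algebra (space M) (W k) N) (\<lambda>\<omega>. indicator A (W (k + 1) \<omega>)) \<omega>)"

definition path_law :: "'a measure \<Rightarrow> 'b measure \<Rightarrow> (int \<Rightarrow> 'a \<Rightarrow> 'b) \<Rightarrow> (int \<Rightarrow> 'b) measure" where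
  "path_law M N W = distr M (Pi\<^sub>M UNIV (\<lambda>_. N)) (\<lambda>\<omega> k. W k \<omega>)"

definition path_shift :: "(int \<Rightarrow> 'b) \<Rightarrow> int \<Rightarrow> 'b" where
  "path_shift x = (\<lambda>k. x (k + 1))"

definition strictly_stationary :: "'a measure \<Rightarrow> 'b measure \<Rightarrow> (int \<Rightarrow> 'a \<Rightarrow> 'b) \<Rightarrow> bool" where
  "strictly_stationary M N W \<longleftrightarrow> measure_preserving_map (path_law M N W) path_shift"

definition ergodic_process :: "'a measure \<Rightarrow> 'b measure \<Rightarrow> (int \<Rightarrow> 'a \<Rightarrow> 'b) \<Rightarrow> bool" where
  "ergodic_process M N W \<longleftrightarrow> ergodic_map (path_law M N W) path_shift"

definition partial_sum :: "('b \<Rightarrow> real) \<Rightarrow> (int \<Rightarrow> 'a \<Rightarrow> 'b) \<Rightarrow> nat \<Rightarrow> 'a \<Rightarrow> real" where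
  "partial_sum g W n \<omega> = (\<Sum>i=1..n. g (W (int i) \<omega>))"

(* For f with f^2 not integrable the value is 0, so this is the L2 norm only on square-integrable f. *)
definition norm_L2 :: "'a measure \<Rightarrow> ('a \<Rightarrow> real) \<Rightarrow> real" where
  "norm_L2 M f = sqrt (integral\<^sup>L M (\<lambda>\<omega>. (f \<omega>)\<^sup>2))"

end

theory Submission
  imports Defs "HOL-Real_Asymp.Real_Asymp"
begin

text \<open>Let \<open>V n = E(S n | F 0)\<close>. Dyadic averages of partial sums solve Poisson equations whose
  innovations have norm at most \<open>2 powr (- r / 2) * \<parallel>V (2 ^ r)\<parallel>\<close>; summing them gives a stationary martingale
  difference \<open>D\<close> such that the remainder \<open>R n = S n - M n\<close> satisfies \<open>\<Sum>j. 2 powr (- j / 2) * \<parallel>R (2 ^ j)\<parallel> < \<infinity>\<close>.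
  Binary expansion of \<open>n\<close> and the bound \<open>E (sup i. \<bar>f \<circ> \<theta>\<^sup>i\<bar> / sqrt (i + 1)) \<le> 3 * \<parallel>f\<parallel>\<close> then yield
  \<open>R n = O(sqrt n)\<close> almost surely, so only the law for \<open>M n\<close> is needed.

  Upper half: since \<open>exp (x - x\<^sup>2 / 6) \<le> 1 + x + x\<^sup>2 / 3\<close> for all real \<open>x\<close>, the process
  \<open>exp (l M n - l\<^sup>2 / 2 * ([M] n / 3 + 2 \<langle>M\<rangle> n / 3))\<close> is a supermartingale without any truncation, and
  by the ergodic theorem both variations are asymptotic to \<open>n \<parallel>D\<parallel>\<^sup>2\<close>.

  Lower half: for bounded \<open>D\<close> cut time into blocks at which the clock \<open>[M]\<close> passes \<open>r ^ j\<close>. The exact martingales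
  \<open>\<Prod>k. 1 + l * D k\<close> over a block give the Laplace transform of its increment conditionally on the
  past, and three values of \<open>l\<close> give a lower bound \<open>1 / (2 * j)\<close> for the probability of a large increment.
  General \<open>D\<close> follow by truncation and the upper half.\<close>

section \<open>Square integrable functions and Birkhoff sums\<close>

text \<open>The remainder \<open>R n\<close> is no martingale, so Doob's inequality does not control
  it between dyadic times; the dyadic maximal function replaces it, using only stationarity and
  second moments. The price is summability, not mere convergence, of the scaled norms at dyadic
  times. Write \<open>a q\<close> for \<open>2 powr (- q / 2)\<close> times the norm of
  \<open>V (2 ^ q)\<close>. At time \<open>2 ^ s\<close> the innovations of higher levels contribute
  the tail of \<open>a\<close> from \<open>s\<close> on, and these tails are summable in
  \<open>s\<close> exactly when \<open>(q + 1) * a q\<close> is summable. The factor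
  \<open>log n\<close> of the hypothesis supplies this \<open>q\<close>.

  In the lower half the factors \<open>1 + l * D k\<close> have conditional mean 1 whatever the
  conditional variance, and their logarithms contain the realised squares
  \<open>(D k)\<^sup>2\<close>; this is why the clock is \<open>[M]\<close> and not the conditional
  variation. Blocks are not independent, so the second Borel-Cantelli lemma is replaced by
  multiplying conditional bounds \<open>1 - 1 / (2 * j)\<close>. Stopping times are avoided: all
  events are observed at a fixed time \<open>n\<close>, and paths whose clock is late at time
  \<open>n\<close> form an error that vanishes as \<open>n\<close> grows.\<close>

definition square_integrable :: "'a measure \<Rightarrow> ('a \<Rightarrow> real) \<Rightarrow> bool" where
  "square_integrable M f \<longleftrightarrow> f \<in> borel_measurable M \<and> integrable M (\<lambda>x. (f x)\<^sup>2)"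

lemma square_integrableD [measurable_dest]:
  "square_integrable M f \<Longrightarrow> f \<in> borel_measurable M"
  by (simp add: square_integrable_def)

lemma square_integrable_integrable_square:
  "square_integrable M f \<Longrightarrow> integrable M (\<lambda>x. (f x)\<^sup>2)"
  by (simp add: square_integrable_def)

lemma square_integrable_mult:
  assumes f: "square_integrable M f" and g: "square_integrable M g"
  shows "integrable M (\<lambda>x. f x * g x)"
proof (rule Bochner_Integration.integrable_bound)
  show "integrable M (\<lambda>x. (f x)\<^sup>2 + (g x)\<^sup>2)"
    using f g by (simp add: square_integrable_def)
  show "(\<lambda>x. f x * g x) \<in> borel_measurable M"
    using f g by (auto simp: square_integrable_def)
  have "\<bar>a * b\<bar> \<le> a\<^sup>2 + b\<^sup>2" for a b :: real
  proof -
    have "0 \<le> (\<bar>a\<bar> - \<bar>b\<bar>)\<^sup>2" by simp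
    then have "2 * (\<bar>a\<bar> * \<bar>b\<bar>) \<le> a\<^sup>2 + b\<^sup>2" by (simp add: power2_diff)
    moreover have "0 \<le> \<bar>a\<bar> * \<bar>b\<bar>" by simp
    ultimately show ?thesis unfolding abs_mult by linarith
  qed
  then show "AE x in M. norm (f x * g x) \<le> norm ((f x)\<^sup>2 + (g x)\<^sup>2)"
    by (auto intro!: AE_I2)
qed

lemma square_integrable_cmult:
  "square_integrable M f \<Longrightarrow> square_integrable M (\<lambda>x. c * f x)"
  by (auto simp: square_integrable_def power_mult_distrib)

lemma square_integrable_uminus:
  "square_integrable M f \<Longrightarrow> square_integrable M (\<lambda>x. - f x)"
  by (auto simp: square_integrable_def)

lemma square_integrable_add:
  assumes f: "square_integrable M f" and g: "square_integrable M g"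
  shows "square_integrable M (\<lambda>x. f x + g x)"
proof -
  have "integrable M (\<lambda>x. (f x)\<^sup>2 + (g x)\<^sup>2 + 2 * (f x * g x))"
    using f g square_integrable_mult[OF f g] by (simp add: square_integrable_def)
  then show ?thesis
    using f g by (auto simp: square_integrable_def power2_sum mult.assoc)
qed

lemma square_integrable_diff:
  assumes f: "square_integrable M f" and g: "square_integrable M g"
  shows "square_integrable M (\<lambda>x. f x - g x)"
  using square_integrable_add[OF f square_integrable_uminus[OF g]] by simp

lemma square_integrable_zero: "square_integrable M (\<lambda>x. 0)"
  by (simp add: square_integrable_def)

lemma square_integrable_sum:
  assumes "\<And>i. i \<in> I \<Longrightarrow> square_integrable M (f i)"
  shows "square_integrable M (\<lambda>x. \<Sum>i\<in>I. f i x)"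
  using assms
  by (induction I rule: infinite_finite_induct)
     (auto intro: square_integrable_add square_integrable_zero)

lemma square_integrable_bound:
  assumes "square_integrable M g" "f \<in> borel_measurable M" "AE x in M. \<bar>f x\<bar> \<le> \<bar>g x\<bar>"
  shows "square_integrable M f"
proof -
  have "integrable M (\<lambda>x. (f x)\<^sup>2)"
    by (rule Bochner_Integration.integrable_bound[OF square_integrable_integrable_square[OF assms(1)]])
       (use assms(2,3) in \<open>auto simp: abs_le_square_iff[symmetric]\<close>)
  then show ?thesis using assms(2) by (simp add: square_integrable_def)
qed

lemma square_integrable_cong_AE:
  assumes "square_integrable M g" "f \<in> borel_measurable M" "AE x in M. f x = g x"
  shows "square_integrable M f"
  by (rule square_integrable_bound[OF assms(1,2)]) (use assms(3) in auto)

lemma (in finite_measure) square_integrable_const: "square_integrable M (\<lambda>x. c)"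
  by (simp add: square_integrable_def)

lemma (in finite_measure) square_integrable_integrable:
  assumes "square_integrable M f"
  shows "integrable M f"
  using square_integrable_mult[OF assms square_integrable_const[of 1]] by simp

lemma norm_L2_nonneg [simp]: "0 \<le> norm_L2 M f"
  by (simp add: norm_L2_def)

lemma norm_L2_power2: "(norm_L2 M f)\<^sup>2 = (\<integral>x. (f x)\<^sup>2 \<partial>M)"
  by (simp add: norm_L2_def)

lemma norm_L2_cong_AE:
  assumes "AE x in M. f x = g x" "f \<in> borel_measurable M" "g \<in> borel_measurable M"
  shows "norm_L2 M f = norm_L2 M g"
  unfolding norm_L2_def
  by (rule arg_cong[where f=sqrt], rule integral_cong_AE) (use assms in auto)

lemma norm_L2_cmult: "norm_L2 M (\<lambda>x. c * f x) = \<bar>c\<bar> * norm_L2 M f"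
  by (simp add: norm_L2_def power_mult_distrib real_sqrt_mult)

lemma norm_L2_uminus: "norm_L2 M (\<lambda>x. - f x) = norm_L2 M f"
  by (simp add: norm_L2_def)

lemma norm_L2_zero [simp]: "norm_L2 M (\<lambda>x. 0) = 0"
  by (simp add: norm_L2_def)

text \<open>Cauchy-Schwarz, from the quadratic polynomial in \<open>t\<close> that the integral of
  \<open>(t * f x - g x)\<^sup>2\<close> defines and that is never negative.\<close>

lemma integral_mult_le_norm_L2:
  assumes f: "square_integrable M f" and g: "square_integrable M g"
  shows "\<bar>\<integral>x. f x * g x \<partial>M\<bar> \<le> norm_L2 M f * norm_L2 M g"
proof -
  let ?A = "(\<integral>x. (f x)\<^sup>2 \<partial>M)" and ?B = "(\<integral>x. (g x)\<^sup>2 \<partial>M)" and ?C = "(\<integral>x. f x * g x \<partial>M)"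
  have pos: "0 \<le> t\<^sup>2 * ?A - 2 * t * ?C + ?B" for t
  proof -
    have "0 \<le> (\<integral>x. (t * f x - g x)\<^sup>2 \<partial>M)" by simp
    also have "(\<lambda>x. (t * f x - g x)\<^sup>2) = (\<lambda>x. t\<^sup>2 * (f x)\<^sup>2 - (2 * t) * (f x * g x) + (g x)\<^sup>2)"
      by (simp add: power2_diff power_mult_distrib algebra_simps)
    also have "(\<integral>x. t\<^sup>2 * (f x)\<^sup>2 - (2 * t) * (f x * g x) + (g x)\<^sup>2 \<partial>M) = t\<^sup>2 * ?A - 2 * t * ?C + ?B"
      using f g square_integrable_mult[OF f g] by (simp add: square_integrable_def)
    finally show ?thesis .
  qed
  have "?C\<^sup>2 \<le> ?A * ?B"
  proof (cases "?A = 0")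
    case True
    have "?C = 0"
    proof (rule ccontr)
      assume "?C \<noteq> 0"
      \<comment> \<open>With \<open>?A = 0\<close> the polynomial is linear, and at this
        \<open>t\<close> it would take the value -1.\<close>
      then have "(?B + 1) / (2 * ?C) * 2 * ?C = ?B + 1" by simp
      then show False using pos[of "(?B + 1) / (2 * ?C)"] True by (simp add: field_simps)
    qed
    then show ?thesis by simp
  next
    case False
    then have A: "?A > 0" by (simp add: order_less_le)
    have "0 \<le> ?A * ((?C / ?A)\<^sup>2 * ?A - 2 * (?C / ?A) * ?C + ?B)"
      using A pos[of "?C / ?A"] by (intro mult_nonneg_nonneg) auto
    also have "\<dots> = ?A * ?B - ?C\<^sup>2"
      using A by (simp add: field_simps power2_eq_square)
    finally show ?thesis by simp
  qed
  then have "sqrt (?C\<^sup>2) \<le> sqrt (?A * ?B)" by (rule real_sqrt_le_mono)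
  then show ?thesis by (simp add: norm_L2_def real_sqrt_mult)
qed

lemma norm_L2_triangle:
  assumes f: "square_integrable M f" and g: "square_integrable M g"
  shows "norm_L2 M (\<lambda>x. f x + g x) \<le> norm_L2 M f + norm_L2 M g"
proof (rule power2_le_imp_le)
  have "(norm_L2 M (\<lambda>x. f x + g x))\<^sup>2 = (\<integral>x. (f x)\<^sup>2 + (g x)\<^sup>2 + 2 * (f x * g x) \<partial>M)"
    by (simp add: norm_L2_power2 power2_sum mult.assoc)
  also have "\<dots> = (norm_L2 M f)\<^sup>2 + (norm_L2 M g)\<^sup>2 + 2 * (\<integral>x. f x * g x \<partial>M)"
    using f g square_integrable_mult[OF f g] by (simp add: square_integrable_def norm_L2_power2)
  also have "\<dots> \<le> (norm_L2 M f + norm_L2 M g)\<^sup>2"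
    using integral_mult_le_norm_L2[OF f g] by (simp add: power2_sum)
  finally show "(norm_L2 M (\<lambda>x. f x + g x))\<^sup>2 \<le> (norm_L2 M f + norm_L2 M g)\<^sup>2" .
qed simp

lemma norm_L2_triangle_diff:
  assumes f: "square_integrable M f" and g: "square_integrable M g"
  shows "norm_L2 M (\<lambda>x. f x - g x) \<le> norm_L2 M f + norm_L2 M g"
  using norm_L2_triangle[OF f square_integrable_uminus[OF g]] by (simp add: norm_L2_uminus)

lemma norm_L2_sum:
  assumes "finite I" "\<And>i. i \<in> I \<Longrightarrow> square_integrable M (f i)"
  shows "norm_L2 M (\<lambda>x. \<Sum>i\<in>I. f i x) \<le> (\<Sum>i\<in>I. norm_L2 M (f i))"
  using assms
proof (induction I rule: finite_induct)
  case (insert i I)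
  have "norm_L2 M (\<lambda>x. f i x + (\<Sum>i\<in>I. f i x)) \<le> norm_L2 M (f i) + norm_L2 M (\<lambda>x. \<Sum>i\<in>I. f i x)"
    using insert.prems by (intro norm_L2_triangle square_integrable_sum) auto
  with insert show ?case by simp
qed simp

lemma (in prob_space) integral_abs_le_norm_L2:
  assumes "square_integrable M f"
  shows "(\<integral>x. \<bar>f x\<bar> \<partial>M) \<le> norm_L2 M f"
proof -
  have "square_integrable M (\<lambda>x. \<bar>f x\<bar>)"
    using assms by (auto simp: square_integrable_def)
  from integral_mult_le_norm_L2[OF this square_integrable_const[of 1]]
  show ?thesis by (simp add: norm_L2_def prob_space)
qed

section \<open>Birkhoff sums and invariance of integrals under the map\<close>

definition birkhoff_sum :: "('a \<Rightarrow> 'a) \<Rightarrow> ('a \<Rightarrow> real) \<Rightarrow> nat \<Rightarrow> 'a \<Rightarrow> real" where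
  "birkhoff_sum \<theta> f n x = (\<Sum>k<n. f ((\<theta> ^^ k) x))"

lemma birkhoff_sum_0 [simp]: "birkhoff_sum \<theta> f 0 x = 0"
  by (simp add: birkhoff_sum_def)

lemma birkhoff_sum_1 [simp]: "birkhoff_sum \<theta> f (Suc 0) x = f x"
  by (simp add: birkhoff_sum_def)

lemma birkhoff_sum_Suc: "birkhoff_sum \<theta> f (Suc n) x = birkhoff_sum \<theta> f n x + f ((\<theta> ^^ n) x)"
  by (simp add: birkhoff_sum_def)

lemma birkhoff_sum_plus:
  "birkhoff_sum \<theta> f (m + n) x = birkhoff_sum \<theta> f m x + birkhoff_sum \<theta> f n ((\<theta> ^^ m) x)"
proof (induction n)
  case (Suc n)
  have "(\<theta> ^^ (m + n)) x = (\<theta> ^^ n) ((\<theta> ^^ m) x)"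
    by (metis add.commute comp_apply funpow_add)
  with Suc show ?case by (simp add: birkhoff_sum_Suc)
qed simp

lemma birkhoff_sum_Suc': "birkhoff_sum \<theta> f (Suc n) x = f x + birkhoff_sum \<theta> f n (\<theta> x)"
  using birkhoff_sum_plus[of \<theta> f 1 n x] by simp

lemma birkhoff_sum_add:
  "birkhoff_sum \<theta> (\<lambda>x. f x + g x) n x = birkhoff_sum \<theta> f n x + birkhoff_sum \<theta> g n x"
  by (simp add: birkhoff_sum_def sum.distrib)

lemma birkhoff_sum_diff:
  "birkhoff_sum \<theta> (\<lambda>x. f x - g x) n x = birkhoff_sum \<theta> f n x - birkhoff_sum \<theta> g n x"
  by (simp add: birkhoff_sum_def sum_subtractf)

lemma birkhoff_sum_uminus:
  "birkhoff_sum \<theta> (\<lambda>x. - f x) n x = - birkhoff_sum \<theta> f n x"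
  by (simp add: birkhoff_sum_def sum_negf)

lemma birkhoff_sum_cmult:
  "birkhoff_sum \<theta> (\<lambda>x. c * f x) n x = c * birkhoff_sum \<theta> f n x"
  by (simp add: birkhoff_sum_def sum_distrib_left)

lemma birkhoff_sum_const: "birkhoff_sum \<theta> (\<lambda>x. c) n x = real n * c"
  by (simp add: birkhoff_sum_def)

lemma birkhoff_sum_coboundary:
  "birkhoff_sum \<theta> (\<lambda>x. p x - p (\<theta> x)) n x = p x - p ((\<theta> ^^ n) x)"
  by (induction n) (auto simp: birkhoff_sum_Suc)

locale measure_preserving_system = prob_space M for M :: "'a measure" +
  fixes \<theta> :: "'a \<Rightarrow> 'a"
  assumes theta_measurable [measurable]: "\<theta> \<in> measurable M M"
    and distr_theta: "distr M M \<theta> = M"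
begin

abbreviation B where "B \<equiv> birkhoff_sum \<theta>"

lemma theta_power_measurable [measurable]: "\<theta> ^^ n \<in> measurable M M"
  by (induction n) auto

lemma distr_theta_power: "distr M M (\<theta> ^^ n) = M"
proof (induction n)
  case 0
  show ?case by (simp add: id_def distr_id)
next
  case (Suc n)
  have "distr M M (\<theta> ^^ Suc n) = distr (distr M M (\<theta> ^^ n)) M \<theta>"
    by (simp add: distr_distr del: funpow.simps) (simp add: comp_def)
  then show ?case by (simp only: Suc distr_theta)
qed

lemma theta_power_space: "x \<in> space M \<Longrightarrow> (\<theta> ^^ n) x \<in> space M"
  using theta_power_measurable[of n] by (rule measurable_space)

lemma nn_integral_theta_power:
  assumes [measurable]: "f \<in> borel_measurable M"
  shows "(\<integral>\<^sup>+x. f ((\<theta> ^^ n) x) \<partial>M) = (\<integral>\<^sup>+x. f x \<partial>M)"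
  by (subst (2) distr_theta_power[of n, symmetric]) (simp add: nn_integral_distr)

lemma integrable_theta_power:
  fixes f :: "'a \<Rightarrow> real"
  assumes "integrable M f"
  shows "integrable M (\<lambda>x. f ((\<theta> ^^ n) x))"
proof -
  have "integrable (distr M M (\<theta> ^^ n)) f" using assms by (simp add: distr_theta_power)
  then show ?thesis by (rule integrable_distr[OF theta_power_measurable])
qed

lemma integral_theta_power:
  fixes f :: "'a \<Rightarrow> real"
  assumes [measurable]: "f \<in> borel_measurable M"
  shows "(\<integral>x. f ((\<theta> ^^ n) x) \<partial>M) = (\<integral>x. f x \<partial>M)"
  by (subst (2) distr_theta_power[of n, symmetric]) (simp add: integral_distr)

lemma AE_theta_power:
  assumes "AE x in M. P x"
  shows "AE x in M. P ((\<theta> ^^ n) x)"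
proof -
  have "AE x in distr M M (\<theta> ^^ n). P x" using assms by (simp only: distr_theta_power)
  then show ?thesis by (rule AE_distrD[OF theta_power_measurable])
qed

lemma square_integrable_theta_power:
  assumes "square_integrable M f"
  shows "square_integrable M (\<lambda>x. f ((\<theta> ^^ n) x))"
  using assms integrable_theta_power[of "\<lambda>x. (f x)\<^sup>2" n]
  by (auto simp: square_integrable_def)

lemma norm_L2_theta_power:
  assumes "f \<in> borel_measurable M"
  shows "norm_L2 M (\<lambda>x. f ((\<theta> ^^ n) x)) = norm_L2 M f"
  unfolding norm_L2_def using integral_theta_power[of "\<lambda>x. (f x)\<^sup>2" n] assms by simp

lemmas integrable_theta = integrable_theta_power[of _ 1, simplified]
lemmas integral_theta = integral_theta_power[of _ 1, simplified]
lemmas AE_theta = AE_theta_power[of _ 1, simplified]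
lemmas square_integrable_theta = square_integrable_theta_power[of _ 1, simplified]
lemmas norm_L2_theta = norm_L2_theta_power[of _ 1, simplified]

lemma birkhoff_sum_measurable [measurable]:
  assumes [measurable]: "f \<in> borel_measurable M"
  shows "B f n \<in> borel_measurable M"
  unfolding birkhoff_sum_def[abs_def] by measurable

lemma square_integrable_birkhoff_sum:
  assumes "square_integrable M f"
  shows "square_integrable M (B f n)"
  unfolding birkhoff_sum_def[abs_def]
  by (intro square_integrable_sum square_integrable_theta_power assms)

lemma birkhoff_sum_cong_AE:
  assumes "AE x in M. f x = g x"
  shows "AE x in M. \<forall>n. B f n x = B g n x"
proof -
  have "AE x in M. \<forall>n. f ((\<theta> ^^ n) x) = g ((\<theta> ^^ n) x)"
    unfolding AE_all_countable using AE_theta_power[OF assms] by blast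
  then show ?thesis by eventually_elim (simp add: birkhoff_sum_def)
qed

end

section \<open>The pointwise ergodic theorem\<close>

locale ergodic_system = measure_preserving_system +
  assumes ergodic: "\<And>A. A \<in> sets M \<Longrightarrow> \<theta> -` A \<inter> space M = A \<Longrightarrow> A \<in> null_sets M \<or> space M - A \<in> null_sets M"
begin

text \<open>Garsia's argument: with \<open>F n = max\<^sub>k\<^sub>\<le>\<^sub>n B f k\<close> one has
  \<open>F (n + 1) - F n \<circ> \<theta> = max (- F n \<circ> \<theta>) f\<close>, whose integral is nonnegative and which decreases to
  \<open>f\<close> wherever the sums are unbounded.\<close>

lemma birkhoff_sum_bounded_above:
  assumes f: "integrable M f" and neg: "(\<integral>x. f x \<partial>M) < 0"
  shows "AE x in M. \<exists>c. \<forall>n. B f n x \<le> c"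
proof -
  have [measurable]: "f \<in> borel_measurable M" using f by auto
  define F where "F n x = Max ((\<lambda>k. B f k x) ` {..n})" for n x
  have F_Suc_max: "F (Suc n) x = max (F n x) (B f (Suc n) x)" for n x
    unfolding F_def by (simp add: atMost_Suc max.commute)
  have F_0: "F 0 x = 0" for x by (simp add: F_def)
  have F_meas [measurable]: "F n \<in> borel_measurable M" for n
  proof (induction n)
    case 0 then show ?case by (simp add: F_0[abs_def])
  next
    case (Suc n) then show ?case by (simp add: F_Suc_max[abs_def])
  qed
  have B_le_F: "B f k x \<le> F n x" if "k \<le> n" for k n x
    unfolding F_def using that by (intro Max_ge) auto
  have F_nonneg: "0 \<le> F n x" for n x using B_le_F[of 0 n x] by simp
  have F_mono: "F n x \<le> F m x" if "n \<le> m" for n m x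
    using that by (induction m rule: dec_induct) (auto simp: F_Suc_max intro: order_trans)
  have F_rec: "F (Suc n) x = max 0 (f x + F n (\<theta> x))" for n x
  proof (induction n)
    case 0
    show ?case by (simp add: F_Suc_max F_0)
  next
    case (Suc n)
    have "F (Suc (Suc n)) x = max (max 0 (f x + F n (\<theta> x))) (f x + B f (Suc n) (\<theta> x))"
      by (simp only: F_Suc_max[of "Suc n"] Suc birkhoff_sum_Suc'[of \<theta> f "Suc n"])
    also have "\<dots> = max 0 (f x + F (Suc n) (\<theta> x))"
      by (simp add: F_Suc_max[of n "\<theta> x"] max_def)
    finally show ?case .
  qed
  have F_int: "integrable M (F n)" for n
  proof (induction n)
    case 0 then show ?case by (simp add: F_0[abs_def])
  next
    case (Suc n)
    from integrable_theta[OF this] show ?case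
      unfolding F_rec[abs_def] using f by auto
  qed
  define A where "A = {x\<in>space M. \<forall>c::nat. \<exists>n. B f n x > real c}"
  have A_meas [measurable]: "A \<in> sets M" unfolding A_def by measurable
  have A_eq: "x \<in> A \<longleftrightarrow> (\<forall>c::real. \<exists>n. B f n x > c)" if "x \<in> space M" for x
  proof
    assume "x \<in> A"
    show "\<forall>c::real. \<exists>n. B f n x > c"
    proof
      fix c :: real
      obtain k :: nat where "c \<le> real k" using real_arch_simple by blast
      with \<open>x \<in> A\<close> show "\<exists>n. B f n x > c" unfolding A_def by (blast intro: le_less_trans)
    qed
  qed (use that in \<open>auto simp: A_def\<close>)
  have "\<theta> -` A \<inter> space M = A"
  proof -
    have "\<theta> x \<in> A \<longleftrightarrow> x \<in> A" if x: "x \<in> space M" for x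
    proof -
      have tx: "\<theta> x \<in> space M" using x theta_power_space[of x 1] by simp
      have 1: "\<exists>n. B f n x > c" if *: "\<forall>c. \<exists>n. B f n (\<theta> x) > c" for c
      proof -
        obtain n where "B f n (\<theta> x) > c - f x" using * by blast
        then show ?thesis by (intro exI[of _ "Suc n"]) (simp add: birkhoff_sum_Suc')
      qed
      have 2: "\<exists>n. B f n (\<theta> x) > c" if *: "\<forall>c. \<exists>n. B f n x > c" for c
      proof -
        \<comment> \<open>Exceeding 0 excludes the empty sum, so \<open>n\<close> is a successor and
          the first term can be split off.\<close>
        obtain n where n: "B f n x > max 0 (c + f x)" using * by blast
        then obtain m where "n = Suc m" by (cases n) auto
        with n show ?thesis by (intro exI[of _ m]) (simp add: birkhoff_sum_Suc')
      qed
      show ?thesis using 1 2 A_eq[OF x] A_eq[OF tx] by blast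
    qed
    moreover have "A \<subseteq> space M" by (auto simp: A_def)
    ultimately show ?thesis by auto
  qed
  with ergodic[OF A_meas] consider "A \<in> null_sets M" | "space M - A \<in> null_sets M" by blast
  then show ?thesis
  proof cases
    case 1
    then have "AE x in M. x \<notin> A" by (rule AE_not_in)
    then show ?thesis
    proof (rule AE_mp, intro AE_I2 impI)
      fix x assume "x \<in> space M" "x \<notin> A"
      then show "\<exists>c. \<forall>n. B f n x \<le> c" using A_eq by (auto simp: not_less)
    qed
  next
    case 2
    then have ae: "AE x in M. x \<in> A" by (rule AE_I') auto
    define h where "h n x = max (- F n (\<theta> x)) (f x)" for n x
    have h_eq: "h n x = F (Suc n) x - F n (\<theta> x)" for n x
      unfolding h_def F_rec by (simp add: max_def)
    have int_h: "0 \<le> (\<integral>x. h n x \<partial>M)" for n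
    proof -
      have "(\<integral>x. h n x \<partial>M) = (\<integral>x. F (Suc n) x \<partial>M) - (\<integral>x. F n (\<theta> x) \<partial>M)"
        unfolding h_eq using F_int integrable_theta[OF F_int] by (intro Bochner_Integration.integral_diff) auto
      also have "\<dots> = (\<integral>x. F (Suc n) x \<partial>M) - (\<integral>x. F n x \<partial>M)"
        by (simp add: integral_theta)
      also have "\<dots> \<ge> 0"
        using F_int F_mono[of n "Suc n"] by (auto intro!: integral_mono)
      finally show ?thesis .
    qed
    have lim: "(\<lambda>n. \<integral>x. h n x \<partial>M) \<longlonglongrightarrow> (\<integral>x. f x \<partial>M)"
    proof (rule integral_dominated_convergence)
      show "integrable M (\<lambda>x. \<bar>f x\<bar>)" using f by auto
      show "AE x in M. (\<lambda>n. h n x) \<longlonglongrightarrow> f x"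
        using AE_theta[OF ae]
      proof (rule AE_mp, intro AE_I2 impI)
        fix x assume x: "x \<in> space M" "\<theta> x \<in> A"
        then have "\<theta> x \<in> space M" by (auto simp: A_def)
        with x(2) A_eq obtain n where n: "B f n (\<theta> x) > - f x" by blast
        have "h m x = f x" if "m \<ge> n" for m
          using B_le_F[OF that, of "\<theta> x"] n unfolding h_def by simp
        then have "eventually (\<lambda>m. h m x = f x) sequentially"
          unfolding eventually_sequentially by blast
        then show "(\<lambda>n. h n x) \<longlonglongrightarrow> f x" by (rule tendsto_eventually)
      qed
      \<comment> \<open>Since \<open>F n\<close> is nonnegative, \<open>h n x\<close> lies between
        \<open>f x\<close> and \<open>max 0 (f x)\<close>.\<close>
      show "AE x in M. norm (h n x) \<le> \<bar>f x\<bar>" for n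
      proof (intro AE_I2)
        fix x show "norm (h n x) \<le> \<bar>f x\<bar>"
          using F_nonneg[of n "\<theta> x"] unfolding h_def real_norm_def by linarith
      qed
      show "h n \<in> borel_measurable M" for n unfolding h_def by measurable
    qed auto
    have "0 \<le> (\<integral>x. f x \<partial>M)" by (rule LIMSEQ_le_const[OF lim]) (use int_h in auto)
    with neg show ?thesis by simp
  qed
qed

text \<open>A level \<open>d\<close> strictly between the mean and \<open>c\<close> makes the mean
  of \<open>f - d\<close> negative; the random upper bound of its sums is eventually absorbed by
  \<open>(c - d) * n\<close>.\<close>

lemma birkhoff_upper:
  assumes f: "integrable M f" and c: "(\<integral>x. f x \<partial>M) < c"
  shows "AE x in M. eventually (\<lambda>n. B f n x \<le> c * real n) sequentially"
proof -
  obtain d where d: "(\<integral>x. f x \<partial>M) < d" "d < c" using dense[OF c] by blast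
  have "AE x in M. \<exists>K. \<forall>n. B (\<lambda>x. f x - d) n x \<le> K"
    using d f by (intro birkhoff_sum_bounded_above) (auto simp: prob_space)
  then show ?thesis
  proof (rule AE_mp, intro AE_I2 impI)
    fix x assume "\<exists>K. \<forall>n. B (\<lambda>x. f x - d) n x \<le> K"
    then obtain K where K: "B f n x \<le> K + real n * d" for n
      by (auto simp: birkhoff_sum_diff birkhoff_sum_const algebra_simps)
    have "eventually (\<lambda>n. real n \<ge> K / (c - d)) sequentially"
      by (simp add: eventually_sequentially) (meson le_trans nat_le_iff_add of_nat_mono real_arch_simple order_trans of_nat_le_iff)
    then show "eventually (\<lambda>n. B f n x \<le> c * real n) sequentially"
    proof eventually_elim
      case (elim n)
      then have "K \<le> real n * (c - d)" using d by (simp add: pos_divide_le_eq)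
      with K[of n] show ?case by (simp add: algebra_simps)
    qed
  qed
qed

theorem birkhoff_ergodic:
  assumes f: "integrable M f"
  shows "AE x in M. (\<lambda>n. B f n x / real n) \<longlonglongrightarrow> (\<integral>x. f x \<partial>M)"
proof -
  let ?m = "\<integral>x. f x \<partial>M"
  have "AE x in M. \<forall>k::nat. eventually (\<lambda>n. B f n x \<le> (?m + 1 / Suc k) * real n) sequentially"
    unfolding AE_all_countable using f by (auto intro!: birkhoff_upper)
  moreover have "AE x in M. \<forall>k::nat. eventually (\<lambda>n. B (\<lambda>x. - f x) n x \<le> (- ?m + 1 / Suc k) * real n) sequentially"
    unfolding AE_all_countable using f by (auto intro!: birkhoff_upper)
  ultimately show ?thesis
  proof eventually_elim
    case (elim x)
    show ?case
    proof (rule LIMSEQ_I)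
      fix e :: real assume "0 < e"
      then obtain k :: nat where k: "1 / Suc k < e"
        using nat_approx_posE by blast
      have "eventually (\<lambda>n. norm (B f n x / real n - ?m) < e) sequentially"
        using elim(1)[rule_format, of k] elim(2)[rule_format, of k] eventually_gt_at_top[of 0]
      proof eventually_elim
        case (elim n)
        then have "B f n x / real n \<le> ?m + 1 / Suc k" "- (B f n x / real n) \<le> - ?m + 1 / Suc k"
          by (auto simp: birkhoff_sum_uminus pos_divide_le_eq field_simps)
        with k show ?case by (auto simp: abs_less_iff)
      qed
      then show "\<exists>no. \<forall>n\<ge>no. norm (B f n x / real n - ?m) < e"
        by (simp add: eventually_sequentially)
    qed
  qed
qed

end

section \<open>Birkhoff sums of order \<open>sqrt n\<close>\<close>

lemma sum_inverse_sqrt_le: "(\<Sum>i<n. 1 / sqrt (real (Suc i))) \<le> 2 * sqrt (real n)"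
proof (induction n)
  case (Suc n)
  have pos: "sqrt (real (Suc n)) > 0" by simp
  have "1 \<le> 2 * (real (Suc n) - sqrt (real n) * sqrt (real (Suc n)))"
  proof -
    have "0 \<le> (sqrt (real (Suc n)) - sqrt (real n))\<^sup>2" by simp
    then show ?thesis by (simp add: power2_diff algebra_simps)
  qed
  then have "1 / sqrt (real (Suc n)) \<le> 2 * (sqrt (real (Suc n)) - sqrt (real n))"
    using pos by (simp add: field_simps)
  with Suc show ?case by simp
qed simp

context measure_preserving_system
begin

text \<open>Terms up to height \<open>d\<close> contribute \<open>d\<close>. By stationarity the
  excess terms can be integrated without the shift: a value \<open>t\<close> exceeds the height only
  at indices with \<open>i + 1 < (t / d)\<^sup>2\<close>, and there
  \<open>\<bar>t\<bar> / sqrt (i + 1)\<close> sums to at most \<open>2 * t\<^sup>2 / d\<close>,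
  whose integral is at most \<open>2 * d\<close>. The stride \<open>m\<close> is meant for dyadic
  blocks, which start at multiples of their length.\<close>

lemma nn_integral_scaled_maximal:
  assumes g: "square_integrable M g" and d: "0 < d" "norm_L2 M g \<le> d"
  shows "(\<integral>\<^sup>+x. (SUP i. ennreal (\<bar>g ((\<theta> ^^ (i * m)) x)\<bar> / sqrt (real (Suc i)))) \<partial>M) \<le> ennreal (3 * d)"
proof -
  have [measurable]: "g \<in> borel_measurable M" using g by (rule square_integrableD)
  define e where "e i t = (if d * sqrt (real (Suc i)) < \<bar>t\<bar> then \<bar>t\<bar> / sqrt (real (Suc i)) else 0)" for i :: nat and t :: real
  have e_nonneg: "0 \<le> e i t" for i t by (simp add: e_def)
  have [measurable]: "e i \<in> borel_measurable borel" for i unfolding e_def[abs_def] by measurable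
  have e_sum: "(\<Sum>i<n. e i t) \<le> 2 * t\<^sup>2 / d" for n t
  proof -
    define K where "K = nat \<lfloor>(t / d)\<^sup>2\<rfloor>"
    have "e i t \<le> (if i < K then \<bar>t\<bar> * (1 / sqrt (real (Suc i))) else 0)" for i
    proof (cases "d * sqrt (real (Suc i)) < \<bar>t\<bar>")
      case True
      then have "sqrt (real (Suc i)) < \<bar>t\<bar> / d" using d by (simp add: field_simps)
      then have "(sqrt (real (Suc i)))\<^sup>2 < (\<bar>t\<bar> / d)\<^sup>2" by (intro power_strict_mono) auto
      then have "real (Suc i) < (t / d)\<^sup>2" by (simp add: power_divide)
      then have "i < K" unfolding K_def by linarith
      then show ?thesis by (simp add: e_def)
    qed (simp add: e_def)
    then have "(\<Sum>i<n. e i t) \<le> (\<Sum>i<n. if i < K then \<bar>t\<bar> * (1 / sqrt (real (Suc i))) else 0)"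
      by (intro sum_mono)
    also have "\<dots> \<le> (\<Sum>i<max n K. if i < K then \<bar>t\<bar> * (1 / sqrt (real (Suc i))) else 0)"
      by (intro sum_mono2) auto
    also have "\<dots> = (\<Sum>i<K. \<bar>t\<bar> * (1 / sqrt (real (Suc i))))"
      by (rule sum.mono_neutral_cong_right) auto
    also have "\<dots> \<le> \<bar>t\<bar> * (2 * sqrt (real K))"
      unfolding sum_distrib_left[symmetric] by (intro mult_left_mono sum_inverse_sqrt_le) auto
    also have "\<dots> \<le> \<bar>t\<bar> * (2 * (\<bar>t\<bar> / d))"
    proof -
      have "real K \<le> (t / d)\<^sup>2" unfolding K_def by simp
      then have "sqrt (real K) \<le> \<bar>t\<bar> / d" using d by (intro real_le_lsqrt) (auto simp: power_divide)
      then show ?thesis by (intro mult_left_mono) auto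
    qed
    also have "\<dots> = 2 * t\<^sup>2 / d"
      by (simp add: power2_eq_square mult.left_commute[of "\<bar>t\<bar>" 2])
    finally show ?thesis .
  qed
  have e_suminf: "(\<Sum>i. ennreal (e i t)) \<le> ennreal (2 * t\<^sup>2 / d)" for t
    unfolding suminf_eq_SUP
    by (intro SUP_least, subst sum_ennreal) (auto simp: e_nonneg intro!: ennreal_leI e_sum)
  have "(\<Sum>i. \<integral>\<^sup>+x. ennreal (e i (g ((\<theta> ^^ (i * m)) x))) \<partial>M) = (\<Sum>i. \<integral>\<^sup>+x. ennreal (e i (g x)) \<partial>M)"
    by (intro suminf_cong nn_integral_theta_power[of "\<lambda>x. ennreal (e _ (g x))"]) measurable
  also have "\<dots> = (\<integral>\<^sup>+x. (\<Sum>i. ennreal (e i (g x))) \<partial>M)"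
    by (rule nn_integral_suminf[symmetric]) measurable
  also have "\<dots> \<le> (\<integral>\<^sup>+x. ennreal (2 * (g x)\<^sup>2 / d) \<partial>M)"
    by (intro nn_integral_mono e_suminf)
  also have "\<dots> = ennreal (\<integral>x. 2 * (g x)\<^sup>2 / d \<partial>M)"
    using g d by (intro nn_integral_eq_integral) (auto simp: square_integrable_def)
  also have "\<dots> \<le> ennreal (2 * d)"
  proof (rule ennreal_leI)
    have "(\<integral>x. 2 * (g x)\<^sup>2 / d \<partial>M) = 2 * (norm_L2 M g)\<^sup>2 / d"
      by (simp add: norm_L2_power2)
    moreover have "(norm_L2 M g)\<^sup>2 \<le> d\<^sup>2" using d by (intro power_mono) auto
    ultimately show "(\<integral>x. 2 * (g x)\<^sup>2 / d \<partial>M) \<le> 2 * d"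
      using d by (simp add: field_simps power2_eq_square)
  qed
  finally have tail: "(\<Sum>i. \<integral>\<^sup>+x. ennreal (e i (g ((\<theta> ^^ (i * m)) x))) \<partial>M) \<le> ennreal (2 * d)" .
  have "(\<integral>\<^sup>+x. (SUP i. ennreal (\<bar>g ((\<theta> ^^ (i * m)) x)\<bar> / sqrt (real (Suc i)))) \<partial>M)
      \<le> (\<integral>\<^sup>+x. ennreal d + (\<Sum>i. ennreal (e i (g ((\<theta> ^^ (i * m)) x)))) \<partial>M)"
  proof (intro nn_integral_mono SUP_least)
    fix x i
    show "ennreal (\<bar>g ((\<theta> ^^ (i * m)) x)\<bar> / sqrt (real (Suc i)))
        \<le> ennreal d + (\<Sum>i. ennreal (e i (g ((\<theta> ^^ (i * m)) x))))" (is "ennreal ?a \<le> _ + ?s")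
    proof (cases "d * sqrt (real (Suc i)) < \<bar>g ((\<theta> ^^ (i * m)) x)\<bar>")
      case True
      then have "ennreal ?a = ennreal (e i (g ((\<theta> ^^ (i * m)) x)))" by (simp add: e_def)
      also have "\<dots> = (\<Sum>i\<in>{i}. ennreal (e i (g ((\<theta> ^^ (i * m)) x))))" by simp
      also have "\<dots> \<le> ?s" by (intro sum_le_suminf) auto
      finally show ?thesis by (simp add: add_increasing)
    next
      case False
      then have "?a \<le> d" by (simp add: pos_divide_le_eq not_less)
      then show ?thesis by (intro add_increasing2 ennreal_leI) auto
    qed
  qed
  also have "\<dots> = ennreal d + (\<Sum>i. \<integral>\<^sup>+x. ennreal (e i (g ((\<theta> ^^ (i * m)) x))) \<partial>M)"
    by (subst nn_integral_add) (auto simp: emeasure_space_1 nn_integral_suminf)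
  also have "\<dots> \<le> ennreal d + ennreal (2 * d)"
    by (intro add_left_mono tail)
  also have "\<dots> = ennreal (d + 2 * d)"
    using d by (intro ennreal_plus[symmetric]) auto
  finally show ?thesis by simp
qed

text \<open>Block \<open>i\<close> of level \<open>r + 1\<close> is made of the blocks
  \<open>2 * i\<close> and \<open>2 * i + 1\<close> of level \<open>r\<close>, so the induction
  needs a general position \<open>i\<close>. The weights fit because
  \<open>Suc (2 * i + 1) = 2 * Suc i\<close>: going one level down doubles the argument of the root
  and halves the power of 2.\<close>

lemma birkhoff_sum_dyadic_bound:
  assumes y: "\<And>i j. \<bar>B f (2 ^ j) ((\<theta> ^^ (i * 2 ^ j)) x)\<bar> \<le> y j * sqrt (real (Suc i))"
    and n: "n < 2 ^ r"
  shows "\<bar>B f n ((\<theta> ^^ (i * 2 ^ r)) x)\<bar> \<le> (\<Sum>j<r. y j * sqrt (real (Suc i) * 2 ^ (r - j)))"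
  using n
proof (induction r arbitrary: n i)
  case (Suc r)
  have y0: "0 \<le> y j" for j using y[of j 0] by simp
  have pw: "(2::real) ^ (Suc r - j) = 2 * 2 ^ (r - j)" if "j < r" for j
    using that by (simp add: Suc_diff_le)
  have step: "(\<Sum>j<r. y j * sqrt (real k * 2 ^ (r - j))) \<le> (\<Sum>j<r. y j * sqrt (real (Suc i) * 2 ^ (Suc r - j)))"
    if k: "k \<le> 2 * Suc i" for k
  proof (intro sum_mono mult_left_mono y0 real_sqrt_le_mono)
    fix j assume "j \<in> {..<r}"
    then have "real (Suc i) * 2 ^ (Suc r - j) = real (2 * Suc i) * 2 ^ (r - j)"
      using pw[of j] by simp
    moreover have "real k * 2 ^ (r - j) \<le> real (2 * Suc i) * 2 ^ (r - j)"
      using k by (intro mult_right_mono) (auto simp del: of_nat_mult of_nat_Suc)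
    ultimately show "real k * 2 ^ (r - j) \<le> real (Suc i) * 2 ^ (Suc r - j)" by simp
  qed
  have idx: "i * 2 ^ Suc r = (2 * i) * 2 ^ r" by simp
  show ?case
  proof (cases "n < 2 ^ r")
    case True
    have "\<bar>B f n ((\<theta> ^^ (i * 2 ^ Suc r)) x)\<bar> \<le> (\<Sum>j<r. y j * sqrt (real (Suc (2 * i)) * 2 ^ (r - j)))"
      unfolding idx by (rule Suc.IH[OF True])
    also have "\<dots> \<le> (\<Sum>j<r. y j * sqrt (real (Suc i) * 2 ^ (Suc r - j)))"
      by (rule step) simp
    also have "\<dots> \<le> (\<Sum>j<Suc r. y j * sqrt (real (Suc i) * 2 ^ (Suc r - j)))"
      using y0 by simp
    finally show ?thesis .
  next
    case False
    \<comment> \<open>The leading binary digit of \<open>n\<close> is set: the left half of the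
      block is used in full, and the remaining \<open>m\<close> terms begin the right half.\<close>
    then obtain m where m: "n = 2 ^ r + m" using le_Suc_ex not_less by blast
    with Suc.prems have "m < 2 ^ r" by simp
    have "(\<theta> ^^ (2 ^ r)) ((\<theta> ^^ (2 * i * 2 ^ r)) x) = (\<theta> ^^ (Suc (2 * i) * 2 ^ r)) x"
      by (simp add: funpow_add)
    then have "B f n ((\<theta> ^^ (i * 2 ^ Suc r)) x)
        = B f (2 ^ r) ((\<theta> ^^ (2 * i * 2 ^ r)) x) + B f m ((\<theta> ^^ (Suc (2 * i) * 2 ^ r)) x)"
      unfolding idx m birkhoff_sum_plus by simp
    then have "\<bar>B f n ((\<theta> ^^ (i * 2 ^ Suc r)) x)\<bar>
        \<le> \<bar>B f (2 ^ r) ((\<theta> ^^ (2 * i * 2 ^ r)) x)\<bar> + \<bar>B f m ((\<theta> ^^ (Suc (2 * i) * 2 ^ r)) x)\<bar>"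
      by simp
    also have "\<dots> \<le> y r * sqrt (real (Suc (2 * i))) + (\<Sum>j<r. y j * sqrt (real (Suc (Suc (2 * i))) * 2 ^ (r - j)))"
      by (intro add_mono y Suc.IH \<open>m < 2 ^ r\<close>)
    also have "\<dots> \<le> y r * sqrt (real (Suc i) * 2 ^ (Suc r - r)) + (\<Sum>j<r. y j * sqrt (real (Suc i) * 2 ^ (Suc r - j)))"
      by (intro add_mono step mult_left_mono y0 real_sqrt_le_mono) auto
    finally show ?thesis by simp
  qed
qed simp

theorem birkhoff_sum_sqrt_bound:
  assumes f: "square_integrable M f"
    and sum: "summable (\<lambda>j. norm_L2 M (B f (2 ^ j)) / sqrt (2 ^ j))"
  shows "AE x in M. \<exists>K. \<forall>n. \<bar>B f n x\<bar> \<le> K * sqrt (real n)"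
proof -
  have [measurable]: "f \<in> borel_measurable M" using f by (rule square_integrableD)
  \<comment> \<open>The added 1 provides the strictly positive height that the maximal bound asks
    for; its contribution \<open>1 / sqrt (2 ^ j)\<close> is summable.\<close>
  define d where "d j = norm_L2 M (B f (2 ^ j)) + 1" for j :: nat
  have d_pos: "0 < d j" for j by (simp add: d_def add_nonneg_pos)
  define Y where "Y j x = (SUP i. ennreal (\<bar>B f (2 ^ j) ((\<theta> ^^ (i * 2 ^ j)) x)\<bar> / sqrt (real (Suc i))))" for j x
  have [measurable]: "Y j \<in> borel_measurable M" for j unfolding Y_def[abs_def] by measurable
  have Y_int: "(\<integral>\<^sup>+x. Y j x \<partial>M) \<le> ennreal (3 * d j)" for j
    unfolding Y_def by (rule nn_integral_scaled_maximal)
      (auto simp: d_def add_nonneg_pos intro: square_integrable_birkhoff_sum f)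
  have "summable (\<lambda>j. (1 / sqrt 2) ^ j)" by (rule summable_geometric) simp
  then have "summable (\<lambda>j. 3 * (norm_L2 M (B f (2 ^ j)) / sqrt (2 ^ j) + (1 / sqrt 2) ^ j))"
    by (intro summable_mult summable_add sum)
  moreover have "(1 / sqrt 2) ^ j = 1 / sqrt (2 ^ j)" for j
    by (simp add: real_sqrt_power power_one_over)
  ultimately have "summable (\<lambda>j. 3 * (norm_L2 M (B f (2 ^ j)) / sqrt (2 ^ j) + 1 / sqrt (2 ^ j)))"
    by (simp only:)
  moreover have "3 * (norm_L2 M (B f (2 ^ j)) / sqrt (2 ^ j) + 1 / sqrt (2 ^ j)) = 1 / sqrt (2 ^ j) * (3 * d j)" for j
    unfolding d_def add_divide_distrib[symmetric] by simp
  ultimately have sd: "summable (\<lambda>j. 1 / sqrt (2 ^ j) * (3 * d j))"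
    by (simp only:)
  have "(\<integral>\<^sup>+x. (\<Sum>j. ennreal (1 / sqrt (2 ^ j)) * Y j x) \<partial>M) = (\<Sum>j. ennreal (1 / sqrt (2 ^ j)) * (\<integral>\<^sup>+x. Y j x \<partial>M))"
    by (subst nn_integral_suminf) (auto simp: nn_integral_cmult)
  also have "\<dots> \<le> (\<Sum>j. ennreal (1 / sqrt (2 ^ j) * (3 * d j)))"
  proof (intro suminf_le)
    fix j
    have "ennreal (1 / sqrt (2 ^ j)) * (\<integral>\<^sup>+x. Y j x \<partial>M) \<le> ennreal (1 / sqrt (2 ^ j)) * ennreal (3 * d j)"
      by (intro mult_left_mono Y_int) simp
    also have "\<dots> = ennreal (1 / sqrt (2 ^ j) * (3 * d j))"
      by (rule ennreal_mult[symmetric]) (use d_pos[of j] in auto)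
    finally show "ennreal (1 / sqrt (2 ^ j)) * (\<integral>\<^sup>+x. Y j x \<partial>M) \<le> ennreal (1 / sqrt (2 ^ j) * (3 * d j))" .
  qed auto
  also have "\<dots> = ennreal (\<Sum>j. 1 / sqrt (2 ^ j) * (3 * d j))"
    by (rule suminf_ennreal2[OF _ sd]) (use d_pos in \<open>simp add: less_imp_le\<close>)
  also have "\<dots> < \<infinity>" by simp
  \<comment> \<open>A finite expectation makes the weighted sum of all the maximal functions finite
    almost everywhere; its value is the constant \<open>T\<close> of the pathwise bound.\<close>
  finally have "AE x in M. (\<Sum>j. ennreal (1 / sqrt (2 ^ j)) * Y j x) \<noteq> \<infinity>"
    by (intro nn_integral_PInf_AE) auto
  then show ?thesis
  proof (rule AE_mp, intro AE_I2 impI)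
    fix x assume fin: "(\<Sum>j. ennreal (1 / sqrt (2 ^ j)) * Y j x) \<noteq> \<infinity>"
    define T where "T = enn2real (\<Sum>j. ennreal (1 / sqrt (2 ^ j)) * Y j x)"
    define y where "y j = enn2real (Y j x)" for j
    have Y_fin: "Y j x < \<infinity>" for j
    proof -
      have "ennreal (1 / sqrt (2 ^ j)) * Y j x = (\<Sum>j\<in>{j}. ennreal (1 / sqrt (2 ^ j)) * Y j x)" by simp
      also have "\<dots> \<le> (\<Sum>j. ennreal (1 / sqrt (2 ^ j)) * Y j x)" by (intro sum_le_suminf) auto
      also have "\<dots> < \<infinity>" using fin by (simp add: less_top)
      finally show ?thesis by (auto simp: ennreal_mult_less_top)
    qed
    have y: "\<bar>B f (2 ^ j) ((\<theta> ^^ (i * 2 ^ j)) x)\<bar> \<le> y j * sqrt (real (Suc i))" for i j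
    proof -
      have "ennreal (\<bar>B f (2 ^ j) ((\<theta> ^^ (i * 2 ^ j)) x)\<bar> / sqrt (real (Suc i))) \<le> Y j x"
        unfolding Y_def by (rule SUP_upper) simp
      also have "Y j x = ennreal (y j)" using Y_fin[of j] by (simp add: y_def)
      finally have "\<bar>B f (2 ^ j) ((\<theta> ^^ (i * 2 ^ j)) x)\<bar> / sqrt (real (Suc i)) \<le> y j"
        by (simp add: y_def ennreal_le_iff)
      then show ?thesis by (simp add: pos_divide_le_eq)
    qed
    have Y_eq: "Y j x = ennreal (y j)" for j
      using Y_fin[of j] by (simp add: y_def)
    have T: "(\<Sum>j<r. 1 / sqrt (2 ^ j) * y j) \<le> T" for r
    proof -
      have "ennreal (\<Sum>j<r. 1 / sqrt (2 ^ j) * y j) = (\<Sum>j<r. ennreal (1 / sqrt (2 ^ j)) * Y j x)"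
        unfolding Y_eq by (subst sum_ennreal[symmetric]) (auto simp: y_def ennreal_mult[symmetric])
      also have "\<dots> \<le> (\<Sum>j. ennreal (1 / sqrt (2 ^ j)) * Y j x)" by (intro sum_le_suminf) auto
      also have "\<dots> = ennreal T" using fin by (simp add: T_def less_top)
      finally show ?thesis by (simp add: T_def ennreal_le_iff)
    qed
    have T0: "0 \<le> T" by (simp add: T_def)
    have "\<bar>B f n x\<bar> \<le> (sqrt 2 * T) * sqrt (real n)" for n
    proof (cases "n = 0")
      case False
      obtain r where r: "n < 2 ^ r" "2 ^ r \<le> 2 * n"
      proof -
        \<comment> \<open>Minimality gives \<open>2 ^ r \<le> 2 * n\<close>, hence the factor
          \<open>sqrt 2\<close> in the final constant.\<close>
        define r where "r = (LEAST r. n < 2 ^ r)"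
        have "n < 2 ^ n" by simp
        then have 1: "n < 2 ^ r" unfolding r_def by (rule LeastI)
        with False obtain q where q: "r = Suc q" by (cases r) auto
        then have "\<not> n < 2 ^ q" unfolding r_def using not_less_Least lessI by metis
        with q 1 show thesis using that[of r] by simp
      qed
      have "\<bar>B f n ((\<theta> ^^ (0 * 2 ^ r)) x)\<bar> \<le> (\<Sum>j<r. y j * sqrt (real (Suc 0) * 2 ^ (r - j)))"
        by (rule birkhoff_sum_dyadic_bound[OF y r(1)])
      also have "\<dots> = (\<Sum>j<r. sqrt (2 ^ r) * (1 / sqrt (2 ^ j) * y j))"
        by (intro sum.cong refl) (auto simp: power_diff real_sqrt_divide)
      also have "\<dots> \<le> sqrt (2 ^ r) * T"
        unfolding sum_distrib_left[symmetric] by (intro mult_left_mono T) auto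
      also have "\<dots> \<le> sqrt (2 * real n) * T"
      proof (intro mult_right_mono real_sqrt_le_mono T0)
        have "real (2 ^ r) \<le> real (2 * n)" using r(2) by (rule of_nat_mono)
        then show "2 ^ r \<le> 2 * real n" by simp
      qed
      finally show ?thesis by (simp add: real_sqrt_mult mult_ac)
    qed simp
    then show "\<exists>K. \<forall>n. \<bar>B f n x\<bar> \<le> K * sqrt (real n)" by blast
  qed
qed

end

section \<open>Upper half of the martingale law\<close>

text \<open>The expansion of \<open>ln (1 + x + a * x\<^sup>2)\<close> is
  \<open>x + (a - 1 / 2) * x\<^sup>2 + (1 / 3 - a) * x ^ 3 + ...\<close>; \<open>a = 1 / 3\<close>
  is the choice that removes the cubic term, which would spoil the inequality on one side of 0. The
  difference \<open>f\<close> then starts at order 4 and its derivative has the sign of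
  \<open>t\<close>.\<close>

lemma exp_minus_square_le: "exp (x - x\<^sup>2 / 6) \<le> 1 + x + x\<^sup>2 / 3" for x :: real
proof -
  have p: "1 + t + t\<^sup>2 / 3 > 0" for t :: real
  proof -
    have "1 + t + t\<^sup>2 / 3 = (t + 3 / 2)\<^sup>2 / 3 + 1 / 4" by (simp add: power2_eq_square field_simps)
    also have "\<dots> > 0" by (intro add_nonneg_pos) auto
    finally show ?thesis .
  qed
  define f where "f t = ln (1 + t + t\<^sup>2 / 3) - t + t\<^sup>2 / 6" for t :: real
  have f': "(f has_real_derivative t ^ 3 / (9 * (1 + t + t\<^sup>2 / 3))) (at t)" for t
  proof -
    have "(f has_real_derivative (1 + 2 * t / 3) / (1 + t + t\<^sup>2 / 3) - 1 + t / 3) (at t)"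
      unfolding f_def using p[of t] by (auto intro!: derivative_eq_intros)
    also have "(1 + 2 * t / 3) / (1 + t + t\<^sup>2 / 3) - 1 + t / 3 = t ^ 3 / (9 * (1 + t + t\<^sup>2 / 3))"
    proof -
      have "(1 + 2 * t / 3) / q - 1 + t / 3 = t ^ 3 / (9 * q)" if "q > 0" "q = 1 + t + t\<^sup>2 / 3" for q
      proof -
        have num: "(1 + 2 * t / 3) - q + t / 3 * q = t ^ 3 / 9"
          unfolding that(2) by (simp add: power2_eq_square power3_eq_cube field_simps)
        have "(1 + 2 * t / 3) / q - 1 + t / 3 = ((1 + 2 * t / 3) - q + t / 3 * q) / q"
          using that(1) by (simp add: add_divide_distrib diff_divide_distrib)
        then show ?thesis unfolding num by simp
      qed
      then show ?thesis using p[of t] by blast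
    qed
    finally show ?thesis .
  qed
  have "0 \<le> f x"
  proof (cases "0 \<le> x")
    case True
    have "f 0 \<le> f x"
    proof (rule DERIV_nonneg_imp_nondecreasing[OF True])
      fix t :: real assume "0 \<le> t"
      then show "\<exists>y. DERIV f t :> y \<and> 0 \<le> y"
        by (intro exI[of _ "t ^ 3 / (9 * (1 + t + t\<^sup>2 / 3))"] conjI f' divide_nonneg_pos mult_pos_pos p) auto
    qed
    then show ?thesis by (simp add: f_def)
  next
    case False
    then have "x \<le> 0" by simp
    have "f 0 \<le> f x"
    proof (rule DERIV_nonpos_imp_nonincreasing[OF \<open>x \<le> 0\<close>])
      fix t assume "x \<le> t" "t \<le> 0"
      then have "t ^ 3 \<le> 0" by (simp add: power3_eq_cube mult_le_0_iff zero_le_mult_iff)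
      then show "\<exists>y. DERIV f t :> y \<and> y \<le> 0"
        by (intro exI[of _ "t ^ 3 / (9 * (1 + t + t\<^sup>2 / 3))"] conjI f' divide_nonpos_pos mult_pos_pos p) auto
    qed
    then show ?thesis by (simp add: f_def)
  qed
  then have "x - x\<^sup>2 / 6 \<le> ln (1 + x + x\<^sup>2 / 3)" by (simp add: f_def)
  then have "exp (x - x\<^sup>2 / 6) \<le> exp (ln (1 + x + x\<^sup>2 / 3))" by simp
  then show ?thesis using p[of x] by simp
qed

section \<open>Filtration pulled back along the map, and supermartingale tools\<close>

locale filtered_system = ergodic_system +
  fixes G :: "'a measure"
  assumes subalg_G: "subalgebra M G"
    and G_past: "\<And>A. A \<in> sets G \<Longrightarrow> \<exists>B\<in>sets G. A = \<theta> -` B \<inter> space M"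

sublocale filtered_system \<subseteq> G: finite_measure_subalgebra M G
  by unfold_locales (rule subalg_G)

context filtered_system
begin

abbreviation C where "C \<equiv> real_cond_exp M G"

text \<open>\<open>G\<close> is the past up to time 0, and its pullback under \<open>n\<close> steps
  is the past up to time \<open>n\<close>; no inverse of \<theta> is involved. The assumption
  \<open>G_past\<close> says that \<open>Filt 0\<close> is contained in \<open>Filt 1\<close>, which
  makes the family increasing.\<close>

definition Filt :: "nat \<Rightarrow> 'a measure" where
  "Filt n = vimage_algebra (space M) (\<theta> ^^ n) G"

lemma space_G: "space G = space M" using subalg_G by (simp add: subalgebra_def)

lemma sets_G_M: "A \<in> sets G \<Longrightarrow> A \<in> sets M" using subalg_G by (auto simp: subalgebra_def)

lemma space_Filt [simp]: "space (Filt n) = space M" by (simp add: Filt_def)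

lemma theta_power_Pi: "\<theta> ^^ n \<in> space M \<rightarrow> space G"
  using theta_power_space by (auto simp: space_G)

lemma sets_Filt: "sets (Filt n) = {(\<theta> ^^ n) -` B \<inter> space M | B. B \<in> sets G}"
  unfolding Filt_def using theta_power_Pi by (rule sets_vimage_algebra2)

lemma subalg_Filt: "subalgebra M (Filt n)"
  unfolding subalgebra_def sets_Filt using sets_G_M by (auto intro!: measurable_sets[OF theta_power_measurable])

lemma sets_Filt_Suc: "sets (Filt n) \<subseteq> sets (Filt (Suc n))"
proof
  fix A assume "A \<in> sets (Filt n)"
  then obtain B where B: "B \<in> sets G" "A = (\<theta> ^^ n) -` B \<inter> space M" by (auto simp: sets_Filt)
  obtain B' where B': "B' \<in> sets G" "B = \<theta> -` B' \<inter> space M" using G_past[OF B(1)] by blast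
  have "A = (\<theta> ^^ Suc n) -` B' \<inter> space M"
    using B(2) B'(2) theta_power_space by auto
  with B'(1) show "A \<in> sets (Filt (Suc n))" unfolding sets_Filt by blast
qed

lemma sets_Filt_mono: "m \<le> n \<Longrightarrow> sets (Filt m) \<subseteq> sets (Filt n)"
  by (induction n rule: dec_induct) (use sets_Filt_Suc in auto)

lemma measurable_Filt_mono: "f \<in> measurable (Filt m) N \<Longrightarrow> m \<le> n \<Longrightarrow> f \<in> measurable (Filt n) N"
  using sets_Filt_mono[of m n] by (auto simp: measurable_def)

lemma measurable_Filt_M: "f \<in> measurable (Filt m) N \<Longrightarrow> f \<in> measurable M N"
  by (rule measurable_from_subalg[OF subalg_Filt])

lemma sets_Filt_0: "sets (Filt 0) = sets G"
proof -
  have "B \<inter> space M = B" if "B \<in> sets G" for B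
    using sets.sets_into_space[OF that] space_G by auto
  then show ?thesis by (auto simp: sets_Filt)
qed

lemma theta_power_measurable_Filt: "\<theta> ^^ k \<in> measurable (Filt (n + k)) (Filt n)"
proof (rule measurableI)
  fix A assume "A \<in> sets (Filt n)"
  then obtain B where B: "B \<in> sets G" "A = (\<theta> ^^ n) -` B \<inter> space M" by (auto simp: sets_Filt)
  then have "(\<theta> ^^ k) -` A \<inter> space (Filt (n + k)) = (\<theta> ^^ (n + k)) -` B \<inter> space M"
    using theta_power_space by (auto simp: funpow_add)
  with B show "(\<theta> ^^ k) -` A \<inter> space (Filt (n + k)) \<in> sets (Filt (n + k))"
    unfolding sets_Filt by blast
qed (simp add: theta_power_space)

lemma measurable_Filt_shift:
  assumes "f \<in> measurable (Filt n) N" "n + k \<le> m"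
  shows "(\<lambda>x. f ((\<theta> ^^ k) x)) \<in> measurable (Filt m) N"
  using measurable_Filt_mono[OF measurable_compose[OF theta_power_measurable_Filt assms(1)] assms(2)] .

lemma measurable_G_Filt_0: "f \<in> measurable G N \<Longrightarrow> f \<in> measurable (Filt 0) N"
  by (simp add: measurable_def sets_Filt_0 space_G)

lemma measurable_G_M: "f \<in> measurable G N \<Longrightarrow> f \<in> measurable M N"
  by (rule measurable_from_subalg[OF subalg_G])

text \<open>One supermartingale step: a factor with conditional mean at most 1 given
  \<open>G\<close> has, after the shift by \<open>n\<close>, conditional mean at most 1 given
  \<open>Filt n\<close>. Nonnegative integrals spare any integrability condition on \<phi>.\<close>

lemma nn_integral_mult_shift_le:
  assumes z [measurable]: "z \<in> borel_measurable M"
    and le: "\<And>A. A \<in> sets G \<Longrightarrow> (\<integral>\<^sup>+x. z x * indicator A x \<partial>M) \<le> emeasure M A"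
    and \<phi>: "\<phi> \<in> borel_measurable (Filt n)"
  shows "(\<integral>\<^sup>+x. \<phi> x * z ((\<theta> ^^ n) x) \<partial>M) \<le> (\<integral>\<^sup>+x. \<phi> x \<partial>M)"
proof -
  have [measurable]: "\<phi> \<in> borel_measurable M" using \<phi> by (rule measurable_Filt_M)
  \<comment> \<open>On sets of \<open>Filt n\<close> the measure with this density is dominated by
    \<open>M\<close>, so the same holds for integrals of functions measurable for
    \<open>Filt n\<close>.\<close>
  define N where "N = density M (\<lambda>x. z ((\<theta> ^^ n) x))"
  have sub: "subalgebra N (Filt n)" using subalg_Filt by (simp add: N_def subalgebra_def)
  have "restr_to_subalg N (Filt n) \<le> restr_to_subalg M (Filt n)"
  proof (subst le_measure)
    show "sets (restr_to_subalg N (Filt n)) = sets (restr_to_subalg M (Filt n))"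
      by (simp add: sets_restr_to_subalg sub subalg_Filt)
    show "\<forall>A\<in>sets (restr_to_subalg N (Filt n)).
        emeasure (restr_to_subalg N (Filt n)) A \<le> emeasure (restr_to_subalg M (Filt n)) A"
    proof
      fix A assume "A \<in> sets (restr_to_subalg N (Filt n))"
      then have A: "A \<in> sets (Filt n)" by (simp add: sets_restr_to_subalg sub)
      then obtain B where B: "B \<in> sets G" "A = (\<theta> ^^ n) -` B \<inter> space M" by (auto simp: sets_Filt)
      have [measurable]: "B \<in> sets M" using B(1) by (rule sets_G_M)
      have [measurable]: "A \<in> sets M" unfolding B(2) by measurable
      have "emeasure N A = (\<integral>\<^sup>+x. z ((\<theta> ^^ n) x) * indicator A x \<partial>M)"
        unfolding N_def by (rule emeasure_density) measurable
      also have "\<dots> = (\<integral>\<^sup>+x. z ((\<theta> ^^ n) x) * indicator B ((\<theta> ^^ n) x) \<partial>M)"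
        by (intro nn_integral_cong) (auto simp: B(2) indicator_def)
      also have "\<dots> = (\<integral>\<^sup>+x. z x * indicator B x \<partial>M)"
        by (rule nn_integral_theta_power) measurable
      also have "\<dots> \<le> emeasure M B" by (rule le[OF B(1)])
      also have "emeasure M B = emeasure (distr M M (\<theta> ^^ n)) B" by (simp add: distr_theta_power)
      also have "\<dots> = emeasure M A" unfolding B(2) by (rule emeasure_distr) measurable
      finally show "emeasure (restr_to_subalg N (Filt n)) A \<le> emeasure (restr_to_subalg M (Filt n)) A"
        using A by (simp add: emeasure_restr_to_subalg sub subalg_Filt)
    qed
  qed
  then have "(\<integral>\<^sup>+x. \<phi> x \<partial>restr_to_subalg N (Filt n)) \<le> (\<integral>\<^sup>+x. \<phi> x \<partial>restr_to_subalg M (Filt n))"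
    by (intro nn_integral_mono_measure) (simp_all add: sets_restr_to_subalg sub subalg_Filt)
  then have "(\<integral>\<^sup>+x. \<phi> x \<partial>N) \<le> (\<integral>\<^sup>+x. \<phi> x \<partial>M)"
    by (simp add: nn_integral_subalgebra2[OF sub \<phi>] nn_integral_subalgebra2[OF subalg_Filt \<phi>])
  moreover have "(\<integral>\<^sup>+x. \<phi> x \<partial>N) = (\<integral>\<^sup>+x. z ((\<theta> ^^ n) x) * \<phi> x \<partial>M)"
    unfolding N_def by (rule nn_integral_density) measurable
  ultimately show ?thesis by (simp add: mult.commute)
qed

text \<open>Doob's inequality for nonnegative supermartingales, without stopping times: the
  induction tracks the mass of the paths that have crossed the level.\<close>

lemma maximal_inequality:
  assumes Y: "\<And>n. Y n \<in> borel_measurable (Filt n)"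
    and super: "\<And>n A. A \<in> sets (Filt n) \<Longrightarrow>
      (\<integral>\<^sup>+x. Y (Suc n) x * indicator A x \<partial>M) \<le> (\<integral>\<^sup>+x. Y n x * indicator A x \<partial>M)"
  shows "c * emeasure M {x\<in>space M. \<exists>k\<le>n. c \<le> Y k x} \<le> (\<integral>\<^sup>+x. Y 0 x \<partial>M)"
proof -
  define H where "H n = {x\<in>space M. \<exists>k\<le>n. c \<le> Y k x}" for n
  have [measurable]: "Y n \<in> borel_measurable M" for n by (rule measurable_Filt_M[OF Y])
  have H_Filt: "H n \<in> sets (Filt n)" for n
  proof -
    have "{x\<in>space (Filt n). c \<le> Y k x} \<in> sets (Filt n)" if "k \<le> n" for k
      using measurable_Filt_mono[OF Y that] by measurable
    then have "(\<Union>k\<in>{..n}. {x\<in>space (Filt n). c \<le> Y k x}) \<in> sets (Filt n)" by auto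
    also have "(\<Union>k\<in>{..n}. {x\<in>space (Filt n). c \<le> Y k x}) = H n" by (auto simp: H_def)
    finally show ?thesis .
  qed
  have [measurable]: "H n \<in> sets M" for n using H_Filt[of n] subalg_Filt[of n] by (auto simp: subalgebra_def)
  \<comment> \<open>Paths that have crossed are charged \<open>c\<close>, all others their current
    value. A path crossing at time \<open>n + 1\<close> has value at least \<open>c\<close> there,
    so the total never increases.\<close>
  have "c * emeasure M (H n) + (\<integral>\<^sup>+x. Y n x * indicator (space M - H n) x \<partial>M) \<le> (\<integral>\<^sup>+x. Y 0 x \<partial>M)"
  proof (induction n)
    case 0
    have "c * emeasure M (H 0) + (\<integral>\<^sup>+x. Y 0 x * indicator (space M - H 0) x \<partial>M)
        = (\<integral>\<^sup>+x. c * indicator (H 0) x + Y 0 x * indicator (space M - H 0) x \<partial>M)"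
      by (subst nn_integral_add) (auto simp: nn_integral_cmult_indicator)
    also have "\<dots> \<le> (\<integral>\<^sup>+x. Y 0 x \<partial>M)"
      by (intro nn_integral_mono) (auto simp: H_def indicator_def)
    finally show ?case .
  next
    case (Suc n)
    let ?J = "H (Suc n) - H n"
    have sub: "H n \<subseteq> H (Suc n)" by (auto simp: H_def intro: le_SucI)
    then have "emeasure M (H (Suc n)) = emeasure M (H n) + emeasure M ?J"
      by (subst plus_emeasure) (auto intro!: arg_cong[where f="emeasure M"])
    then have "c * emeasure M (H (Suc n)) + (\<integral>\<^sup>+x. Y (Suc n) x * indicator (space M - H (Suc n)) x \<partial>M)
      = c * emeasure M (H n) + (c * emeasure M ?J + (\<integral>\<^sup>+x. Y (Suc n) x * indicator (space M - H (Suc n)) x \<partial>M))"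
      by (simp add: distrib_left add.assoc)
    also have "c * emeasure M ?J + (\<integral>\<^sup>+x. Y (Suc n) x * indicator (space M - H (Suc n)) x \<partial>M)
      = (\<integral>\<^sup>+x. c * indicator ?J x + Y (Suc n) x * indicator (space M - H (Suc n)) x \<partial>M)"
      by (subst nn_integral_add) (auto simp: nn_integral_cmult_indicator)
    also have "\<dots> \<le> (\<integral>\<^sup>+x. Y (Suc n) x * indicator (space M - H n) x \<partial>M)"
    proof (intro nn_integral_mono)
      fix x assume x: "x \<in> space M"
      show "c * indicator ?J x + Y (Suc n) x * indicator (space M - H (Suc n)) x
          \<le> Y (Suc n) x * indicator (space M - H n) x"
        using x sub by (auto simp: H_def indicator_def le_Suc_eq)
    qed
    also have "\<dots> \<le> (\<integral>\<^sup>+x. Y n x * indicator (space M - H n) x \<partial>M)"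
    proof (rule super)
      show "space M - H n \<in> sets (Filt n)" using sets.compl_sets[OF H_Filt[of n]] by simp
    qed
    finally show ?case using Suc by (meson add_left_mono order_trans)
  qed
  then have "c * emeasure M (H n) \<le> (\<integral>\<^sup>+x. Y 0 x \<partial>M)"
    by (rule order_trans[rotated]) simp
  then show ?thesis by (simp add: H_def)
qed

text \<open>A single function encodes the whole sequence: the increments of \<open>B D n\<close> are
  the shifts of \<open>D\<close>, and the shift by \<open>k\<close> belongs to
  \<open>Filt (k + 1)\<close> and is centred given \<open>Filt k\<close>.\<close>

definition martingale_difference :: "('a \<Rightarrow> real) \<Rightarrow> bool" where
  "martingale_difference D \<longleftrightarrow>
     D \<in> borel_measurable (Filt 1) \<and> square_integrable M D \<and> (AE x in M. C D x = 0)"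

lemma martingale_difference_uminus:
  assumes "martingale_difference D"
  shows "martingale_difference (\<lambda>x. - D x)"
proof -
  have "square_integrable M D" using assms by (simp add: martingale_difference_def)
  then have "AE x in M. C (\<lambda>x. - 1 * D x) x = - 1 * C D x"
    by (intro G.real_cond_exp_cmult square_integrable_integrable)
  with assms show ?thesis
    by (auto simp: martingale_difference_def square_integrable_uminus)
qed

lemma integral_mult_C:
  assumes "integrable M (\<lambda>x. \<psi> x * f x)" "\<psi> \<in> borel_measurable G" "f \<in> borel_measurable M"
  shows "(\<integral>x. \<psi> x * C f x \<partial>M) = (\<integral>x. \<psi> x * f x \<partial>M)"
  using G.real_cond_exp_intg(2)[OF assms] .

text \<open>By \<open>exp_minus_square_le\<close> the conditional mean of
  \<open>exp (l * D x - l\<^sup>2 / 6 * (D x)\<^sup>2)\<close> is at most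
  \<open>1 + l\<^sup>2 / 3 * v x\<close>, since the linear term is centred, and this is at most
  \<open>exp (l\<^sup>2 / 3 * v x)\<close>. The maximum with 0 selects a version of the conditional
  variance that is nonnegative everywhere.\<close>

lemma exp_martingale_difference_le:
  assumes D: "martingale_difference D"
    and v: "v = (\<lambda>x. max 0 (C (\<lambda>x. (D x)\<^sup>2) x))"
    and A: "A \<in> sets G"
  shows "(\<integral>\<^sup>+x. ennreal (exp (l * D x - l\<^sup>2 / 6 * (D x)\<^sup>2 - l\<^sup>2 / 3 * v x)) * indicator A x \<partial>M) \<le> emeasure M A"
proof -
  have sq: "square_integrable M D" using D by (simp add: martingale_difference_def)
  have [measurable]: "D \<in> borel_measurable M" using sq by (rule square_integrableD)
  have [measurable]: "A \<in> sets M" using A by (rule sets_G_M)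
  have intD: "integrable M D" using sq by (rule square_integrable_integrable)
  have intD2: "integrable M (\<lambda>x. (D x)\<^sup>2)" using sq by (rule square_integrable_integrable_square)
  have vG [measurable]: "v \<in> borel_measurable G" unfolding v by measurable
  have [measurable]: "v \<in> borel_measurable M" by (rule measurable_G_M[OF vG])
  have v_AE: "AE x in M. v x = C (\<lambda>x. (D x)\<^sup>2) x"
    using G.real_cond_exp_pos[of "\<lambda>x. (D x)\<^sup>2"] by (auto simp: v)
  have v0: "0 \<le> v x" for x by (simp add: v)
  have intv: "integrable M v"
    using G.real_cond_exp_int(1)[OF intD2] unfolding v by auto
  \<comment> \<open>This weight is measurable for \<open>G\<close> and bounded by 1, so every
    product with it stays integrable and conditioning can be carried out under the integral.\<close>
  define \<psi> where "\<psi> x = indicator A x * exp (- (l\<^sup>2 / 3 * v x))" for x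
  have \<psi>G: "\<psi> \<in> borel_measurable G" unfolding \<psi>_def[abs_def] using A by measurable
  have [measurable]: "\<psi> \<in> borel_measurable M" by (rule measurable_G_M[OF \<psi>G])
  have \<psi>_bd: "0 \<le> \<psi> x" "\<psi> x \<le> 1" for x
    using v0[of x] by (auto simp: \<psi>_def indicator_def)
  have int\<psi>: "integrable M (\<lambda>x. \<psi> x * f x)" if "integrable M f" for f
  proof (rule Bochner_Integration.integrable_bound[OF that])
    show "(\<lambda>x. \<psi> x * f x) \<in> borel_measurable M" using that by auto
    show "AE x in M. norm (\<psi> x * f x) \<le> norm (f x)"
      using \<psi>_bd by (intro AE_I2) (simp add: abs_mult mult_left_le_one_le)
  qed
  have int\<psi>1: "integrable M \<psi>" using int\<psi>[of "\<lambda>_. 1"] by simp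
  have "(\<integral>\<^sup>+x. ennreal (exp (l * D x - l\<^sup>2 / 6 * (D x)\<^sup>2 - l\<^sup>2 / 3 * v x)) * indicator A x \<partial>M)
      \<le> (\<integral>\<^sup>+x. ennreal (\<psi> x + l * (\<psi> x * D x) + l\<^sup>2 / 3 * (\<psi> x * (D x)\<^sup>2)) \<partial>M)"
  proof (intro nn_integral_mono)
    fix x
    have "exp (l * D x - l\<^sup>2 / 6 * (D x)\<^sup>2 - l\<^sup>2 / 3 * v x)
        = exp (- (l\<^sup>2 / 3 * v x)) * exp ((l * D x) - (l * D x)\<^sup>2 / 6)"
      by (simp add: exp_add[symmetric] power_mult_distrib)
    also have "\<dots> \<le> exp (- (l\<^sup>2 / 3 * v x)) * (1 + l * D x + (l * D x)\<^sup>2 / 3)"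
      by (intro mult_left_mono exp_minus_square_le) auto
    finally show "ennreal (exp (l * D x - l\<^sup>2 / 6 * (D x)\<^sup>2 - l\<^sup>2 / 3 * v x)) * indicator A x
        \<le> ennreal (\<psi> x + l * (\<psi> x * D x) + l\<^sup>2 / 3 * (\<psi> x * (D x)\<^sup>2))"
      by (auto simp: \<psi>_def indicator_def power_mult_distrib algebra_simps intro!: ennreal_leI)
  qed
  also have "\<dots> = ennreal (\<integral>x. \<psi> x + l * (\<psi> x * D x) + l\<^sup>2 / 3 * (\<psi> x * (D x)\<^sup>2) \<partial>M)"
  proof (rule nn_integral_eq_integral)
    show "AE x in M. 0 \<le> \<psi> x + l * (\<psi> x * D x) + l\<^sup>2 / 3 * (\<psi> x * (D x)\<^sup>2)"
    proof (intro AE_I2)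
      fix x
      have "0 \<le> 1 + l * D x + (l * D x)\<^sup>2 / 3"
        using exp_minus_square_le[of "l * D x"] by (meson exp_ge_zero order_trans)
      then have "0 \<le> \<psi> x * (1 + l * D x + (l * D x)\<^sup>2 / 3)" using \<psi>_bd by simp
      then show "0 \<le> \<psi> x + l * (\<psi> x * D x) + l\<^sup>2 / 3 * (\<psi> x * (D x)\<^sup>2)"
        by (simp add: algebra_simps power_mult_distrib)
    qed
  qed (use int\<psi>1 int\<psi>[OF intD] int\<psi>[OF intD2] in auto)
  also have "\<dots> \<le> ennreal (measure M A)"
  proof (rule ennreal_leI)
    have "(\<integral>x. \<psi> x * D x \<partial>M) = (\<integral>x. \<psi> x * C D x \<partial>M)"
      by (rule integral_mult_C[symmetric]) (use int\<psi>[OF intD] \<psi>G in auto)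
    also have "\<dots> = 0"
      using D by (intro integral_eq_zero_AE) (auto simp: martingale_difference_def)
    finally have 1: "(\<integral>x. \<psi> x * D x \<partial>M) = 0" .
    have "(\<integral>x. \<psi> x * (D x)\<^sup>2 \<partial>M) = (\<integral>x. \<psi> x * C (\<lambda>x. (D x)\<^sup>2) x \<partial>M)"
      by (rule integral_mult_C[symmetric]) (use int\<psi>[OF intD2] \<psi>G in auto)
    also have "\<dots> = (\<integral>x. \<psi> x * v x \<partial>M)"
      by (rule integral_cong_AE) (use v_AE in auto)
    finally have 2: "(\<integral>x. \<psi> x * (D x)\<^sup>2 \<partial>M) = (\<integral>x. \<psi> x * v x \<partial>M)" .
    have "(\<integral>x. \<psi> x + l * (\<psi> x * D x) + l\<^sup>2 / 3 * (\<psi> x * (D x)\<^sup>2) \<partial>M)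
        = (\<integral>x. \<psi> x + l\<^sup>2 / 3 * (\<psi> x * v x) \<partial>M)"
      using int\<psi>1 int\<psi>[OF intD] int\<psi>[OF intD2] int\<psi>[OF intv] 1 2 by simp
    also have "\<dots> \<le> (\<integral>x. indicator A x \<partial>M)"
    proof (rule integral_mono)
      show "integrable M (indicator A :: _ \<Rightarrow> real)"
        by (rule integrable_real_indicator) (auto simp: emeasure_eq_measure)
      fix x
      have "exp (- (l\<^sup>2 / 3 * v x)) * (1 + l\<^sup>2 / 3 * v x) \<le> exp (- (l\<^sup>2 / 3 * v x)) * exp (l\<^sup>2 / 3 * v x)"
        by (intro mult_left_mono exp_ge_add_one_self) auto
      then have "exp (- (l\<^sup>2 / 3 * v x)) * (1 + l\<^sup>2 / 3 * v x) \<le> 1" by (simp add: exp_minus_inverse mult.commute[of "exp (- _)"])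
      then show "\<psi> x + l\<^sup>2 / 3 * (\<psi> x * v x) \<le> indicator A x"
        by (simp add: \<psi>_def indicator_def algebra_simps)
    qed (use int\<psi>1 int\<psi>[OF intv] in auto)
    finally show "(\<integral>x. \<psi> x + l * (\<psi> x * D x) + l\<^sup>2 / 3 * (\<psi> x * (D x)\<^sup>2) \<partial>M) \<le> measure M A"
      by simp
  qed
  finally show ?thesis by (simp add: emeasure_eq_measure)
qed

lemma birkhoff_sum_measurable_Filt:
  assumes "f \<in> borel_measurable (Filt 1)"
  shows "B f n \<in> borel_measurable (Filt n)"
  unfolding birkhoff_sum_def[abs_def]
proof (rule borel_measurable_sum)
  fix k assume "k \<in> {..<n}"
  then show "(\<lambda>x. f ((\<theta> ^^ k) x)) \<in> borel_measurable (Filt n)"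
    using measurable_Filt_shift[OF assms, of k n] by auto
qed

text \<open>The maximal inequality at level \<open>exp u\<close> for the exponential
  supermartingale. Both variations are kept inside the event; they are replaced by their almost sure
  growth only after Borel-Cantelli.\<close>

lemma exponential_tail:
  assumes D: "martingale_difference D"
    and v: "v = (\<lambda>x. max 0 (C (\<lambda>x. (D x)\<^sup>2) x))"
  shows "measure M {x\<in>space M. \<exists>k\<le>n. u + l\<^sup>2 / 6 * B (\<lambda>x. (D x)\<^sup>2) k x + l\<^sup>2 / 3 * B v k x \<le> l * B D k x} \<le> exp (- u)"
proof -
  have DF: "D \<in> borel_measurable (Filt 1)" using D by (simp add: martingale_difference_def)
  have [measurable]: "D \<in> borel_measurable M" using DF by (rule measurable_Filt_M)
  have vG: "v \<in> borel_measurable G" unfolding v by measurable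
  then have vF: "v \<in> borel_measurable (Filt 1)"
    by (intro measurable_Filt_mono[OF measurable_G_Filt_0]) auto
  have [measurable]: "v \<in> borel_measurable M" by (rule measurable_G_M[OF vG])
  define z where "z x = exp (l * D x - l\<^sup>2 / 6 * (D x)\<^sup>2 - l\<^sup>2 / 3 * v x)" for x
  have [measurable]: "z \<in> borel_measurable M" unfolding z_def[abs_def] by measurable
  define Y where "Y k x = ennreal (exp (l * B D k x - l\<^sup>2 / 6 * B (\<lambda>x. (D x)\<^sup>2) k x - l\<^sup>2 / 3 * B v k x))" for k x
  have Y_Suc: "Y (Suc k) x = Y k x * ennreal (z ((\<theta> ^^ k) x))" for k x
    unfolding Y_def z_def birkhoff_sum_Suc
    by (simp add: ennreal_mult[symmetric] exp_add[symmetric] algebra_simps)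
  have Y_F: "Y k \<in> borel_measurable (Filt k)" for k
  proof -
    have [measurable]: "B D k \<in> borel_measurable (Filt k)" "B v k \<in> borel_measurable (Filt k)"
      "B (\<lambda>x. (D x)\<^sup>2) k \<in> borel_measurable (Filt k)"
      using DF vF by (auto intro!: birkhoff_sum_measurable_Filt)
    show ?thesis unfolding Y_def[abs_def] by measurable
  qed
  have "ennreal (exp u) * emeasure M {x\<in>space M. \<exists>k\<le>n. ennreal (exp u) \<le> Y k x} \<le> (\<integral>\<^sup>+x. Y 0 x \<partial>M)"
  proof (rule maximal_inequality[OF Y_F])
    fix k A assume A: "A \<in> sets (Filt k)"
    have "(\<integral>\<^sup>+x. (Y k x * indicator A x) * ennreal (z ((\<theta> ^^ k) x)) \<partial>M) \<le> (\<integral>\<^sup>+x. Y k x * indicator A x \<partial>M)"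
    proof (rule nn_integral_mult_shift_le)
      show "(\<integral>\<^sup>+x. ennreal (z x) * indicator A x \<partial>M) \<le> emeasure M A" if "A \<in> sets G" for A
        unfolding z_def by (rule exp_martingale_difference_le[OF D v that])
      show "(\<lambda>x. Y k x * indicator A x) \<in> borel_measurable (Filt k)" using Y_F[of k] A by measurable
    qed measurable
    then show "(\<integral>\<^sup>+x. Y (Suc k) x * indicator A x \<partial>M) \<le> (\<integral>\<^sup>+x. Y k x * indicator A x \<partial>M)"
      by (simp add: Y_Suc mult_ac)
  qed
  also have "(\<integral>\<^sup>+x. Y 0 x \<partial>M) = 1" by (simp add: Y_def emeasure_space_1)
  also have "{x\<in>space M. \<exists>k\<le>n. ennreal (exp u) \<le> Y k x}
    = {x\<in>space M. \<exists>k\<le>n. u + l\<^sup>2 / 6 * B (\<lambda>x. (D x)\<^sup>2) k x + l\<^sup>2 / 3 * B v k x \<le> l * B D k x}" (is "_ = ?S")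
    by (auto simp: Y_def ennreal_le_iff algebra_simps)
  finally have "ennreal (exp u * measure M ?S) \<le> ennreal 1"
    by (simp add: emeasure_eq_measure ennreal_mult)
  then have "exp u * measure M ?S \<le> 1" by (simp add: ennreal_le_iff del: ennreal_1)
  then show ?thesis by (simp add: exp_minus field_simps)
qed

end

lemma ln_ln_at_top: "filterlim (\<lambda>n. ln (ln (real n))) at_top sequentially"
  by (intro filterlim_compose[OF ln_at_top] filterlim_real_sequentially)

context filtered_system
begin

text \<open>Squares and conditional variances have the same mean, and
  \<open>1 / 6 + 1 / 3 = 1 / 2\<close>: the mixed correction grows like half the variance, as for
  Gaussian increments.\<close>

lemma AE_eventually_mixed_variation_le:
  assumes D: "martingale_difference D"
    and v: "v = (\<lambda>x. max 0 (C (\<lambda>x. (D x)\<^sup>2) x))"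
    and c: "(norm_L2 M D)\<^sup>2 < c"
  shows "AE x in M. eventually (\<lambda>n. B (\<lambda>x. (D x)\<^sup>2) n x / 6 + B v n x / 3 \<le> c / 2 * real n) sequentially"
proof -
  have sq: "square_integrable M D" using D by (simp add: martingale_difference_def)
  have [measurable]: "D \<in> borel_measurable M" using sq by (rule square_integrableD)
  have intD2: "integrable M (\<lambda>x. (D x)\<^sup>2)" using sq by (rule square_integrable_integrable_square)
  have intv: "integrable M v" using G.real_cond_exp_int(1)[OF intD2] unfolding v by auto
  have "AE x in M. v x = C (\<lambda>x. (D x)\<^sup>2) x"
    using G.real_cond_exp_pos[of "\<lambda>x. (D x)\<^sup>2"] by (auto simp: v)
  then have "(\<integral>x. v x \<partial>M) = (\<integral>x. C (\<lambda>x. (D x)\<^sup>2) x \<partial>M)"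
    using intv G.real_cond_exp_int(1)[OF intD2] by (intro integral_cong_AE) auto
  also have "\<dots> = (norm_L2 M D)\<^sup>2"
    using G.real_cond_exp_int(2)[OF intD2] by (simp add: norm_L2_power2)
  finally have "(\<integral>x. (1 / 6) * (D x)\<^sup>2 + (1 / 3) * v x \<partial>M) = (norm_L2 M D)\<^sup>2 / 2"
    using intD2 intv by (simp add: norm_L2_power2)
  then have "AE x in M. eventually (\<lambda>n. B (\<lambda>x. (1 / 6) * (D x)\<^sup>2 + (1 / 3) * v x) n x \<le> c / 2 * real n) sequentially"
    using intD2 intv c by (intro birkhoff_upper) auto
  moreover have "B (\<lambda>x. (1 / 6) * (D x)\<^sup>2 + (1 / 3) * v x) n x = B (\<lambda>x. (D x)\<^sup>2) n x / 6 + B v n x / 3" for n x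
    by (simp only: birkhoff_sum_add birkhoff_sum_cmult)
  ultimately show ?thesis by (simp only:)
qed

theorem martingale_lil_upper:
  assumes D: "martingale_difference D" and \<kappa>: "norm_L2 M D < \<kappa>"
  shows "AE x in M. eventually (\<lambda>n. B D n x \<le> \<kappa> * sqrt (2 * real n * ln (ln (real n)))) sequentially"
proof -
  have DF: "D \<in> borel_measurable (Filt 1)" using D by (simp add: martingale_difference_def)
  have [measurable]: "D \<in> borel_measurable M" using DF by (rule measurable_Filt_M)
  define v where "v = (\<lambda>x. max 0 (C (\<lambda>x. (D x)\<^sup>2) x))"
  have [measurable]: "v \<in> borel_measurable M" unfolding v_def by (rule measurable_G_M) measurable
  obtain a where a: "norm_L2 M D < a" "a < \<kappa>" using dense[OF \<kappa>] by blast
  have a0: "0 < a" using a(1) norm_L2_nonneg[of M D] by linarith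
  \<comment> \<open>The estimate loses a factor \<open>r\<close> three times: in \<open>u\<close>,
    to make \<open>j powr - r\<close> summable; in passing from \<open>ln j\<close> to
    \<open>ln (ln k)\<close>; and in \<open>N j \<le> r * k\<close>. The cube root makes the total
    loss \<open>\<kappa>\<^sup>2 / a\<^sup>2\<close>.\<close>
  define r where "r = root 3 (\<kappa>\<^sup>2 / a\<^sup>2)"
  have "a\<^sup>2 < \<kappa>\<^sup>2" using a a0 by (intro power_strict_mono) auto
  then have q1: "1 < \<kappa>\<^sup>2 / a\<^sup>2" using a0 by simp
  then have r1: "1 < r" unfolding r_def by (simp add: real_root_gt_1_iff)
  have r3: "r ^ 3 * a\<^sup>2 = \<kappa>\<^sup>2"
  proof -
    have "r ^ 3 = \<kappa>\<^sup>2 / a\<^sup>2" unfolding r_def using q1 by (intro real_root_pow_pos2) auto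
    then show ?thesis using a0 by simp
  qed
  define N where "N j = r ^ Suc j" for j :: nat
  have N0: "0 < N j" for j using r1 by (simp add: N_def)
  define u where "u j = r * ln (real j)" for j :: nat
  \<comment> \<open>This is the minimiser of \<open>u / l + l * a\<^sup>2 * N / 2\<close>, the bound
    that the complement of \<open>E j\<close> gives for the sums; the minimum is
    \<open>2 * u / l\<close>.\<close>
  define l where "l j = sqrt (2 * u j / (a\<^sup>2 * N j))" for j
  define E where "E j = {x\<in>space M. \<exists>k\<le>nat \<lfloor>N j\<rfloor>. u j + (l j)\<^sup>2 / 6 * B (\<lambda>x. (D x)\<^sup>2) k x + (l j)\<^sup>2 / 3 * B v k x \<le> l j * B D k x}" for j
  have [measurable]: "E j \<in> sets M" for j unfolding E_def by measurable
  have "summable (\<lambda>j. measure M (E j))"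
  proof (rule summable_comparison_test_ev)
    show "eventually (\<lambda>j. norm (measure M (E j)) \<le> real j powr - r) sequentially"
      using eventually_gt_at_top[of 0]
    proof eventually_elim
      case (elim j)
      have "measure M (E j) \<le> exp (- u j)" unfolding E_def by (rule exponential_tail[OF D v_def])
      also have "\<dots> = real j powr - r" using elim by (simp add: u_def powr_def)
      finally show ?case by simp
    qed
    show "summable (\<lambda>j. real j powr - r)" using r1 by (simp add: summable_real_powr_iff)
  qed
  then have "AE x in M. eventually (\<lambda>j. x \<in> space M - E j) sequentially"
    by (intro borel_cantelli_AE1) (auto simp: emeasure_eq_measure)
  moreover have "AE x in M. eventually (\<lambda>n. B (\<lambda>x. (D x)\<^sup>2) n x / 6 + B v n x / 3 \<le> a\<^sup>2 / 2 * real n) sequentially"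
    using a by (intro AE_eventually_mixed_variation_le[OF D v_def] power_strict_mono) auto
  ultimately show ?thesis
  proof eventually_elim
    case (elim x)
    obtain J where J: "\<And>j. j \<ge> J \<Longrightarrow> x \<in> space M - E j"
      using elim(1) by (auto simp: eventually_sequentially)
    have ev1: "eventually (\<lambda>n. r ^ (max J 2) \<le> real n) sequentially"
      using filterlim_real_sequentially by (simp add: filterlim_at_top)
    \<comment> \<open>From \<open>j \<le> log r k\<close> one gets
      \<open>ln j \<le> ln (ln k) - ln (ln r)\<close>; this threshold lets the constant
      \<open>- ln (ln r)\<close>, positive when \<open>r\<close> is near 1, be absorbed by
      \<open>(r - 1) * ln (ln k)\<close>.\<close>
    have ev2: "eventually (\<lambda>n. - ln (ln r) / (r - 1) \<le> ln (ln (real n))) sequentially"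
      using ln_ln_at_top by (simp add: filterlim_at_top)
    show ?case using ev1 ev2 elim(2) eventually_gt_at_top[of 1]
    proof eventually_elim
      case (elim k)
      define j where "j = nat \<lfloor>log r (real k)\<rfloor>"
      have k0: "0 < real k" using elim(4) by simp
      have lg0: "0 \<le> log r (real k)" using elim(4) r1 by simp
      have "real j \<le> log r (real k)" unfolding j_def using lg0 by simp
      then have rj: "r ^ j \<le> real k"
        using r1 k0 by (simp add: le_log_iff powr_realpow)
      have "log r (real k) < real (Suc j)" unfolding j_def using lg0 by linarith
      then have kN: "real k < N j"
        unfolding N_def using r1 k0 by (simp add: log_less_iff powr_realpow del: of_nat_Suc power_Suc)
      have "r ^ (max J 2) < r ^ Suc j" using elim(1) kN unfolding N_def by linarith
      then have "max J 2 < Suc j" using r1 power_strict_increasing_iff by blast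
      then have jJ: "J \<le> j" "2 \<le> j" by auto
      have u0: "0 < u j" using jJ r1 by (simp add: u_def)
      have l0: "0 < l j" using u0 N0 a0 by (simp add: l_def)
      have l2: "(l j)\<^sup>2 = 2 * u j / (a\<^sup>2 * N j)"
        unfolding l_def using u0 N0[of j] a0 by simp
      have "k \<le> nat \<lfloor>N j\<rfloor>" using kN by linarith
      with J[OF jJ(1)] have "\<not> (u j + (l j)\<^sup>2 / 6 * B (\<lambda>x. (D x)\<^sup>2) k x + (l j)\<^sup>2 / 3 * B v k x \<le> l j * B D k x)"
        unfolding E_def by blast
      then have "l j * B D k x < u j + (l j)\<^sup>2 * (B (\<lambda>x. (D x)\<^sup>2) k x / 6 + B v k x / 3)"
        by (simp add: not_le algebra_simps)
      also have "\<dots> \<le> u j + (l j)\<^sup>2 * (a\<^sup>2 / 2 * N j)"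
      proof -
        have "a\<^sup>2 / 2 * real k \<le> a\<^sup>2 / 2 * N j" using kN by (intro mult_left_mono) auto
        with elim(3) show ?thesis by (intro add_left_mono mult_left_mono) auto
      qed
      also have "\<dots> = 2 * u j" unfolding l2 using a0 N0[of j] by (simp add: field_simps)
      finally have "B D k x \<le> 2 * u j / l j" using l0 by (simp add: pos_le_divide_eq mult.commute)
      also have "\<dots> = sqrt ((2 * u j / l j)\<^sup>2)" using u0 l0 by simp
      also have "(2 * u j / l j)\<^sup>2 = 2 * u j * (a\<^sup>2 * N j)"
        unfolding power_divide l2 using u0 N0[of j] a0 by (simp add: field_simps power2_eq_square)
      also have "sqrt (2 * u j * (a\<^sup>2 * N j)) \<le> sqrt (\<kappa>\<^sup>2 * (2 * real k * ln (ln (real k))))"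
      proof (rule real_sqrt_le_mono)
        have lnk: "0 < ln (real k)" using elim(4) by simp
        have "ln (real j) \<le> ln (log r (real k))"
          using \<open>real j \<le> log r (real k)\<close> jJ by (intro ln_mono) auto
        also have "\<dots> = ln (ln (real k)) - ln (ln r)"
          unfolding log_def using lnk r1 by (simp add: ln_div)
        also have "\<dots> \<le> r * ln (ln (real k))"
        proof -
          have "- ln (ln r) \<le> ln (ln (real k)) * (r - 1)"
            using elim(2) r1 by (subst (asm) pos_divide_le_eq) auto
          then show ?thesis by (simp add: algebra_simps)
        qed
        finally have "u j \<le> r * (r * ln (ln (real k)))" unfolding u_def using r1 by simp
        moreover have "N j \<le> r * real k" unfolding N_def using rj r1 by simp
        ultimately have "2 * u j * (a\<^sup>2 * N j) \<le> 2 * (r * (r * ln (ln (real k)))) * (a\<^sup>2 * (r * real k))"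
          using u0 N0[of j] by (intro mult_mono) auto
        also have "\<dots> = (r ^ 3 * a\<^sup>2) * (2 * real k * ln (ln (real k)))"
          by (simp add: power3_eq_cube)
        finally show "2 * u j * (a\<^sup>2 * N j) \<le> \<kappa>\<^sup>2 * (2 * real k * ln (ln (real k)))" by (simp only: r3)
      qed
      also have "\<dots> = \<kappa> * sqrt (2 * real k * ln (ln (real k)))"
        using a a0 by (subst real_sqrt_mult) simp
      finally show ?case .
    qed
  qed
qed

corollary martingale_lil_upper_abs:
  assumes D: "martingale_difference D" and \<kappa>: "norm_L2 M D < \<kappa>"
  shows "AE x in M. eventually (\<lambda>n. \<bar>B D n x\<bar> \<le> \<kappa> * sqrt (2 * real n * ln (ln (real n)))) sequentially"
  using martingale_lil_upper[OF D \<kappa>]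
    martingale_lil_upper[OF martingale_difference_uminus[OF D], of \<kappa>, unfolded norm_L2_uminus, OF \<kappa>]
proof eventually_elim
  case (elim x)
  then show ?case by eventually_elim (auto simp: birkhoff_sum_uminus)
qed

end

section \<open>Lower half of the martingale law\<close>

text \<open>Taking \<open>s = 1\<close> and \<open>s = -1\<close> in the auxiliary function gives
  the two sides of the bound. The factor \<open>1 + 3 * s + 3 * s * x\<close> keeps its sign for
  \<open>x \<ge> - 2 / 3\<close>, and this covers the range assumed.\<close>

lemma ln_one_plus_third_order:
  fixes t :: real
  assumes "\<bar>t\<bar> \<le> 1 / 2"
  shows "\<bar>ln (1 + t) - (t - t\<^sup>2 / 2)\<bar> \<le> \<bar>t\<bar> ^ 3"
proof -
  define f where "f s x = ln (1 + x) - (x - x\<^sup>2 / 2) + s * x ^ 3" for s x :: real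
  have f': "(f s has_real_derivative x\<^sup>2 * (1 + 3 * s + 3 * s * x) / (1 + x)) (at x)" if "-1 < x" for s x
  proof -
    have "(f s has_real_derivative 1 / (1 + x) - (1 - x) + s * (3 * x\<^sup>2)) (at x)"
      unfolding f_def using that by (auto intro!: derivative_eq_intros)
    moreover have "1 / (1 + x) - (1 - x) + s * (3 * x\<^sup>2) = x\<^sup>2 * (1 + 3 * s + 3 * s * x) / (1 + x)"
      using that by (simp add: field_simps power2_eq_square)
    ultimately show ?thesis by simp
  qed
  have up: "f s a \<le> f s b"
    if "a \<le> b" "-1 < a" "\<And>x. a \<le> x \<Longrightarrow> x \<le> b \<Longrightarrow> 0 \<le> 1 + 3 * s + 3 * s * x" for s a b
  proof (rule DERIV_nonneg_imp_nondecreasing[OF that(1)])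
    fix x assume x: "a \<le> x" "x \<le> b"
    then have "-1 < x" using that(2) by linarith
    then show "\<exists>y. DERIV (f s) x :> y \<and> 0 \<le> y"
      using that(3)[OF x] by (intro exI[of _ "x\<^sup>2 * (1 + 3 * s + 3 * s * x) / (1 + x)"] conjI f' divide_nonneg_pos mult_nonneg_nonneg) auto
  qed
  have down: "f s b \<le> f s a"
    if "a \<le> b" "-1 < a" "\<And>x. a \<le> x \<Longrightarrow> x \<le> b \<Longrightarrow> 1 + 3 * s + 3 * s * x \<le> 0" for s a b
  proof (rule DERIV_nonpos_imp_nonincreasing[OF that(1)])
    fix x assume x: "a \<le> x" "x \<le> b"
    then have "-1 < x" using that(2) by linarith
    then show "\<exists>y. DERIV (f s) x :> y \<and> y \<le> 0"
      using that(3)[OF x] by (intro exI[of _ "x\<^sup>2 * (1 + 3 * s + 3 * s * x) / (1 + x)"] conjI f' divide_nonpos_pos mult_nonneg_nonpos) auto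
  qed
  have f0: "f s 0 = 0" for s by (simp add: f_def)
  show ?thesis
  proof (cases "0 \<le> t")
    case True
    have "f 1 0 \<le> f 1 t" using True by (intro up) auto
    moreover have "f (-1) t \<le> f (-1) 0" using True by (intro down) auto
    ultimately show ?thesis using True by (simp add: f0) (simp add: f_def abs_le_iff)
  next
    case False
    have "f (-1) t \<ge> f (-1) 0" using False assms by (intro down) auto
    moreover have "f 1 t \<le> f 1 0" using False assms by (intro up) auto
    ultimately show ?thesis using False by (simp add: f0) (simp add: f_def abs_le_iff)
  qed
qed

text \<open>Below \<open>a\<close> the smaller tilt \<open>l - d\<close> dominates
  \<open>exp (l * x)\<close>, above \<open>b\<close> the larger tilt \<open>l + d\<close> does, and
  between them \<open>exp (l * x) \<le> exp (l * b)\<close>. Integrated, it turns three values of a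
  Laplace transform into a lower bound for the probability of \<open>a \<le> x\<close>.\<close>

lemma indicator_ge_exponentials:
  fixes x :: real
  assumes "0 \<le> d" "0 \<le> l"
  shows "exp (l * x) - exp (d * a) * exp ((l - d) * x) - exp (- d * b) * exp ((l + d) * x)
    \<le> exp (l * b) * (if a \<le> x then 1 else 0)"
proof -
  consider "x < a" | "a \<le> x" "x \<le> b" | "a \<le> x" "b < x" by linarith
  then show ?thesis
  proof cases
    case 1
    have "exp (l * x) \<le> exp (d * a) * exp ((l - d) * x)"
      using 1 assms mult_left_mono[of x a d] by (simp add: exp_add[symmetric] algebra_simps)
    moreover have "0 \<le> exp (- d * b) * exp ((l + d) * x)" by simp
    moreover have "\<not> a \<le> x" using 1 by simp
    ultimately show ?thesis by (simp only: if_False mult_zero_right)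
  next
    case 2
    have "exp (l * x) \<le> exp (l * b)" using 2 assms by (simp add: mult_left_mono)
    moreover have "0 \<le> exp (- d * b) * exp ((l + d) * x)" "0 \<le> exp (d * a) * exp ((l - d) * x)" by simp_all
    ultimately show ?thesis using 2(1) by (simp only: if_True mult_1_right)
  next
    case 3
    have "exp (l * x) \<le> exp (- d * b) * exp ((l + d) * x)"
      using 3 assms mult_left_mono[of b x d] by (simp add: exp_add[symmetric] algebra_simps)
    moreover have "0 \<le> exp (l * b)" "0 \<le> exp (d * a) * exp ((l - d) * x)" by simp_all
    ultimately show ?thesis using 3(1) by (simp only: if_True mult_1_right)
  qed
qed

context filtered_system
begin

text \<open>A set of \<open>Filt n\<close> is a preimage under \<open>n\<close> steps, so
  stationarity moves its integral back to time 0, where \<open>C D\<close> vanishes.\<close>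

lemma integral_mult_martingale_difference:
  assumes D: "martingale_difference D" and \<psi>: "\<psi> \<in> borel_measurable (Filt n)"
    and int: "integrable M (\<lambda>x. \<psi> x * D ((\<theta> ^^ n) x))"
  shows "(\<integral>x. \<psi> x * D ((\<theta> ^^ n) x) \<partial>M) = 0"
proof -
  interpret F: finite_measure_subalgebra M "Filt n" by unfold_locales (rule subalg_Filt)
  have sq: "square_integrable M D" using D by (simp add: martingale_difference_def)
  have D_integrable: "integrable M D" using sq by (rule square_integrable_integrable)
  have [measurable]: "D \<in> borel_measurable M" using sq by (rule square_integrableD)
  have "AE x in M. real_cond_exp M (Filt n) (\<lambda>x. D ((\<theta> ^^ n) x)) x = 0"
  proof (rule F.real_cond_exp_charact)
    fix A assume "A \<in> sets (Filt n)"
    then obtain E where E: "E \<in> sets G" "A = (\<theta> ^^ n) -` E \<inter> space M" by (auto simp: sets_Filt)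
    have [measurable]: "E \<in> sets M" using E(1) by (rule sets_G_M)
    have "(\<integral>x\<in>A. D ((\<theta> ^^ n) x) \<partial>M) = (\<integral>x. indicator E ((\<theta> ^^ n) x) * D ((\<theta> ^^ n) x) \<partial>M)"
      unfolding set_lebesgue_integral_def E(2)
      by (intro Bochner_Integration.integral_cong) (auto simp: indicator_def)
    also have "\<dots> = (\<integral>x. indicator E x * D x \<partial>M)"
      by (rule integral_theta_power[of "\<lambda>x. indicator E x * D x"]) measurable
    also have "\<dots> = (\<integral>x. indicator E x * C D x \<partial>M)"
      using E(1) integrable_mult_indicator[OF \<open>E \<in> sets M\<close> D_integrable]
      by (intro integral_mult_C[symmetric]) auto
    also have "\<dots> = 0"
      using D by (intro integral_eq_zero_AE) (auto simp: martingale_difference_def)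
    finally show "(\<integral>x\<in>A. D ((\<theta> ^^ n) x) \<partial>M) = (\<integral>x\<in>A. 0 \<partial>M)" by simp
  qed (use integrable_theta_power[OF D_integrable] in auto)
  then have "(\<integral>x. \<psi> x * real_cond_exp M (Filt n) (\<lambda>x. D ((\<theta> ^^ n) x)) x \<partial>M) = 0"
    by (intro integral_eq_zero_AE) auto
  then show "(\<integral>x. \<psi> x * D ((\<theta> ^^ n) x) \<partial>M) = 0"
    using F.real_cond_exp_intg(2)[OF int \<psi>] D_integrable integrable_theta_power[OF D_integrable] by auto
qed

end

text \<open>The bound is required at every point: the clock and product estimates below are made
  path by path, with no exceptional set.\<close>

locale bounded_martingale_difference = filtered_system +
  fixes D :: "'a \<Rightarrow> real" and c :: real
  assumes D: "martingale_difference D"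
    and D_bounded: "\<And>x. \<bar>D x\<bar> \<le> c"
begin

lemma D_Filt: "D \<in> borel_measurable (Filt 1)" using D by (simp add: martingale_difference_def)

lemma D_measurable: "D \<in> borel_measurable M" by (rule measurable_Filt_M[OF D_Filt])

lemma c_nonneg: "0 \<le> c" using D_bounded[of undefined] by linarith

lemma D_square_le: "(D x)\<^sup>2 \<le> c\<^sup>2"
  using D_bounded[of x] by (simp add: abs_le_square_iff[symmetric])

lemma integral_mult_shift_eq_0:
  assumes \<psi>: "\<psi> \<in> borel_measurable (Filt n)" and bd: "\<And>x. x \<in> space M \<Longrightarrow> \<bar>\<psi> x\<bar> \<le> K"
  shows "integrable M (\<lambda>x. \<psi> x * D ((\<theta> ^^ n) x))" "(\<integral>x. \<psi> x * D ((\<theta> ^^ n) x) \<partial>M) = 0"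
proof -
  have [measurable]: "\<psi> \<in> borel_measurable M" using \<psi> by (rule measurable_Filt_M)
  note [measurable] = D_measurable
  show int: "integrable M (\<lambda>x. \<psi> x * D ((\<theta> ^^ n) x))"
  proof (rule integrable_const_bound)
    show "AE x in M. norm (\<psi> x * D ((\<theta> ^^ n) x)) \<le> K * c"
      using bd D_bounded by (intro AE_I2) (auto simp: abs_mult intro!: mult_mono order_trans[OF abs_ge_zero])
  qed measurable
  show "(\<integral>x. \<psi> x * D ((\<theta> ^^ n) x) \<partial>M) = 0"
    by (rule integral_mult_martingale_difference[OF D \<psi> int])
qed

text \<open>The quadratic variation serves as a clock: \<open>block \<alpha> \<beta> k\<close> is the \<open>k\<close>-th difference while the
  clock lies between \<open>\<alpha>\<close> and \<open>\<beta>\<close>, so that the variation accumulated by a completed block is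
  deterministic up to \<open>c\<^sup>2\<close>.\<close>

definition clock :: "nat \<Rightarrow> 'a \<Rightarrow> real" where
  "clock n = B (\<lambda>x. (D x)\<^sup>2) n"

definition block :: "real \<Rightarrow> real \<Rightarrow> nat \<Rightarrow> 'a \<Rightarrow> real" where
  "block \<alpha> \<beta> k x = (if \<alpha> \<le> clock k x \<and> clock k x < \<beta> then D ((\<theta> ^^ k) x) else 0)"

definition block_sum :: "real \<Rightarrow> real \<Rightarrow> nat \<Rightarrow> 'a \<Rightarrow> real" where
  "block_sum \<alpha> \<beta> n x = (\<Sum>k<n. block \<alpha> \<beta> k x)"

definition block_var :: "real \<Rightarrow> real \<Rightarrow> nat \<Rightarrow> 'a \<Rightarrow> real" where
  "block_var \<alpha> \<beta> n x = (\<Sum>k<n. (block \<alpha> \<beta> k x)\<^sup>2)"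

text \<open>The stochastic exponential of \<open>l\<close> times the block martingale. Unlike
  \<open>exp (l * block_sum)\<close> it has mean exactly 1, for every \<open>l\<close> and with no
  knowledge of conditional variances.\<close>

definition block_prod :: "real \<Rightarrow> real \<Rightarrow> real \<Rightarrow> nat \<Rightarrow> 'a \<Rightarrow> real" where
  "block_prod \<alpha> \<beta> l n x = (\<Prod>k<n. 1 + l * block \<alpha> \<beta> k x)"

lemma clock_Suc: "clock (Suc n) x = clock n x + (D ((\<theta> ^^ n) x))\<^sup>2"
  by (simp add: clock_def birkhoff_sum_Suc)

lemma clock_0 [simp]: "clock 0 x = 0" by (simp add: clock_def)

lemma clock_mono: "m \<le> n \<Longrightarrow> clock m x \<le> clock n x"
  by (induction n rule: dec_induct) (auto simp: clock_Suc intro: add_increasing2)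

lemma clock_Suc_le: "clock (Suc n) x \<le> clock n x + c\<^sup>2"
  using D_square_le by (simp add: clock_Suc)

lemma clock_le: "clock n x \<le> c\<^sup>2 * real n"
proof (induction n)
  case (Suc n)
  then show ?case using clock_Suc_le[of n x] by (simp add: algebra_simps)
qed simp

lemma clock_Filt: "clock n \<in> borel_measurable (Filt n)"
  unfolding clock_def by (intro birkhoff_sum_measurable_Filt borel_measurable_power D_Filt)

lemma block_Filt:
  assumes "k < n"
  shows "block \<alpha> \<beta> k \<in> borel_measurable (Filt n)"
proof -
  have [measurable]: "clock k \<in> borel_measurable (Filt n)"
    using assms by (intro measurable_Filt_mono[OF clock_Filt]) auto
  define d where "d = (\<lambda>x. D ((\<theta> ^^ k) x))"
  have [measurable]: "d \<in> borel_measurable (Filt n)"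
    unfolding d_def using assms by (intro measurable_Filt_shift[OF D_Filt]) auto
  have eq: "block \<alpha> \<beta> k = (\<lambda>x. if \<alpha> \<le> clock k x \<and> clock k x < \<beta> then d x else 0)"
    by (auto simp: block_def d_def)
  show ?thesis unfolding eq by measurable
qed

lemma block_sum_Filt: "block_sum \<alpha> \<beta> n \<in> borel_measurable (Filt n)"
  unfolding block_sum_def[abs_def] using block_Filt by (intro borel_measurable_sum) auto

lemma block_prod_Filt: "block_prod \<alpha> \<beta> l n \<in> borel_measurable (Filt n)"
  unfolding block_prod_def[abs_def]
  using block_Filt by (intro borel_measurable_prod borel_measurable_add borel_measurable_times) auto

lemmas [measurable] = measurable_Filt_M[OF clock_Filt] measurable_Filt_M[OF block_sum_Filt]
  measurable_Filt_M[OF block_prod_Filt]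

lemma abs_block_le: "\<bar>block \<alpha> \<beta> k x\<bar> \<le> c"
  using D_bounded c_nonneg by (simp add: block_def)

lemma abs_block_prod_le: "\<bar>block_prod \<alpha> \<beta> l n x\<bar> \<le> (1 + \<bar>l\<bar> * c) ^ n"
proof -
  have "\<bar>block_prod \<alpha> \<beta> l n x\<bar> = (\<Prod>k<n. \<bar>1 + l * block \<alpha> \<beta> k x\<bar>)"
    by (simp add: block_prod_def abs_prod)
  also have "\<dots> \<le> (\<Prod>k<n. 1 + \<bar>l\<bar> * c)"
  proof (intro prod_mono conjI)
    fix k
    have "\<bar>1 + l * block \<alpha> \<beta> k x\<bar> \<le> 1 + \<bar>l\<bar> * \<bar>block \<alpha> \<beta> k x\<bar>"
      using abs_triangle_ineq[of 1 "l * block \<alpha> \<beta> k x"] by (simp add: abs_mult)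
    also have "\<dots> \<le> 1 + \<bar>l\<bar> * c" using abs_block_le by (intro add_left_mono mult_left_mono) auto
    finally show "\<bar>1 + l * block \<alpha> \<beta> k x\<bar> \<le> 1 + \<bar>l\<bar> * c" .
  qed simp
  finally show ?thesis by simp
qed

lemma integrable_block_prod: "integrable M (block_prod \<alpha> \<beta> l n)"
  by (rule integrable_const_bound[of _ "(1 + \<bar>l\<bar> * c) ^ n"]) (auto simp: abs_block_prod_le)

lemma integrable_block_prod_indicator:
  assumes "A \<in> sets M"
  shows "integrable M (\<lambda>x. block_prod \<alpha> \<beta> l n x * indicator A x)"
  using integrable_mult_indicator[OF assms integrable_block_prod] by (simp add: mult.commute)

lemma block_prod_Suc: "block_prod \<alpha> \<beta> l (Suc n) x = block_prod \<alpha> \<beta> l n x * (1 + l * block \<alpha> \<beta> n x)"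
  by (simp add: block_prod_def)

text \<open>The events \<open>A n\<close> below are those of the past before the clock reaches \<open>\<alpha>\<close>, observed up to
  time \<open>n\<close>.\<close>

lemma integral_block_prod:
  assumes A: "\<And>n. A n \<in> sets (Filt n)"
    and mono: "\<And>n. A n \<subseteq> A (Suc n)"
    and determined: "\<And>n x. x \<in> A (Suc n) \<Longrightarrow> \<alpha> \<le> clock n x \<Longrightarrow> x \<in> A n"
  shows "(\<integral>x. block_prod \<alpha> \<beta> l n x * indicator (A n) x \<partial>M) = measure M (A n)"
proof (induction n)
  case 0
  have "A 0 \<in> sets M" using A[of 0] subalg_Filt[of 0] by (auto simp: subalgebra_def)
  then show ?case by (simp add: block_prod_def)
next
  case (Suc n)
  have AM [measurable]: "A n \<in> sets M" for n using A[of n] subalg_Filt[of n] by (auto simp: subalgebra_def)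
  \<comment> \<open>The part of the increment known at time \<open>n\<close>; multiplied by the next
    difference it integrates to 0.\<close>
  define \<psi> where "\<psi> x = l * block_prod \<alpha> \<beta> l n x * indicator (A n) x *
    (if \<alpha> \<le> clock n x \<and> clock n x < \<beta> then 1 else 0)" for x
  have \<psi>_Filt: "\<psi> \<in> borel_measurable (Filt n)"
  proof -
    have [measurable]: "A n \<in> sets (Filt n)" "block_prod \<alpha> \<beta> l n \<in> borel_measurable (Filt n)"
      "clock n \<in> borel_measurable (Filt n)" by (rule A block_prod_Filt clock_Filt)+
    show ?thesis unfolding \<psi>_def[abs_def] by measurable
  qed
  have \<psi>_bd: "\<bar>\<psi> x\<bar> \<le> \<bar>l\<bar> * (1 + \<bar>l\<bar> * c) ^ n" for x
  proof -
    have "\<bar>\<psi> x\<bar> \<le> \<bar>l\<bar> * \<bar>block_prod \<alpha> \<beta> l n x\<bar>"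
      by (simp add: \<psi>_def abs_mult indicator_def)
    also have "\<dots> \<le> \<bar>l\<bar> * (1 + \<bar>l\<bar> * c) ^ n" by (intro mult_left_mono abs_block_prod_le) simp
    finally show ?thesis .
  qed
  note z = integral_mult_shift_eq_0[OF \<psi>_Filt \<psi>_bd]
  have split: "block_prod \<alpha> \<beta> l (Suc n) x * indicator (A (Suc n)) x
      = block_prod \<alpha> \<beta> l n x * indicator (A n) x + \<psi> x * D ((\<theta> ^^ n) x) + indicator (A (Suc n) - A n) x" for x
  proof (cases "x \<in> A n")
    case True
    then show ?thesis using mono[of n]
      by (auto simp: block_prod_Suc \<psi>_def block_def algebra_simps)
  next
    case False
    show ?thesis
    proof (cases "x \<in> A (Suc n)")
      case True
      \<comment> \<open>A path that joins the event only at time \<open>n + 1\<close> has not yet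
        entered the block, so its product is still the empty one.\<close>
      with False determined have lt: "clock n x < \<alpha>" by force
      have "block \<alpha> \<beta> k x = 0" if "k < Suc n" for k
        using clock_mono[of k n x] that lt by (simp add: block_def)
      then have "block_prod \<alpha> \<beta> l (Suc n) x = 1" by (simp add: block_prod_def)
      with True False show ?thesis by (simp add: \<psi>_def)
    qed (use False in \<open>simp add: \<psi>_def\<close>)
  qed
  have "(\<integral>x. block_prod \<alpha> \<beta> l (Suc n) x * indicator (A (Suc n)) x \<partial>M)
      = (\<integral>x. block_prod \<alpha> \<beta> l n x * indicator (A n) x \<partial>M) + (\<integral>x. \<psi> x * D ((\<theta> ^^ n) x) \<partial>M) + measure M (A (Suc n) - A n)"
    unfolding split using z(1) integrable_block_prod_indicator[OF AM]
    by (subst Bochner_Integration.integral_add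
          Bochner_Integration.integral_add[of M "\<lambda>x. block_prod \<alpha> \<beta> l n x * indicator (A n) x"];
        (intro Bochner_Integration.integrable_add)?; (simp add: emeasure_eq_measure)?)
  also have "\<dots> = measure M (A n) + measure M (A (Suc n) - A n)" by (simp add: Suc z(2))
  also have "\<dots> = measure M (A (Suc n))" using mono[of n] by (simp add: finite_measure_Diff)
  finally show ?case .
qed

lemma integral_block_prod_1: "(\<integral>x. block_prod \<alpha> \<beta> l n x \<partial>M) = 1"
proof -
  have "space M \<in> sets (Filt n)" for n by (metis sets.top space_Filt)
  then have "(\<integral>x. block_prod \<alpha> \<beta> l n x * indicator (space M) x \<partial>M) = measure M (space M)"
    by (intro integral_block_prod) auto
  moreover have "(\<integral>x. block_prod \<alpha> \<beta> l n x * indicator (space M) x \<partial>M) = (\<integral>x. block_prod \<alpha> \<beta> l n x \<partial>M)"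
    by (intro Bochner_Integration.integral_cong) auto
  ultimately show ?thesis by (simp add: prob_space)
qed

lemma block_var_Suc: "block_var \<alpha> \<beta> (Suc n) x = block_var \<alpha> \<beta> n x + (block \<alpha> \<beta> n x)\<^sup>2"
  by (simp add: block_var_def)

lemma block_var_nonneg: "0 \<le> block_var \<alpha> \<beta> n x"
  by (simp add: block_var_def sum_nonneg)

text \<open>The last difference of a block starts with the clock below \<beta> and may overshoot it
  by at most one square, \<open>c\<^sup>2\<close>.\<close>

lemma block_var_le:
  assumes "\<alpha> \<le> \<beta>"
  shows "block_var \<alpha> \<beta> n x \<le> \<beta> - \<alpha> + c\<^sup>2"
proof -
  \<comment> \<open>Up to its end the block has collected no more than what the clock gained beyond
    \<alpha>.\<close>
  have 1: "block_var \<alpha> \<beta> n x \<le> max 0 (clock n x - \<alpha>)" for n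
  proof (induction n)
    case (Suc n)
    have b: "(block \<alpha> \<beta> n x)\<^sup>2 \<le> (D ((\<theta> ^^ n) x))\<^sup>2" by (simp add: block_def)
    show ?case
    proof (cases "\<alpha> \<le> clock n x")
      case True
      with Suc b show ?thesis by (simp add: block_var_Suc clock_Suc max_def)
    next
      case False
      with Suc show ?thesis by (simp add: block_var_Suc block_def max_def)
    qed
  qed (simp add: block_var_def)
  show ?thesis
  proof (induction n)
    case 0 then show ?case using assms by (simp add: block_var_def)
  next
    case (Suc n)
    show ?case
    proof (cases "\<alpha> \<le> clock n x \<and> clock n x < \<beta>")
      case True
      then have "block_var \<alpha> \<beta> n x \<le> \<beta> - \<alpha>" using 1[of n] by (simp add: max_def)
      moreover have "(block \<alpha> \<beta> n x)\<^sup>2 \<le> c\<^sup>2" using D_square_le by (simp add: block_def)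
      ultimately show ?thesis by (simp add: block_var_Suc)
    qed (use Suc in \<open>auto simp: block_var_Suc block_def\<close>)
  qed
qed

text \<open>The counterpart for a late start: the clock may jump over \<alpha> by up to
  \<open>c\<^sup>2\<close>, and that amount is missing from the block.\<close>

lemma block_var_ge:
  assumes "0 \<le> \<alpha>" "\<beta> \<le> clock n x"
  shows "\<beta> - \<alpha> - c\<^sup>2 \<le> block_var \<alpha> \<beta> n x"
proof -
  have "min (clock n x) \<beta> - \<alpha> - c\<^sup>2 \<le> block_var \<alpha> \<beta> n x" for n
  proof (induction n)
    case 0 then show ?case using assms by (simp add: block_var_def min_def) (use zero_le_power2[of c] in linarith)
  next
    case (Suc n)
    show ?case
    proof (cases "clock n x < \<alpha>")
      case True
      then have "min (clock (Suc n) x) \<beta> \<le> \<alpha> + c\<^sup>2" using clock_Suc_le[of n x] by linarith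
      then show ?thesis using block_var_nonneg[of \<alpha> \<beta> "Suc n" x] by linarith
    next
      case False
      show ?thesis
      proof (cases "clock n x < \<beta>")
        case True
        then have "block_var \<alpha> \<beta> (Suc n) x = block_var \<alpha> \<beta> n x + (D ((\<theta> ^^ n) x))\<^sup>2"
          using False by (simp add: block_var_Suc block_def)
        then show ?thesis using Suc True by (simp add: clock_Suc min_def split: if_splits)
      next
        case F: False
        then show ?thesis using Suc clock_mono[of n "Suc n" x] by (simp add: block_var_Suc block_def min_def split: if_splits)
      qed
    qed
  qed
  from this[of n] show ?thesis using assms(2) by (simp add: min_def split: if_splits)
qed

text \<open>Expand the logarithm of each factor to second order. The cubic errors are bounded
  through \<open>\<bar>b\<bar> ^ 3 \<le> c * b\<^sup>2\<close>, so their sum is controlled by the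
  block variation rather than by the number of steps.\<close>

lemma block_prod_eq_exp:
  assumes "\<bar>l\<bar> * c \<le> 1 / 2"
  obtains e where "block_prod \<alpha> \<beta> l n x = exp (l * block_sum \<alpha> \<beta> n x - l\<^sup>2 / 2 * block_var \<alpha> \<beta> n x + e)"
    and "\<bar>e\<bar> \<le> \<bar>l\<bar> ^ 3 * c * block_var \<alpha> \<beta> n x"
proof -
  define b where "b k = block \<alpha> \<beta> k x" for k
  have small: "\<bar>l * b k\<bar> \<le> 1 / 2" for k
  proof -
    have "\<bar>l * b k\<bar> \<le> \<bar>l\<bar> * c" unfolding abs_mult b_def by (intro mult_left_mono abs_block_le) auto
    with assms show ?thesis by linarith
  qed
  define r where "r k = ln (1 + l * b k) - (l * b k - (l * b k)\<^sup>2 / 2)" for k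
  have r: "\<bar>r k\<bar> \<le> \<bar>l\<bar> ^ 3 * c * (b k)\<^sup>2" for k
  proof -
    have "\<bar>r k\<bar> \<le> \<bar>l * b k\<bar> ^ 3" unfolding r_def by (rule ln_one_plus_third_order[OF small])
    also have "\<dots> = \<bar>l\<bar> ^ 3 * \<bar>b k\<bar> * (b k)\<^sup>2"
    proof -
      have "\<bar>b k\<bar> ^ Suc 2 = \<bar>b k\<bar> * (b k)\<^sup>2" unfolding power_Suc by simp
      then have "\<bar>b k\<bar> ^ 3 = \<bar>b k\<bar> * (b k)\<^sup>2" by simp
      then show ?thesis by (simp add: abs_mult power_mult_distrib)
    qed
    also have "\<dots> \<le> \<bar>l\<bar> ^ 3 * c * (b k)\<^sup>2"
      unfolding b_def by (intro mult_right_mono mult_left_mono abs_block_le) auto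
    finally show ?thesis .
  qed
  have "1 + l * b k = exp (l * b k - l\<^sup>2 / 2 * (b k)\<^sup>2 + r k)" for k
    using small[of k] unfolding r_def by (simp add: power_mult_distrib)
  then have "block_prod \<alpha> \<beta> l n x = (\<Prod>k<n. exp (l * b k - l\<^sup>2 / 2 * (b k)\<^sup>2 + r k))"
    by (simp add: block_prod_def b_def)
  also have "\<dots> = exp (\<Sum>k<n. l * b k - l\<^sup>2 / 2 * (b k)\<^sup>2 + r k)" by (simp add: exp_sum)
  also have "(\<Sum>k<n. l * b k - l\<^sup>2 / 2 * (b k)\<^sup>2 + r k)
      = l * block_sum \<alpha> \<beta> n x - l\<^sup>2 / 2 * block_var \<alpha> \<beta> n x + (\<Sum>k<n. r k)"
    by (simp add: block_sum_def block_var_def b_def sum.distrib sum_subtractf sum_distrib_left)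
  finally have 1: "block_prod \<alpha> \<beta> l n x = exp (l * block_sum \<alpha> \<beta> n x - l\<^sup>2 / 2 * block_var \<alpha> \<beta> n x + (\<Sum>k<n. r k))" .
  have "\<bar>\<Sum>k<n. r k\<bar> \<le> (\<Sum>k<n. \<bar>l\<bar> ^ 3 * c * (b k)\<^sup>2)"
    by (rule order_trans[OF sum_abs]) (intro sum_mono r)
  also have "\<dots> = \<bar>l\<bar> ^ 3 * c * block_var \<alpha> \<beta> n x"
    by (simp add: block_var_def b_def sum_distrib_left)
  finally show thesis using that[OF 1] by blast
qed

text \<open>Once the clock has passed \<beta> the block variation is \<open>s\<close> up to
  \<open>c\<^sup>2\<close>. The product then agrees with the Gaussian form
  \<open>exp (l * block_sum - l\<^sup>2 / 2 * s)\<close> up to a factor \<open>exp e\<close> that is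
  common to all tilts of size at most \<open>L\<close>.\<close>

lemma block_prod_estimates:
  assumes \<alpha>: "0 \<le> \<alpha>" "\<alpha> \<le> \<beta>" and s: "s = \<beta> - \<alpha>" and L: "\<bar>l\<bar> \<le> L" "L * c \<le> 1 / 2"
    and e: "e = L\<^sup>2 * c\<^sup>2 / 2 + L ^ 3 * c * (s + c\<^sup>2)" and n: "\<beta> \<le> clock n x"
  shows "block_prod \<alpha> \<beta> l n x \<le> exp (l * block_sum \<alpha> \<beta> n x - l\<^sup>2 / 2 * s + e)"
    and "exp (l * block_sum \<alpha> \<beta> n x - l\<^sup>2 / 2 * s - e) \<le> block_prod \<alpha> \<beta> l n x"
proof -
  have "\<bar>l\<bar> * c \<le> L * c" using L c_nonneg by (intro mult_right_mono) auto
  then have "\<bar>l\<bar> * c \<le> 1 / 2" using L by linarith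
  then obtain e' where e': "block_prod \<alpha> \<beta> l n x = exp (l * block_sum \<alpha> \<beta> n x - l\<^sup>2 / 2 * block_var \<alpha> \<beta> n x + e')"
    and "\<bar>e'\<bar> \<le> \<bar>l\<bar> ^ 3 * c * block_var \<alpha> \<beta> n x" by (rule block_prod_eq_exp)
  note this(2)
  also have "\<bar>l\<bar> ^ 3 * c * block_var \<alpha> \<beta> n x \<le> L ^ 3 * c * (s + c\<^sup>2)"
    using L c_nonneg block_var_le[OF \<alpha>(2)] block_var_nonneg s
    by (intro mult_mono power_mono) (auto intro!: mult_nonneg_nonneg)
  finally have e'2: "\<bar>e'\<bar> \<le> L ^ 3 * c * (s + c\<^sup>2)" .
  have l2: "l\<^sup>2 \<le> L\<^sup>2" using L power_mono[of "\<bar>l\<bar>" L 2] by simp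
  have "\<bar>block_var \<alpha> \<beta> n x - s\<bar> \<le> c\<^sup>2"
    using block_var_le[OF \<alpha>(2), of n x] block_var_ge[OF \<alpha>(1) n] s by linarith
  then have "\<bar>l\<^sup>2 / 2 * (block_var \<alpha> \<beta> n x - s)\<bar> \<le> L\<^sup>2 / 2 * c\<^sup>2"
    unfolding abs_mult using l2 by (intro mult_mono) auto
  then have "\<bar>l\<^sup>2 / 2 * block_var \<alpha> \<beta> n x - l\<^sup>2 / 2 * s\<bar> \<le> L\<^sup>2 * c\<^sup>2 / 2"
    by (simp add: right_diff_distrib)
  with e'2 show "block_prod \<alpha> \<beta> l n x \<le> exp (l * block_sum \<alpha> \<beta> n x - l\<^sup>2 / 2 * s + e)"
    and "exp (l * block_sum \<alpha> \<beta> n x - l\<^sup>2 / 2 * s - e) \<le> block_prod \<alpha> \<beta> l n x"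
    unfolding e' e exp_le_cancel_iff by linarith+
qed

lemma block_prod_nonneg:
  assumes "\<bar>l\<bar> * c \<le> 1 / 2"
  shows "0 \<le> block_prod \<alpha> \<beta> l n x"
  by (rule block_prod_eq_exp[OF assms, of \<alpha> \<beta> n x]) simp

text \<open>Comparing the square at tilt \<open>l\<close> with the product at tilt
  \<open>2 * l\<close>, whose mean is known exactly, gives a second moment bound that does not
  depend on \<open>n\<close>.\<close>

lemma block_prod_square_le:
  assumes "\<bar>l\<bar> * c \<le> 1 / 4" "\<alpha> \<le> \<beta>"
  shows "(block_prod \<alpha> \<beta> l n x)\<^sup>2 \<le> exp (2 * l\<^sup>2 * (\<beta> - \<alpha> + c\<^sup>2)) * block_prod \<alpha> \<beta> (2 * l) n x"
proof -
  define t where "t k = l * block \<alpha> \<beta> k x" for k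
  have t: "\<bar>t k\<bar> \<le> 1 / 4" for k
  proof -
    have "\<bar>t k\<bar> \<le> \<bar>l\<bar> * c" unfolding abs_mult t_def by (intro mult_left_mono abs_block_le) auto
    with assms show ?thesis by linarith
  qed
  have "(block_prod \<alpha> \<beta> l n x)\<^sup>2 = (\<Prod>k<n. (1 + t k)\<^sup>2)"
    by (simp add: block_prod_def t_def prod_power_distrib)
  also have "\<dots> \<le> (\<Prod>k<n. exp (2 * (t k)\<^sup>2) * (1 + 2 * t k))"
  proof (intro prod_mono conjI)
    fix k
    have "(1 + t k)\<^sup>2 \<le> (1 + 2 * (t k)\<^sup>2) * (1 + 2 * t k)"
    proof -
      \<comment> \<open>This product is the difference of the two sides;
        \<open>\<bar>t k\<bar> \<le> 1 / 4\<close> is what makes it nonnegative.\<close>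
      have "0 \<le> (t k)\<^sup>2 * (1 + 4 * t k)" using t[of k] by (intro mult_nonneg_nonneg) auto
      then show ?thesis by (simp add: power2_eq_square algebra_simps)
    qed
    also have "\<dots> \<le> exp (2 * (t k)\<^sup>2) * (1 + 2 * t k)"
      using t[of k] by (intro mult_right_mono exp_ge_add_one_self) auto
    finally show "(1 + t k)\<^sup>2 \<le> exp (2 * (t k)\<^sup>2) * (1 + 2 * t k)" .
  qed simp
  also have "\<dots> = exp (2 * l\<^sup>2 * block_var \<alpha> \<beta> n x) * block_prod \<alpha> \<beta> (2 * l) n x"
    by (simp add: prod.distrib exp_sum[symmetric] block_prod_def block_var_def t_def power_mult_distrib
        sum_distrib_left mult.assoc)
  also have "\<dots> \<le> exp (2 * l\<^sup>2 * (\<beta> - \<alpha> + c\<^sup>2)) * block_prod \<alpha> \<beta> (2 * l) n x"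
    using block_var_le[OF assms(2)] assms(1) by (intro mult_right_mono block_prod_nonneg) (auto intro!: mult_left_mono)
  finally show ?thesis .
qed

text \<open>Cauchy-Schwarz with the uniform second moment: paths that are still inside the block at
  time \<open>n\<close> carry little of the product when they are improbable.\<close>

lemma integral_block_prod_clock_le:
  assumes "\<bar>l\<bar> * c \<le> 1 / 4" "\<alpha> \<le> \<beta>"
  shows "(\<integral>x. block_prod \<alpha> \<beta> l n x * indicator {x\<in>space M. clock n x < \<gamma>} x \<partial>M)
    \<le> exp (l\<^sup>2 * (\<beta> - \<alpha> + c\<^sup>2)) * sqrt (measure M {x\<in>space M. clock n x < \<gamma>})"
proof -
  let ?S = "{x\<in>space M. clock n x < \<gamma>}"
  have [measurable]: "?S \<in> sets M" by measurable
  have sqZ: "square_integrable M (block_prod \<alpha> \<beta> l n)"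
  proof -
    have "\<bar>block_prod \<alpha> \<beta> l n x\<bar> \<le> \<bar>(1 + \<bar>l\<bar> * c) ^ n\<bar>" for x
      using abs_block_prod_le[of \<alpha> \<beta> l n x] by linarith
    then show ?thesis by (intro square_integrable_bound[OF square_integrable_const]) auto
  qed
  have sqI: "square_integrable M (indicator ?S)"
    by (rule square_integrable_bound[OF square_integrable_const[of 1]]) auto
  have "(norm_L2 M (block_prod \<alpha> \<beta> l n))\<^sup>2 \<le> (\<integral>x. exp (2 * l\<^sup>2 * (\<beta> - \<alpha> + c\<^sup>2)) * block_prod \<alpha> \<beta> (2 * l) n x \<partial>M)"
    unfolding norm_L2_power2
    by (intro integral_mono block_prod_square_le assms square_integrable_integrable_square[OF sqZ]
        integrable_mult_right integrable_block_prod)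
  also have "\<dots> = (exp (l\<^sup>2 * (\<beta> - \<alpha> + c\<^sup>2)))\<^sup>2"
    by (simp add: integral_block_prod_1 power2_eq_square exp_add[symmetric])
  finally have nZ: "norm_L2 M (block_prod \<alpha> \<beta> l n) \<le> exp (l\<^sup>2 * (\<beta> - \<alpha> + c\<^sup>2))"
    by (rule power2_le_imp_le) simp
  have "(\<lambda>x. (indicator ?S x :: real)\<^sup>2) = indicator ?S" by (auto simp: indicator_def)
  then have nI: "norm_L2 M (indicator ?S) = sqrt (measure M ?S)"
    by (simp add: norm_L2_def)
  have "(\<integral>x. block_prod \<alpha> \<beta> l n x * indicator ?S x \<partial>M) \<le> norm_L2 M (block_prod \<alpha> \<beta> l n) * norm_L2 M (indicator ?S)"
    using integral_mult_le_norm_L2[OF sqZ sqI] by linarith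
  also have "\<dots> \<le> exp (l\<^sup>2 * (\<beta> - \<alpha> + c\<^sup>2)) * sqrt (measure M ?S)"
    unfolding nI by (intro mult_right_mono nZ) auto
  finally show ?thesis .
qed

text \<open>The tilt \<open>l\<close> puts the tilted mean \<open>l * s\<close> at the midpoint of
  \<open>[a, b]\<close>. The side tilts are \<open>a / s\<close> and \<open>b / s\<close>, and their
  relative cost is the same, \<open>q\<close>. Under the main tilt most of the mass has its sum in
  the window, and undoing the tilt costs at most the factor \<open>K\<close>. The additive term
  accounts for unfinished blocks.\<close>

lemma block_step:
  fixes A :: "nat \<Rightarrow> 'a set"
  assumes A: "\<And>n. A n \<in> sets (Filt n)"
    and mono: "\<And>n. A n \<subseteq> A (Suc n)"
    and determined: "\<And>n x. x \<in> A (Suc n) \<Longrightarrow> \<alpha> \<le> clock n x \<Longrightarrow> x \<in> A n"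
    and \<alpha>: "0 \<le> \<alpha>" "\<alpha> < \<beta>" and s: "s = \<beta> - \<alpha>"
    and ab: "0 \<le> a" "a \<le> b" and small: "b / s * c \<le> 1 / 4"
    and l: "l = (a + b) / (2 * s)"
    and e: "e = (b / s)\<^sup>2 * c\<^sup>2 / 2 + (b / s) ^ 3 * c * (s + c\<^sup>2)"
    and K: "K = exp (l\<^sup>2 / 2 * s - l * b)"
    and q: "q = exp (e - (b - a)\<^sup>2 / (8 * s))"
  shows "measure M {x\<in>A n. \<beta> \<le> clock n x \<and> block_sum \<alpha> \<beta> n x < a}
    \<le> measure M (A n) * (1 - K * (exp (- e) - 2 * q))
      + K * exp (l\<^sup>2 * (s + c\<^sup>2)) * sqrt (measure M {x\<in>space M. clock n x < \<beta>})"
proof -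
  have s0: "0 < s" using \<alpha> s by simp
  \<comment> \<open>Half the window width divided by \<open>s\<close>, so that \<open>l - d\<close>
    and \<open>l + d\<close> are the tilts centred at \<open>a\<close> and \<open>b\<close>.\<close>
  define d where "d = (b - a) / (2 * s)"
  have d0: "0 \<le> d" and l0: "0 \<le> l" using ab s0 by (auto simp: d_def l)
  have lmd: "l - d = a / s" and lpd: "l + d = b / s"
    using s0 by (auto simp: l d_def field_simps)
  have abL: "a / s \<le> b / s" using ab s0 by (intro divide_right_mono) auto
  have bs0: "0 \<le> b / s" "0 \<le> a / s" using ab s0 by auto
  have le1: "\<bar>l\<bar> \<le> b / s" "\<bar>l - d\<bar> \<le> b / s" "\<bar>l + d\<bar> \<le> b / s"
    using lmd lpd d0 l0 abL bs0 by linarith+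
  have small': "\<bar>t\<bar> * c \<le> 1 / 4" if "\<bar>t\<bar> \<le> b / s" for t
    using mult_right_mono[OF that c_nonneg] small by linarith
  have e0: "0 \<le> e" unfolding e using bs0 c_nonneg s0 by (intro add_nonneg_nonneg mult_nonneg_nonneg) auto
  have AM [measurable]: "A n \<in> sets M" using A[of n] subalg_Filt[of n] by (auto simp: subalgebra_def)
  define T where "T = {x\<in>space M. clock n x < \<beta>}"
  define E where "E = {x\<in>A n. \<beta> \<le> clock n x \<and> a \<le> block_sum \<alpha> \<beta> n x}"
  define F where "F = {x\<in>A n. \<beta> \<le> clock n x \<and> block_sum \<alpha> \<beta> n x < a}"
  have TM [measurable]: "T \<in> sets M" unfolding T_def by measurable
  have EM [measurable]: "E \<in> sets M" unfolding E_def by measurable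
  have FM [measurable]: "F \<in> sets M" unfolding F_def by measurable
  have Asp: "A n \<subseteq> space M" using AM by (rule sets.sets_into_space)
  let ?Z = "\<lambda>t. block_prod \<alpha> \<beta> t n"
  have Z0: "0 \<le> ?Z t x" if "\<bar>t\<bar> \<le> b / s" for t x
    using small'[OF that] by (intro block_prod_nonneg) simp
  have K0: "0 < K" by (simp add: K)
  have q0: "0 < q" by (simp add: q)
  \<comment> \<open>On finished paths of \<open>A n\<close> this is
    \<open>indicator_ge_exponentials\<close> with exponentials replaced by products. Integrals are
    known exactly only over all of \<open>A n\<close>, so the main term is corrected by its part on
    \<open>T\<close>, and elsewhere the left side is at most 0.\<close>
  have pw: "K * (exp (- e) * (?Z l x * indicator (A n) x - ?Z l x * indicator T x)
      - q * (?Z (l - d) x * indicator (A n) x) - q * (?Z (l + d) x * indicator (A n) x)) \<le> indicator E x"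
    if x: "x \<in> space M" for x
  proof (cases "x \<in> A n \<and> x \<notin> T")
    case True
    then have cl: "\<beta> \<le> clock n x" using x by (auto simp: T_def)
    let ?X = "block_sum \<alpha> \<beta> n x"
    note est = block_prod_estimates[OF \<alpha>(1) less_imp_le[OF \<alpha>(2)] s _ _ e cl]
    have sm: "b / s * c \<le> 1 / 2" using small by linarith
    have 1: "?Z l x * exp (- e) \<le> exp (l * ?X) * exp (- (l\<^sup>2 / 2 * s))"
    proof -
      have "?Z l x * exp (- e) \<le> exp (l * ?X - l\<^sup>2 / 2 * s + e) * exp (- e)"
        by (intro mult_right_mono est(1) le1 sm) auto
      then show ?thesis by (simp add: exp_add[symmetric])
    qed
    have 2: "exp (t * ?X) \<le> ?Z t x * exp (t\<^sup>2 / 2 * s + e)" if t: "\<bar>t\<bar> \<le> b / s" for t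
    proof -
      have "exp (t * ?X - t\<^sup>2 / 2 * s - e) * exp (t\<^sup>2 / 2 * s + e) \<le> ?Z t x * exp (t\<^sup>2 / 2 * s + e)"
        by (intro mult_right_mono est(2) t sm) auto
      then show ?thesis by (simp add: exp_add[symmetric])
    qed
    have ls: "l * s = (a + b) / 2" and ds: "d * s = (b - a) / 2"
      using s0 by (auto simp: l d_def)
    have dd: "d\<^sup>2 * s = (b - a)\<^sup>2 / (4 * s)"
      using s0 by (simp add: d_def power2_eq_square field_simps)
    have dba: "d * (b - a) = (b - a)\<^sup>2 / (2 * s)"
      by (simp add: d_def power2_eq_square)
    \<comment> \<open>Completing the square: with \<open>l * s\<close> at the midpoint, both side
      terms carry the same saving \<open>(b - a)\<^sup>2 / (8 * s)\<close>.\<close>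
    have 3: "d * a + ((l - d)\<^sup>2 / 2 * s + e) = l\<^sup>2 / 2 * s + (e - (b - a)\<^sup>2 / (8 * s))"
    proof -
      have "d * a + (l - d)\<^sup>2 / 2 * s = l\<^sup>2 / 2 * s + d * a - d * (l * s) + (d\<^sup>2 * s) / 2"
        by (simp add: power2_eq_square field_simps)
      also have "\<dots> = l\<^sup>2 / 2 * s - (d * (b - a)) / 2 + (d\<^sup>2 * s) / 2"
        unfolding ls by (simp add: field_simps)
      also have "\<dots> = l\<^sup>2 / 2 * s - (b - a)\<^sup>2 / (8 * s)" unfolding dd dba by simp
      finally show ?thesis by simp
    qed
    have 4: "- d * b + ((l + d)\<^sup>2 / 2 * s + e) = l\<^sup>2 / 2 * s + (e - (b - a)\<^sup>2 / (8 * s))"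
    proof -
      have "- d * b + (l + d)\<^sup>2 / 2 * s = l\<^sup>2 / 2 * s - d * b + d * (l * s) + (d\<^sup>2 * s) / 2"
        by (simp add: power2_eq_square field_simps)
      also have "\<dots> = l\<^sup>2 / 2 * s - (d * (b - a)) / 2 + (d\<^sup>2 * s) / 2"
        unfolding ls by (simp add: field_simps)
      also have "\<dots> = l\<^sup>2 / 2 * s - (b - a)\<^sup>2 / (8 * s)" unfolding dd dba by simp
      finally show ?thesis by simp
    qed
    have 5: "exp (l\<^sup>2 / 2 * s) * (?Z l x * exp (- e)) \<le> exp (l * ?X)"
    proof -
      have "exp (l\<^sup>2 / 2 * s) * (?Z l x * exp (- e)) \<le> exp (l\<^sup>2 / 2 * s) * (exp (l * ?X) * exp (- (l\<^sup>2 / 2 * s)))"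
        by (intro mult_left_mono 1) auto
      then show ?thesis by (simp add: exp_add[symmetric])
    qed
    have 6: "exp (d * a) * exp ((l - d) * ?X) \<le> exp (l\<^sup>2 / 2 * s) * (q * ?Z (l - d) x)"
    proof -
      have "exp (d * a) * exp ((l - d) * ?X) \<le> exp (d * a) * (?Z (l - d) x * exp ((l - d)\<^sup>2 / 2 * s + e))"
        by (intro mult_left_mono 2 le1) auto
      also have "\<dots> = exp (d * a + ((l - d)\<^sup>2 / 2 * s + e)) * ?Z (l - d) x" by (simp only: exp_add mult_ac)
      also have "\<dots> = exp (l\<^sup>2 / 2 * s) * (q * ?Z (l - d) x)" unfolding 3 q exp_add by simp
      finally show ?thesis .
    qed
    have 7: "exp (- d * b) * exp ((l + d) * ?X) \<le> exp (l\<^sup>2 / 2 * s) * (q * ?Z (l + d) x)"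
    proof -
      have "exp (- d * b) * exp ((l + d) * ?X) \<le> exp (- d * b) * (?Z (l + d) x * exp ((l + d)\<^sup>2 / 2 * s + e))"
        by (intro mult_left_mono 2 le1) auto
      also have "\<dots> = exp (- d * b + ((l + d)\<^sup>2 / 2 * s + e)) * ?Z (l + d) x" by (simp only: exp_add mult_ac)
      also have "\<dots> = exp (l\<^sup>2 / 2 * s) * (q * ?Z (l + d) x)" unfolding 4 q exp_add by simp
      finally show ?thesis .
    qed
    have "exp (l\<^sup>2 / 2 * s) * (?Z l x * exp (- e) - q * ?Z (l - d) x - q * ?Z (l + d) x)
        \<le> exp (l * b) * (if a \<le> ?X then 1 else 0)"
      using indicator_ge_exponentials[OF d0 l0, of ?X a b] 5 6 7
      unfolding right_diff_distrib by linarith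
    then have "exp (- (l * b)) * (exp (l\<^sup>2 / 2 * s) * (?Z l x * exp (- e) - q * ?Z (l - d) x - q * ?Z (l + d) x))
        \<le> exp (- (l * b)) * (exp (l * b) * (if a \<le> ?X then 1 else 0))"
      by (intro mult_left_mono) auto
    also have "exp (- (l * b)) * (exp (l * b) * (if a \<le> ?X then 1 else 0)) = (if a \<le> ?X then 1 else 0)"
      by (simp add: exp_minus)
    also have "\<dots> = indicator E x" using True cl by (simp add: E_def)
    also have "exp (- (l * b)) * (exp (l\<^sup>2 / 2 * s) * (?Z l x * exp (- e) - q * ?Z (l - d) x - q * ?Z (l + d) x))
        = K * (?Z l x * exp (- e) - q * ?Z (l - d) x - q * ?Z (l + d) x)"
    proof -
      have "K = exp (- (l * b)) * exp (l\<^sup>2 / 2 * s)"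
        unfolding K exp_add[symmetric] by simp
      then show ?thesis by (simp only: mult.assoc)
    qed
    finally show ?thesis using True by (simp add: mult.commute)
  next
    case False
    have "?Z l x * indicator (A n) x \<le> ?Z l x * indicator T x"
      using False Z0[OF le1(1), of x] by (auto simp: indicator_def)
    then have "exp (- e) * (?Z l x * indicator (A n) x - ?Z l x * indicator T x) \<le> 0"
      by (intro mult_nonneg_nonpos) auto
    moreover have "0 \<le> q * (?Z (l - d) x * indicator (A n) x)" "0 \<le> q * (?Z (l + d) x * indicator (A n) x)"
      using q0 Z0[OF le1(2), of x] Z0[OF le1(3), of x] by auto
    ultimately have "K * (exp (- e) * (?Z l x * indicator (A n) x - ?Z l x * indicator T x)
      - q * (?Z (l - d) x * indicator (A n) x) - q * (?Z (l + d) x * indicator (A n) x)) \<le> 0"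
      using K0 by (intro mult_nonneg_nonpos) auto
    also have "0 \<le> (indicator E x :: real)" by simp
    finally show ?thesis .
  qed
  note intA = integrable_block_prod_indicator[OF AM] and intT = integrable_block_prod_indicator[OF TM]
  \<comment> \<open>For each of the three tilts the integral over \<open>A n\<close> is just the
    measure of \<open>A n\<close>; this is what makes the bound conditional on the past.\<close>
  note EA = integral_block_prod[of A, OF A mono determined]
  define ET where "ET = (\<integral>x. ?Z l x * indicator T x \<partial>M)"
  have ET: "ET \<le> exp (l\<^sup>2 * (s + c\<^sup>2)) * sqrt (measure M T)"
    unfolding ET_def T_def s using \<alpha>(2) by (intro integral_block_prod_clock_le small' le1) auto
  have ET0: "0 \<le> ET" unfolding ET_def using Z0[OF le1(1)] by (intro integral_nonneg_AE) auto
  have "K * (exp (- e) * (measure M (A n) - ET) - q * measure M (A n) - q * measure M (A n))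
      = (\<integral>x. K * (exp (- e) * (?Z l x * indicator (A n) x - ?Z l x * indicator T x)
      - q * (?Z (l - d) x * indicator (A n) x) - q * (?Z (l + d) x * indicator (A n) x)) \<partial>M)"
    using intA intT by (simp add: EA ET_def)
  also have "\<dots> \<le> (\<integral>x. indicator E x \<partial>M)"
  proof (rule integral_mono)
    show "integrable M (indicator E :: 'a \<Rightarrow> real)"
      by (rule integrable_real_indicator) (auto simp: emeasure_eq_measure)
  qed (use pw intA intT in auto)
  also have "\<dots> = measure M E" by simp
  finally have mE: "K * (exp (- e) * (measure M (A n) - ET) - q * measure M (A n) - q * measure M (A n)) \<le> measure M E" .
  have "measure M F + measure M E = measure M (F \<union> E)"
    by (intro finite_measure_Union[symmetric]) (auto simp: E_def F_def)
  also have "\<dots> \<le> measure M (A n)"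
    by (intro finite_measure_mono) (auto simp: E_def F_def)
  finally have "measure M F \<le> measure M (A n) - K * (exp (- e) * (measure M (A n) - ET) - q * measure M (A n) - q * measure M (A n))"
    using mE by linarith
  also have "\<dots> = measure M (A n) * (1 - K * (exp (- e) - 2 * q)) + K * (exp (- e) * ET)"
    by (simp add: algebra_simps)
  also have "\<dots> \<le> measure M (A n) * (1 - K * (exp (- e) - 2 * q)) + K * (exp (l\<^sup>2 * (s + c\<^sup>2)) * sqrt (measure M T))"
  proof -
    have "exp (- e) * ET \<le> 1 * ET" using ET0 e0 by (intro mult_right_mono) auto
    with ET have "exp (- e) * ET \<le> exp (l\<^sup>2 * (s + c\<^sup>2)) * sqrt (measure M T)" by linarith
    then show ?thesis using K0 by (intro add_left_mono mult_left_mono) auto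
  qed
  finally show ?thesis by (simp add: F_def T_def mult.assoc)
qed

lemma AE_clock_limit: "AE x in M. (\<lambda>n. clock n x / real n) \<longlonglongrightarrow> (norm_L2 M D)\<^sup>2"
  unfolding clock_def norm_L2_power2
  by (rule birkhoff_ergodic)
     (use D in \<open>auto simp: martingale_difference_def intro: square_integrable_integrable_square\<close>)

end

section \<open>Geometric blocks: large increments cannot be avoided forever\<close>

locale nondegenerate_bounded_martingale_difference = bounded_martingale_difference +
  assumes nondegenerate: "0 < norm_L2 M D"
begin

lemma clock_at_top:
  assumes "(\<lambda>n. clock n x / real n) \<longlonglongrightarrow> (norm_L2 M D)\<^sup>2"
  shows "filterlim (\<lambda>n. clock n x) at_top sequentially"
proof -
  have "filterlim (\<lambda>n. clock n x / real n * real n) at_top sequentially"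
    using nondegenerate
    by (intro filterlim_tendsto_pos_mult_at_top[OF assms] filterlim_real_sequentially) auto
  moreover have "eventually (\<lambda>n. clock n x / real n * real n = clock n x) sequentially"
    using eventually_gt_at_top[of 0] by eventually_elim simp
  ultimately show ?thesis by (simp add: filterlim_cong)
qed

lemma measure_clock_less_tendsto_0: "(\<lambda>n. measure M {x\<in>space M. clock n x < \<gamma>}) \<longlonglongrightarrow> 0"
proof -
  have "(\<lambda>n. \<integral>x. indicator {x\<in>space M. clock n x < \<gamma>} x \<partial>M) \<longlonglongrightarrow> (\<integral>x. (0::real) \<partial>M)"
  proof (rule integral_dominated_convergence[where w="\<lambda>_. 1"])
    show "AE x in M. (\<lambda>n. indicator {x\<in>space M. clock n x < \<gamma>} x) \<longlonglongrightarrow> (0::real)"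
      using AE_clock_limit
    proof eventually_elim
      case (elim x)
      have "eventually (\<lambda>n. \<gamma> \<le> clock n x) sequentially"
        using clock_at_top[OF elim] by (simp add: filterlim_at_top)
      then show ?case by (intro tendsto_eventually) (auto elim: eventually_mono simp: indicator_def)
    qed
  qed (auto simp: indicator_def)
  then show ?thesis by simp
qed

lemma c_pos: "0 < c"
proof (rule ccontr)
  assume "\<not> 0 < c"
  then have "D = (\<lambda>x. 0)" using D_bounded by (intro ext) (meson abs_le_zero_iff not_less order_trans)
  with nondegenerate show False by simp
qed

definition block_length :: "real \<Rightarrow> nat \<Rightarrow> real" where
  "block_length r j = r ^ j * (r - 1)"

text \<open>Chosen so that the Gaussian exponent
  \<open>(level r j)\<^sup>2 / (2 * block_length r j)\<close> equals \<open>ln (Suc j)\<close>: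
  exceeding the level has probability of order \<open>1 / (j + 1)\<close> up to smaller powers, on
  the edge of divergence.\<close>

definition level :: "real \<Rightarrow> nat \<Rightarrow> real" where
  "level r j = sqrt (2 * block_length r j * ln (real (Suc j)))"

text \<open>The fixed observation time \<open>n\<close> and the condition
  \<open>r ^ j \<le> clock n x\<close> give the event the shape that
  \<open>integral_block_prod\<close> demands: it lies in \<open>Filt n\<close>, grows with
  \<open>n\<close>, and is decided once the clock has reached \<open>r ^ j\<close>.\<close>

definition avoiding :: "real \<Rightarrow> real \<Rightarrow> nat \<Rightarrow> nat \<Rightarrow> nat \<Rightarrow> 'a set" where
  "avoiding r \<eta> J j n = {x\<in>space M. r ^ j \<le> clock n x \<and>
     (\<forall>i\<in>{J..<j}. block_sum (r ^ i) (r ^ Suc i) n x < (1 - \<eta>) * level r i)}"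

lemma block_length_pos: "1 < r \<Longrightarrow> 0 < block_length r j"
  by (simp add: block_length_def)

lemma avoiding_Filt: "avoiding r \<eta> J j n \<in> sets (Filt n)"
proof -
  have "{x\<in>space (Filt n). r ^ j \<le> clock n x \<and>
     (\<forall>i\<in>{J..<j}. block_sum (r ^ i) (r ^ Suc i) n x < (1 - \<eta>) * level r i)} \<in> sets (Filt n)"
    by (intro sets.sets_Collect_conj sets.sets_Collect_finite_All borel_measurable_le borel_measurable_less
        clock_Filt block_sum_Filt borel_measurable_const finite_atLeastLessThan)
  then show ?thesis by (simp add: avoiding_def)
qed

lemma block_sum_Suc_eq:
  assumes "1 < r" "i < j" "r ^ j \<le> clock n x"
  shows "block_sum (r ^ i) (r ^ Suc i) (Suc n) x = block_sum (r ^ i) (r ^ Suc i) n x"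
proof -
  have "r ^ Suc i \<le> r ^ j" using assms by (intro power_increasing) auto
  then have "\<not> clock n x < r ^ Suc i" using assms(3) by linarith
  then show ?thesis by (simp add: block_sum_def block_def)
qed

lemma avoiding_mono:
  assumes "1 < r"
  shows "avoiding r \<eta> J j n \<subseteq> avoiding r \<eta> J j (Suc n)"
proof
  fix x assume x: "x \<in> avoiding r \<eta> J j n"
  then have "r ^ j \<le> clock (Suc n) x"
    using clock_mono[of n "Suc n" x] by (auto simp: avoiding_def)
  with x show "x \<in> avoiding r \<eta> J j (Suc n)"
    using block_sum_Suc_eq[OF assms, of _ j n x] by (auto simp: avoiding_def)
qed

lemma avoiding_determined:
  assumes "1 < r" "x \<in> avoiding r \<eta> J j (Suc n)" "r ^ j \<le> clock n x"
  shows "x \<in> avoiding r \<eta> J j n"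
  using assms(2,3) block_sum_Suc_eq[OF assms(1) _ assms(3)] by (auto simp: avoiding_def)

lemma avoiding_Suc:
  assumes "1 < r" "J \<le> j"
  shows "avoiding r \<eta> J (Suc j) n = {x\<in>avoiding r \<eta> J j n. r ^ Suc j \<le> clock n x \<and>
    block_sum (r ^ j) (r ^ Suc j) n x < (1 - \<eta>) * level r j}"
proof -
  have "r ^ j \<le> r ^ Suc j" using assms by (intro power_increasing) auto
  moreover have "{J..<Suc j} = insert j {J..<j}" using assms by auto
  ultimately show ?thesis unfolding avoiding_def by (auto simp del: power_Suc)
qed

text \<open>Each block multiplies the probability of avoidance by at most
  \<open>1 - 1 / (2 * (j + 1))\<close>, and the product of these factors decays like the square root
  of \<open>J / j\<close>. The slack \<epsilon> collects the unfinished clocks; it is halved at each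
  induction step, so the time from which the bound holds depends on \<open>j\<close> while
  \<open>J0\<close> does not.\<close>

lemma avoiding_eventually_small:
  assumes r: "1 < r" and \<eta>: "0 < \<eta>" "\<eta> < 1"
  obtains J0 where "\<And>J j \<epsilon>. J0 \<le> J \<Longrightarrow> J \<le> j \<Longrightarrow> 0 < \<epsilon> \<Longrightarrow>
    eventually (\<lambda>n. measure M (avoiding r \<eta> J j n) \<le> sqrt (real (Suc J) / real (Suc j)) + \<epsilon>) sequentially"
proof -
  define L where "L j = level r j / block_length r j" for j
  define e where "e j = (L j)\<^sup>2 * c\<^sup>2 / 2 + (L j) ^ 3 * c * (block_length r j + c\<^sup>2)" for j
  define q where "q j = exp (e j - ((level r j - (1 - \<eta>) * level r j))\<^sup>2 / (8 * block_length r j))" for j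
  define l where "l j = ((1 - \<eta>) * level r j + level r j) / (2 * block_length r j)" for j
  define K where "K j = exp ((l j)\<^sup>2 / 2 * block_length r j - l j * level r j)" for j
  have level2: "(level r j)\<^sup>2 = 2 * block_length r j * ln (real (Suc j))" for j
    using block_length_pos[OF r, of j] by (simp add: level_def)
  have e_lim: "e \<longlonglongrightarrow> 0"
    unfolding e_def[abs_def] L_def level_def block_length_def using r c_pos by real_asymp
  have L_lim: "L \<longlonglongrightarrow> 0"
    unfolding L_def[abs_def] level_def block_length_def using r by real_asymp
  \<comment> \<open>The window from \<open>(1 - \<eta>) * level\<close> to \<open>level\<close> has
    width \<open>\<eta> * level\<close>, hence the exponent \<open>\<eta>\<^sup>2 / 4\<close>; it is
    small but sends \<open>q\<close> to 0.\<close>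
  have q_eq: "q j = exp (e j - \<eta>\<^sup>2 / 4 * ln (real (Suc j)))" for j
  proof -
    have "level r j - (1 - \<eta>) * level r j = \<eta> * level r j" by (simp add: algebra_simps)
    then have "(level r j - (1 - \<eta>) * level r j)\<^sup>2 = \<eta>\<^sup>2 * (level r j)\<^sup>2"
      by (simp add: power_mult_distrib)
    then show ?thesis using block_length_pos[OF r, of j] unfolding q_def level2 by simp
  qed
  have q_lim: "q \<longlonglongrightarrow> 0"
  proof -
    have "(\<lambda>j. exp (e j) * exp (- (\<eta>\<^sup>2 / 4 * ln (real (Suc j))))) \<longlonglongrightarrow> exp 0 * 0"
    proof (intro tendsto_mult tendsto_exp e_lim)
      have "0 < \<eta>\<^sup>2 / 4" using \<eta> by simp
      then show "(\<lambda>j. exp (- (\<eta>\<^sup>2 / 4 * ln (real (Suc j))))) \<longlonglongrightarrow> 0" by real_asymp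
    qed
    moreover have "q = (\<lambda>j. exp (e j) * exp (- (\<eta>\<^sup>2 / 4 * ln (real (Suc j)))))"
      unfolding exp_add[symmetric] by (rule ext) (simp add: q_eq)
    ultimately show ?thesis by simp
  qed
  \<comment> \<open>The exponent works out as
    \<open>- (1 - \<eta>\<^sup>2 / 4) * ln (Suc j)\<close>; the term with \<open>\<eta>\<close> is
    simply dropped.\<close>
  have K_ge: "1 / real (Suc j) \<le> K j" for j
  proof -
    have l': "l j = (2 - \<eta>) / 2 * (level r j / block_length r j)"
      by (simp add: l_def algebra_simps add_divide_distrib diff_divide_distrib)
    have "(l j)\<^sup>2 / 2 * block_length r j - l j * level r j
      = ((2 - \<eta>)\<^sup>2 / 8 - (2 - \<eta>) / 2) * ((level r j)\<^sup>2 / block_length r j)"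
      unfolding l' using block_length_pos[OF r, of j] by (simp add: power2_eq_square field_simps)
    also have "\<dots> = - (1 - \<eta>\<^sup>2 / 4) * ln (real (Suc j))"
      unfolding level2 using block_length_pos[OF r, of j] by (simp add: power2_eq_square field_simps)
    also have "\<dots> \<ge> - ln (real (Suc j))"
      by (simp add: algebra_simps)
    finally have "exp (- ln (real (Suc j))) \<le> K j" unfolding K_def by simp
    then show ?thesis by (simp add: exp_minus divide_inverse)
  qed
  have "(\<lambda>j. exp (- e j) - 2 * q j) \<longlonglongrightarrow> exp (- 0) - 2 * 0"
    by (intro tendsto_intros e_lim q_lim)
  then have "eventually (\<lambda>j. 1 / 2 < exp (- e j) - 2 * q j) sequentially"
    by (rule order_tendstoD) simp
  moreover have "eventually (\<lambda>j. L j * c < 1 / 4) sequentially"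
    using order_tendstoD(2)[OF tendsto_mult_right[OF L_lim, of c], of "1 / 4"] by simp
  ultimately have "eventually (\<lambda>j. 1 / 2 < exp (- e j) - 2 * q j \<and> L j * c < 1 / 4) sequentially"
    by (rule eventually_conj)
  then obtain J0 where J0: "\<And>j. J0 \<le> j \<Longrightarrow> 1 / 2 < exp (- e j) - 2 * q j \<and> L j * c < 1 / 4"
    by (auto simp: eventually_sequentially)
  show thesis
  proof (rule that[of J0])
    fix J j :: nat and \<epsilon> :: real
    assume J: "J0 \<le> J" and "J \<le> j" and "0 < \<epsilon>"
    from \<open>J \<le> j\<close> \<open>0 < \<epsilon>\<close>
    show "eventually (\<lambda>n. measure M (avoiding r \<eta> J j n) \<le> sqrt (real (Suc J) / real (Suc j)) + \<epsilon>) sequentially"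
    proof (induction j arbitrary: \<epsilon> rule: dec_induct)
      case base
      have "measure M (avoiding r \<eta> J J n) \<le> 1" for n by simp
      then show ?case using base by (intro always_eventually allI) (auto intro: order_trans)
    next
      case (step j)
      have j: "J0 \<le> j" using J step by linarith
      define m where "m = real (Suc j)"
      have m1: "1 \<le> m" by (simp add: m_def)
      define p where "p = K j * (exp (- e j) - 2 * q j)"
      have p: "1 / (2 * m) \<le> p"
      proof -
        have "1 / m * (1 / 2) \<le> p"
          unfolding p_def using K_ge[of j] J0[OF j] m1
          by (intro mult_mono) (auto simp: m_def K_def)
        then show ?thesis by simp
      qed
      define R where "R n = K j * exp ((l j)\<^sup>2 * (block_length r j + c\<^sup>2)) *
        sqrt (measure M {x\<in>space M. clock n x < r ^ Suc j})" for n
      have "(\<lambda>n. R n) \<longlonglongrightarrow> K j * exp ((l j)\<^sup>2 * (block_length r j + c\<^sup>2)) * sqrt 0"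
        unfolding R_def by (intro tendsto_intros measure_clock_less_tendsto_0)
      then have R: "eventually (\<lambda>n. R n < \<epsilon> / 2) sequentially"
        by (rule order_tendstoD) (use step in simp)
      have main: "measure M (avoiding r \<eta> J (Suc j) n) \<le> measure M (avoiding r \<eta> J j n) * (1 - p) + R n" for n
        unfolding avoiding_Suc[OF r step(1)] p_def R_def
      proof (rule block_step[OF avoiding_Filt avoiding_mono[OF r] avoiding_determined[OF r] _ _ _ _ _ _ l_def])
        show "0 \<le> (1 - \<eta>) * level r j" "(1 - \<eta>) * level r j \<le> level r j"
          using \<eta> block_length_pos[OF r, of j] by (auto simp: level_def mult_left_le_one_le)
        show "level r j / block_length r j * c \<le> 1 / 4" using J0[OF j] by (simp add: L_def)
        show "K j = exp ((l j)\<^sup>2 / 2 * block_length r j - l j * level r j)" by (rule K_def)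
        show "q j = exp (e j - (level r j - (1 - \<eta>) * level r j)\<^sup>2 / (8 * block_length r j))" by (rule q_def)
        show "e j = (level r j / block_length r j)\<^sup>2 * c\<^sup>2 / 2 + (level r j / block_length r j) ^ 3 * c * (block_length r j + c\<^sup>2)"
          by (simp add: e_def L_def)
        show "block_length r j = r ^ Suc j - r ^ j" by (simp add: block_length_def algebra_simps)
      qed (use r in \<open>auto intro!: power_strict_increasing simp del: power_Suc\<close>)
      \<comment> \<open>The reduction factor is below \<open>sqrt (m / (m + 1))\<close>, so the
        bound passes from \<open>m\<close> to \<open>m + 1\<close> by telescoping under the
        root.\<close>
      have rec: "sqrt (real (Suc J) / m) * (1 - 1 / (2 * m)) \<le> sqrt (real (Suc J) / (m + 1))"
      proof -
        have "(1 - 1 / (2 * m))\<^sup>2 \<le> m / (m + 1)"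
        proof -
          have "(1 - 1 / (2 * m))\<^sup>2 * (4 * m\<^sup>2 * (m + 1)) = (2 * m - 1)\<^sup>2 * (m + 1)"
            using m1 by (simp add: power2_eq_square field_simps)
          also have "\<dots> = 4 * m\<^sup>2 * m - 3 * m + 1" by (simp add: power2_eq_square algebra_simps)
          also have "\<dots> \<le> 4 * m\<^sup>2 * m" using m1 by simp
          also have "\<dots> = m / (m + 1) * (4 * m\<^sup>2 * (m + 1))" using m1 by simp
          finally show ?thesis using m1 by (simp add: mult_le_cancel_right pos_le_divide_eq)
        qed
        then have "sqrt ((1 - 1 / (2 * m))\<^sup>2) \<le> sqrt (m / (m + 1))" by (rule real_sqrt_le_mono)
        then have "1 - 1 / (2 * m) \<le> sqrt (m / (m + 1))" by simp
        then have "sqrt (real (Suc J) / m) * (1 - 1 / (2 * m)) \<le> sqrt (real (Suc J) / m) * sqrt (m / (m + 1))"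
          using m1 by (intro mult_left_mono) auto
        also have "\<dots> = sqrt (real (Suc J) / (m + 1))" using m1 by (simp add: real_sqrt_mult[symmetric])
        finally show ?thesis .
      qed
      from step.IH[of "\<epsilon> / 2"] step.prems
      have "eventually (\<lambda>n. measure M (avoiding r \<eta> J j n) \<le> sqrt (real (Suc J) / m) + \<epsilon> / 2) sequentially"
        by (simp add: m_def)
      with R show ?case
      proof eventually_elim
        case (elim n)
        have frac: "0 \<le> 1 - 1 / (2 * m)" "1 - 1 / (2 * m) \<le> 1" using m1 by auto
        have "measure M (avoiding r \<eta> J (Suc j) n) \<le> measure M (avoiding r \<eta> J j n) * (1 - p) + R n" by (rule main)
        also have "\<dots> \<le> measure M (avoiding r \<eta> J j n) * (1 - 1 / (2 * m)) + R n"
          using p by (intro add_right_mono mult_left_mono) auto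
        also have "\<dots> \<le> (sqrt (real (Suc J) / m) + \<epsilon> / 2) * (1 - 1 / (2 * m)) + \<epsilon> / 2"
          using elim frac by (intro add_mono mult_right_mono) auto
        also have "\<dots> \<le> sqrt (real (Suc J) / (m + 1)) + \<epsilon> / 2 * 1 + \<epsilon> / 2"
          unfolding distrib_right using rec frac step.prems by (intro add_mono mult_left_mono) auto
        finally show ?case by (simp add: m_def add.commute)
      qed
    qed
  qed
qed

text \<open>A path with no large block from \<open>J\<close> on avoids all blocks between
  \<open>J\<close> and any \<open>j\<close>, an event whose probability vanishes as \<open>j\<close>
  grows. Independence is not involved.\<close>

lemma blocks_infinitely_often:
  assumes r: "1 < r" and \<eta>: "0 < \<eta>" "\<eta> < 1"
  shows "AE x in M. \<forall>J. \<exists>j\<ge>J. \<exists>n. r ^ Suc j \<le> clock n x \<and>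
    (1 - \<eta>) * level r j \<le> block_sum (r ^ j) (r ^ Suc j) n x"
proof -
  obtain J0 where J0: "\<And>J j \<epsilon>. J0 \<le> J \<Longrightarrow> J \<le> j \<Longrightarrow> 0 < \<epsilon> \<Longrightarrow>
    eventually (\<lambda>n. measure M (avoiding r \<eta> J j n) \<le> sqrt (real (Suc J) / real (Suc j)) + \<epsilon>) sequentially"
    using avoiding_eventually_small[OF assms] by blast
  define Bad where "Bad J = {x\<in>space M. \<forall>j\<in>{J..}. \<forall>n. r ^ Suc j \<le> clock n x \<longrightarrow>
    block_sum (r ^ j) (r ^ Suc j) n x < (1 - \<eta>) * level r j}" for J
  have Bad_meas [measurable]: "Bad J \<in> sets M" for J unfolding Bad_def by measurable
  have Bad_null: "measure M (Bad J) = 0" if J: "J0 \<le> J" for J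
  proof -
    have bound: "measure M (Bad J) \<le> 3 * \<epsilon>" if \<epsilon>: "0 < \<epsilon>" for \<epsilon>
    proof -
      have "(\<lambda>j. sqrt (real (Suc J) / real (Suc j))) \<longlonglongrightarrow> 0" by real_asymp
      then have "eventually (\<lambda>j. sqrt (real (Suc J) / real (Suc j)) < \<epsilon>) sequentially"
        by (rule order_tendstoD) (rule \<epsilon>)
      with eventually_ge_at_top[of J] have "eventually (\<lambda>j. J \<le> j \<and> sqrt (real (Suc J) / real (Suc j)) < \<epsilon>) sequentially"
        by (rule eventually_conj)
      then obtain j where j: "J \<le> j" "sqrt (real (Suc J) / real (Suc j)) < \<epsilon>"
        by (auto simp: eventually_sequentially)
      have "eventually (\<lambda>n. measure M {x\<in>space M. clock n x < r ^ j} < \<epsilon>) sequentially"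
        by (rule order_tendstoD(2)[OF measure_clock_less_tendsto_0 \<epsilon>])
      with J0[OF J j(1) \<epsilon>]
      have "eventually (\<lambda>n. measure M (avoiding r \<eta> J j n) \<le> sqrt (real (Suc J) / real (Suc j)) + \<epsilon> \<and>
        measure M {x\<in>space M. clock n x < r ^ j} < \<epsilon>) sequentially" by (rule eventually_conj)
      then obtain n where n: "measure M (avoiding r \<eta> J j n) \<le> sqrt (real (Suc J) / real (Suc j)) + \<epsilon>"
        "measure M {x\<in>space M. clock n x < r ^ j} < \<epsilon>" by (auto simp: eventually_sequentially)
      \<comment> \<open>If the clock has reached \<open>r ^ j\<close> by time \<open>n\<close>, all
        blocks before \<open>j\<close> are complete, and badness forces each of them to be low.
        Together the three errors stay below \<open>3 * \<epsilon>\<close>.\<close>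
      have "Bad J \<subseteq> avoiding r \<eta> J j n \<union> {x\<in>space M. clock n x < r ^ j}"
      proof
        fix x assume x: "x \<in> Bad J"
        show "x \<in> avoiding r \<eta> J j n \<union> {x\<in>space M. clock n x < r ^ j}"
        proof (cases "clock n x < r ^ j")
          case False
          have "r ^ Suc i \<le> clock n x" if "i < j" for i
          proof -
            have "r ^ Suc i \<le> r ^ j" using that r by (intro power_increasing) auto
            with False show ?thesis by linarith
          qed
          with x False show ?thesis by (auto simp: Bad_def avoiding_def simp del: power_Suc)
        qed (use x in \<open>auto simp: Bad_def\<close>)
      qed
      then have "measure M (Bad J) \<le> measure M (avoiding r \<eta> J j n \<union> {x\<in>space M. clock n x < r ^ j})"
        using avoiding_Filt[of r \<eta> J j n] subalg_Filt[of n] by (intro finite_measure_mono) (auto simp: subalgebra_def)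
      also have "\<dots> \<le> measure M (avoiding r \<eta> J j n) + measure M {x\<in>space M. clock n x < r ^ j}"
        using avoiding_Filt[of r \<eta> J j n] subalg_Filt[of n] by (intro measure_Un_le) (auto simp: subalgebra_def)
      finally show ?thesis using n j by linarith
    qed
    have "measure M (Bad J) \<le> 0"
    proof (rule field_le_epsilon)
      fix \<epsilon> :: real assume "0 < \<epsilon>"
      then show "measure M (Bad J) \<le> 0 + \<epsilon>" using bound[of "\<epsilon> / 3"] by simp
    qed
    then show ?thesis by (simp add: measure_le_0_iff)
  qed
  \<comment> \<open>Raising the start to at least \<open>J0\<close> only strengthens the claim to be
    proved for \<open>J\<close>.\<close>
  have "AE x in M. x \<notin> Bad (max J J0)" for J
    using Bad_null[of "max J J0"] by (intro AE_not_in) (auto simp: null_sets_def emeasure_eq_measure)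
  then have "AE x in M. \<forall>J. x \<notin> Bad (max J J0)" unfolding AE_all_countable by blast
  then show ?thesis
  proof (rule AE_mp, intro AE_I2 impI allI)
    fix x J assume x: "x \<in> space M" "\<forall>J. x \<notin> Bad (max J J0)"
    then obtain j n where "max J J0 \<le> j" "r ^ Suc j \<le> clock n x"
      "\<not> block_sum (r ^ j) (r ^ Suc j) n x < (1 - \<eta>) * level r j"
      unfolding Bad_def by blast
    then show "\<exists>j\<ge>J. \<exists>n. r ^ Suc j \<le> clock n x \<and> (1 - \<eta>) * level r j \<le> block_sum (r ^ j) (r ^ Suc j) n x"
      by (intro exI[of _ j] conjI exI[of _ n]) auto
  qed
qed

end

section \<open>From clock blocks back to ordinary time\<close>

context bounded_martingale_difference
begin

text \<open>Positivity of \<beta> makes the passage index positive, so the value one step earlier is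
  below \<beta> and the overshoot is a single square.\<close>

lemma first_passage:
  assumes "0 < \<beta>" "\<beta> \<le> clock n x"
  obtains m where "m \<le> n" "\<beta> \<le> clock m x" "clock m x \<le> \<beta> + c\<^sup>2" "\<And>k. clock k x < \<beta> \<longleftrightarrow> k < m"
proof -
  define m where "m = (LEAST m. \<beta> \<le> clock m x)"
  have m: "\<beta> \<le> clock m x" unfolding m_def using assms(2) by (rule LeastI)
  have mn: "m \<le> n" unfolding m_def using assms(2) by (rule Least_le)
  have lt: "clock k x < \<beta>" if "k < m" for k using not_less_Least[of k "\<lambda>m. \<beta> \<le> clock m x"] that by (simp add: m_def)
  have iff: "clock k x < \<beta> \<longleftrightarrow> k < m" for k
    using lt[of k] clock_mono[of m k x] m by (cases "k < m") auto
  have "0 < m" using m assms(1) by (cases m) auto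
  then have "clock m x \<le> clock (m - 1) x + c\<^sup>2" using clock_Suc_le[of "m - 1" x] by simp
  with lt[of "m - 1"] \<open>0 < m\<close> have "clock m x \<le> \<beta> + c\<^sup>2" by simp
  with m mn iff show thesis using that by blast
qed

text \<open>Because the clock is monotone, the times inside a block form an interval between two
  passage indices, and the block sum is the increment of the martingale over it.\<close>

lemma block_sum_eq_increment:
  assumes "0 < \<alpha>" "\<alpha> < \<beta>" "\<beta> \<le> clock n x"
  obtains m1 m2 where "\<alpha> \<le> clock m1 x" "clock m1 x \<le> \<alpha> + c\<^sup>2" "\<beta> \<le> clock m2 x" "clock m2 x \<le> \<beta> + c\<^sup>2"
    "block_sum \<alpha> \<beta> n x = B D m2 x - B D m1 x"
proof -
  obtain m2 where m2: "m2 \<le> n" "\<beta> \<le> clock m2 x" "clock m2 x \<le> \<beta> + c\<^sup>2" "\<And>k. clock k x < \<beta> \<longleftrightarrow> k < m2"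
    using first_passage[of \<beta> n x] assms by auto
  obtain m1 where m1: "m1 \<le> n" "\<alpha> \<le> clock m1 x" "clock m1 x \<le> \<alpha> + c\<^sup>2" "\<And>k. clock k x < \<alpha> \<longleftrightarrow> k < m1"
    using first_passage[of \<alpha> n x] assms by auto
  have "m1 \<le> m2"
  proof (rule ccontr)
    assume "\<not> m1 \<le> m2"
    then have "clock m2 x < \<alpha>" using m1(4) by simp
    with m2(2) assms(2) show False by simp
  qed
  have "block_sum \<alpha> \<beta> n x = (\<Sum>k\<in>{..<n}. if k \<in> {m1..<m2} then D ((\<theta> ^^ k) x) else 0)"
    unfolding block_sum_def block_def using m1(4) m2(4) by (intro sum.cong) (auto simp: not_less[symmetric])
  also have "\<dots> = (\<Sum>k\<in>{m1..<m2}. D ((\<theta> ^^ k) x))"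
    using m2(1) by (intro sum.mono_neutral_cong_right) auto
  also have "\<dots> = B D m2 x - B D m1 x"
    using sum_diff_nat_ivl[of 0 m1 m2 "\<lambda>k. D ((\<theta> ^^ k) x)"] \<open>m1 \<le> m2\<close>
    by (simp add: birkhoff_sum_def lessThan_atLeast0)
  finally show thesis using that m1 m2 by blast
qed

end

context nondegenerate_bounded_martingale_difference
begin

text \<open>At a passage time the clock gives \<open>\<sigma>\<^sup>2 * n\<close> close to
  \<open>r ^ j\<close>, so the normalisation at time \<open>n\<close> can be expressed in
  \<open>j\<close>. Of the three factors \<open>w\<close>, one pays for the ergodic limit of the
  clock, one for the overshoot and one for replacing \<open>ln (ln n)\<close> by
  \<open>ln j\<close>.\<close>

lemma lil_scale_at_passage:
  assumes lim: "(\<lambda>n. clock n x / real n) \<longlonglongrightarrow> (norm_L2 M D)\<^sup>2" and r: "1 < r" and w: "1 < w"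
  shows "eventually (\<lambda>j. \<forall>n. r ^ j \<le> clock n x \<and> clock n x \<le> r ^ j + c\<^sup>2 \<longrightarrow>
    norm_L2 M D * sqrt (2 * real n * ln (ln (real n))) \<le> sqrt (w ^ 3) * sqrt (2 * r ^ j * ln (real j))) sequentially"
proof -
  define \<sigma> where "\<sigma> = norm_L2 M D"
  have s0: "0 < \<sigma>" using nondegenerate by (simp add: \<sigma>_def)
  have "\<sigma>\<^sup>2 / w < \<sigma>\<^sup>2" using s0 w by (simp add: pos_divide_less_eq)
  then have "eventually (\<lambda>n. \<sigma>\<^sup>2 / w < clock n x / real n) sequentially"
    using order_tendstoD(1)[OF lim] by (simp add: \<sigma>_def)
  with eventually_ge_at_top[of 3] have "eventually (\<lambda>n. 3 \<le> n \<and> \<sigma>\<^sup>2 / w < clock n x / real n) sequentially"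
    by (rule eventually_conj)
  then obtain n0 where n0: "\<And>n. n0 \<le> n \<Longrightarrow> 3 \<le> n \<and> \<sigma>\<^sup>2 / w < clock n x / real n"
    by (auto simp: eventually_sequentially)
  \<comment> \<open>The absolute value bounds the constant in
    \<open>ln n \<le> ln (w\<^sup>2 / \<sigma>\<^sup>2) + j * ln r\<close>, and the 1 makes
    \<open>A\<close> positive; neither changes the limit of the ratio of logarithms.\<close>
  define A where "A = \<bar>ln (w\<^sup>2 / \<sigma>\<^sup>2)\<bar> + 1"
  have A0: "0 < A" by (simp add: A_def)
  have lnr: "0 < ln r" using r by simp
  have "(\<lambda>j. ln (A + real j * ln r) / ln (real j)) \<longlonglongrightarrow> 1" using A0 lnr by real_asymp
  then have ev1: "eventually (\<lambda>j. ln (A + real j * ln r) / ln (real j) < w) sequentially"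
    by (rule order_tendstoD) (rule w)
  have ev2: "eventually (\<lambda>j. K < r ^ j) sequentially" for K
  proof -
    have "filterlim (\<lambda>j. r ^ j) at_top sequentially" using r by real_asymp
    then show ?thesis by (simp add: filterlim_at_top_dense)
  qed
  show ?thesis using ev1 ev2[of "c\<^sup>2 * real n0"] ev2[of "c\<^sup>2 / (w - 1)"] eventually_ge_at_top[of 2]
  proof eventually_elim
    case (elim j)
    show ?case
    proof (intro allI impI, elim conjE)
      fix n assume n: "r ^ j \<le> clock n x" "clock n x \<le> r ^ j + c\<^sup>2"
      have "c\<^sup>2 * real n0 < c\<^sup>2 * real n" using n(1) clock_le[of n x] elim(2) by linarith
      then have "n0 \<le> n" using c_pos by simp
      with n0 have n3: "3 \<le> n" and cl: "\<sigma>\<^sup>2 / w < clock n x / real n" by auto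
      have rj: "0 < r ^ j" using r by simp
      have "\<sigma>\<^sup>2 * real n < w * clock n x" using cl n3 w by (simp add: field_simps)
      also have "\<dots> \<le> w * (r ^ j + c\<^sup>2)" using n(2) w by simp
      also have "\<dots> \<le> w * (w * r ^ j)"
      proof -
        have "c\<^sup>2 < r ^ j * (w - 1)" using elim(3) w by (simp add: pos_divide_less_eq)
        then have "r ^ j + c\<^sup>2 \<le> w * r ^ j" by (simp add: algebra_simps)
        then show ?thesis using w by (intro mult_left_mono) auto
      qed
      finally have sn: "\<sigma>\<^sup>2 * real n \<le> w\<^sup>2 * r ^ j" by (simp add: power2_eq_square)
      then have "real n \<le> w\<^sup>2 / \<sigma>\<^sup>2 * r ^ j" using s0 by (simp add: field_simps)
      then have "ln (real n) \<le> ln (w\<^sup>2 / \<sigma>\<^sup>2 * r ^ j)"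
        using n3 by (intro ln_mono) auto
      also have "\<dots> = ln (w\<^sup>2 / \<sigma>\<^sup>2) + real j * ln r"
        using s0 w rj r by (subst ln_mult) (auto simp: ln_realpow)
      also have "\<dots> \<le> A + real j * ln r" by (simp add: A_def)
      finally have ln_n: "ln (real n) \<le> A + real j * ln r" .
      have ln1: "1 < ln (real n)"
      proof -
        have "exp 1 < real n" using exp_le n3 e_less_272 by linarith
        then have "ln (exp 1) < ln (real n)" using n3 by (intro ln_less_cancel_iff[THEN iffD2]) auto
        then show ?thesis by simp
      qed
      have "ln (ln (real n)) \<le> ln (A + real j * ln r)" using ln_n ln1 by (intro ln_mono) auto
      also have "\<dots> \<le> w * ln (real j)"
        using elim(1,4) by (simp add: pos_divide_less_eq)
      finally have ll: "ln (ln (real n)) \<le> w * ln (real j)" .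
      have "(\<sigma>\<^sup>2 * real n) * ln (ln (real n)) \<le> (w\<^sup>2 * r ^ j) * (w * ln (real j))"
        by (rule mult_mono[OF sn ll]) (use ln1 rj w in auto)
      then have "\<sigma>\<^sup>2 * (2 * real n * ln (ln (real n))) \<le> w ^ 3 * (2 * r ^ j * ln (real j))"
        by (simp add: power2_eq_square power3_eq_cube mult_ac)
      then have "sqrt (\<sigma>\<^sup>2 * (2 * real n * ln (ln (real n)))) \<le> sqrt (w ^ 3 * (2 * r ^ j * ln (real j)))"
        by (rule real_sqrt_le_mono)
      then show "norm_L2 M D * sqrt (2 * real n * ln (ln (real n))) \<le> sqrt (w ^ 3) * sqrt (2 * r ^ j * ln (real j))"
        using s0 unfolding real_sqrt_mult[of "\<sigma>\<^sup>2"] real_sqrt_mult[of "w ^ 3"] by (simp add: \<sigma>_def)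
    qed
  qed
qed

text \<open>A large block forces a large sum at its end unless the sum at its start is very
  negative. The upper half bounds the latter by a multiple of a scale that is smaller by
  \<open>sqrt (1 / r)\<close>, which is negligible for large \<open>r\<close>.\<close>

theorem lil_lower_bounded:
  assumes \<kappa>: "\<kappa> < norm_L2 M D"
  shows "AE x in M. frequently (\<lambda>n. \<kappa> * sqrt (2 * real n * ln (ln (real n))) \<le> B D n x) sequentially"
proof -
  define \<sigma> where "\<sigma> = norm_L2 M D"
  have s0: "0 < \<sigma>" using nondegenerate by (simp add: \<sigma>_def)
  \<comment> \<open>A nonnegative constant is needed to multiply the scale estimate for the end of
    the block.\<close>
  define k where "k = max \<kappa> 0"
  have k: "0 \<le> k" "k < \<sigma>" using \<kappa> s0 by (auto simp: k_def \<sigma>_def)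
  \<comment> \<open>One integer drives all the parameters: \<open>r = N\<^sup>2\<close>,
    \<open>w = 1 + 1 / N\<close>, \<open>\<eta> = 1 / N\<close>. In the limit the required
    inequality reads \<open>k < \<sigma>\<close>.\<close>
  obtain N :: nat where N: "2 \<le> N" and
    gap: "k * sqrt ((1 + 1 / real N) ^ 3) + 2 * \<sigma> * sqrt ((1 + 1 / real N) ^ 3) * sqrt (1 / (real N)\<^sup>2)
      < \<sigma> * ((1 - 1 / real N) * sqrt (1 - 1 / (real N)\<^sup>2))"
  proof -
    have "(\<lambda>N. \<sigma> * ((1 - 1 / real N) * sqrt (1 - 1 / (real N)\<^sup>2)) -
      (k * sqrt ((1 + 1 / real N) ^ 3) + 2 * \<sigma> * sqrt ((1 + 1 / real N) ^ 3) * sqrt (1 / (real N)\<^sup>2)))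
      \<longlonglongrightarrow> \<sigma> * ((1 - 0) * sqrt (1 - 0)) - (k * sqrt ((1 + 0) ^ 3) + 2 * \<sigma> * sqrt ((1 + 0) ^ 3) * sqrt 0)"
    proof -
      have "(\<lambda>N. 1 / real N) \<longlonglongrightarrow> 0" "(\<lambda>N. 1 / (real N)\<^sup>2) \<longlonglongrightarrow> 0" by real_asymp+
      then show ?thesis
        by (intro tendsto_diff tendsto_add tendsto_mult tendsto_const tendsto_real_sqrt tendsto_power)
    qed
    then have "eventually (\<lambda>N. 0 < \<sigma> * ((1 - 1 / real N) * sqrt (1 - 1 / (real N)\<^sup>2)) -
      (k * sqrt ((1 + 1 / real N) ^ 3) + 2 * \<sigma> * sqrt ((1 + 1 / real N) ^ 3) * sqrt (1 / (real N)\<^sup>2))) sequentially"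
      by (rule order_tendstoD(1)) (use k in simp)
    with eventually_ge_at_top[of 2] have "eventually (\<lambda>N. 2 \<le> N \<and> 0 < \<sigma> * ((1 - 1 / real N) * sqrt (1 - 1 / (real N)\<^sup>2)) -
      (k * sqrt ((1 + 1 / real N) ^ 3) + 2 * \<sigma> * sqrt ((1 + 1 / real N) ^ 3) * sqrt (1 / (real N)\<^sup>2))) sequentially"
      by (rule eventually_conj)
    then show thesis using that by (auto simp: eventually_sequentially)
  qed
  define r where "r = (real N)\<^sup>2"
  define w where "w = 1 + 1 / real N"
  define \<eta> where "\<eta> = 1 / real N"
  have r1: "1 < r" unfolding r_def using N by (simp add: one_less_power)
  have w1: "1 < w" unfolding w_def using N by simp
  have eta: "0 < \<eta>" "\<eta> < 1" unfolding \<eta>_def using N by auto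
  have gap': "k * sqrt (w ^ 3) + 2 * \<sigma> * sqrt (w ^ 3) * sqrt (1 / r) < \<sigma> * ((1 - \<eta>) * sqrt (1 - 1 / r))"
    using gap unfolding r_def w_def \<eta>_def .
  have "AE x in M. eventually (\<lambda>n. \<bar>B D n x\<bar> \<le> (2 * \<sigma>) * sqrt (2 * real n * ln (ln (real n)))) sequentially"
    using s0 by (intro martingale_lil_upper_abs D) (simp add: \<sigma>_def)
  with AE_clock_limit blocks_infinitely_often[OF r1 eta]
  show ?thesis
  proof eventually_elim
    case (elim x)
    let ?\<phi> = "\<lambda>n. sqrt (2 * real n * ln (ln (real n)))"
    show ?case
    proof (rule ccontr)
      assume "\<not> frequently (\<lambda>n. \<kappa> * ?\<phi> n \<le> B D n x) sequentially"
      then have "eventually (\<lambda>n. B D n x < \<kappa> * ?\<phi> n) sequentially"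
        by (simp add: not_frequently not_le)
      moreover have "eventually (\<lambda>n. 0 \<le> ?\<phi> n) sequentially"
        using ln_ln_at_top by (auto simp: filterlim_at_top elim!: allE[of _ 0] eventually_mono)
      ultimately have "eventually (\<lambda>n. B D n x \<le> k * ?\<phi> n) sequentially"
      proof eventually_elim
        case (elim n)
        have "\<kappa> * ?\<phi> n \<le> k * ?\<phi> n" using elim(2) by (intro mult_right_mono) (auto simp: k_def)
        with elim(1) show ?case by linarith
      qed
      with elim(3) have "eventually (\<lambda>n. \<bar>B D n x\<bar> \<le> (2 * \<sigma>) * ?\<phi> n \<and> B D n x \<le> k * ?\<phi> n) sequentially"
        by (rule eventually_conj)
      then obtain n0 where n0: "\<And>n. n0 \<le> n \<Longrightarrow> \<bar>B D n x\<bar> \<le> (2 * \<sigma>) * ?\<phi> n \<and> B D n x \<le> k * ?\<phi> n"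
        by (auto simp: eventually_sequentially)
      have "filterlim (\<lambda>j. r ^ j) at_top sequentially" using r1 by real_asymp
      then have "eventually (\<lambda>j. c\<^sup>2 * real n0 < r ^ j) sequentially" by (simp add: filterlim_at_top_dense)
      with lil_scale_at_passage[OF elim(1) r1 w1]
      have "eventually (\<lambda>j. (\<forall>n. r ^ j \<le> clock n x \<and> clock n x \<le> r ^ j + c\<^sup>2 \<longrightarrow>
        \<sigma> * ?\<phi> n \<le> sqrt (w ^ 3) * sqrt (2 * r ^ j * ln (real j))) \<and> c\<^sup>2 * real n0 < r ^ j) sequentially"
        unfolding \<sigma>_def by (rule eventually_conj)
      then obtain J where J: "\<And>j. J \<le> j \<Longrightarrow> (\<forall>n. r ^ j \<le> clock n x \<and> clock n x \<le> r ^ j + c\<^sup>2 \<longrightarrow>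
        \<sigma> * ?\<phi> n \<le> sqrt (w ^ 3) * sqrt (2 * r ^ j * ln (real j))) \<and> c\<^sup>2 * real n0 < r ^ j"
        by (auto simp: eventually_sequentially)
      obtain j n where j: "max J 1 \<le> j" and n: "r ^ Suc j \<le> clock n x"
        "(1 - \<eta>) * level r j \<le> block_sum (r ^ j) (r ^ Suc j) n x"
        using elim(2) by blast
      have rj: "0 < r ^ j" "r ^ j < r ^ Suc j" using r1 by auto
      obtain m1 m2 where m: "r ^ j \<le> clock m1 x" "clock m1 x \<le> r ^ j + c\<^sup>2"
        "r ^ Suc j \<le> clock m2 x" "clock m2 x \<le> r ^ Suc j + c\<^sup>2"
        "block_sum (r ^ j) (r ^ Suc j) n x = B D m2 x - B D m1 x"
        using block_sum_eq_increment[OF rj n(1)] by blast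
      define Q where "Q = sqrt (2 * r ^ Suc j * ln (real (Suc j)))"
      have lnj: "0 < ln (real (Suc j))" using j by simp
      have Q0: "0 < Q" unfolding Q_def using lnj r1 by simp
      have large: "n0 \<le> i" if "r ^ j \<le> clock i x" for i
      proof -
        have "c\<^sup>2 * real n0 < c\<^sup>2 * real i" using J[of j] j clock_le[of i x] that by simp
        then show ?thesis using c_pos by simp
      qed
      have "n0 \<le> m1" "n0 \<le> m2"
        using large[OF m(1)] large[OF order_trans[OF less_imp_le[OF rj(2)] m(3)]] by auto
      then have b: "\<bar>B D m1 x\<bar> \<le> (2 * \<sigma>) * ?\<phi> m1" "B D m2 x \<le> k * ?\<phi> m2" using n0 by auto
      have s1: "\<sigma> * ?\<phi> m1 \<le> sqrt (w ^ 3) * sqrt (2 * r ^ j * ln (real j))"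
        using J[of j] j m by auto
      have s2: "\<sigma> * ?\<phi> m2 \<le> sqrt (w ^ 3) * Q"
        using J[of "Suc j"] j m unfolding Q_def by (auto simp del: power_Suc)
      have Qr: "sqrt (2 * r ^ j * ln (real j)) \<le> sqrt (1 / r) * Q"
      proof -
        have "2 * r ^ j * ln (real j) \<le> 2 * r ^ j * ln (real (Suc j))"
          using j rj by (intro mult_left_mono ln_mono) auto
        also have "\<dots> = 1 / r * (2 * r ^ Suc j * ln (real (Suc j)))" using r1 by simp
        finally show ?thesis unfolding Q_def real_sqrt_mult[symmetric] by (rule real_sqrt_le_mono)
      qed
      have level: "level r j = sqrt (1 - 1 / r) * Q"
      proof -
        have "2 * block_length r j * ln (real (Suc j)) = (1 - 1 / r) * (2 * r ^ Suc j * ln (real (Suc j)))"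
          using r1 by (simp add: block_length_def algebra_simps)
        then show ?thesis unfolding Q_def level_def real_sqrt_mult[symmetric] by simp
      qed
      have "\<sigma> * ((1 - \<eta>) * level r j) \<le> \<sigma> * (B D m2 x - B D m1 x)"
        using n(2) m(5) s0 by (intro mult_left_mono) auto
      also have "\<dots> \<le> \<sigma> * (k * ?\<phi> m2 + 2 * \<sigma> * ?\<phi> m1)"
        using b s0 by (intro mult_left_mono) auto
      also have "\<dots> = k * (\<sigma> * ?\<phi> m2) + 2 * \<sigma> * (\<sigma> * ?\<phi> m1)" by (simp add: algebra_simps)
      also have "\<dots> \<le> k * (sqrt (w ^ 3) * Q) + 2 * \<sigma> * (sqrt (w ^ 3) * (sqrt (1 / r) * Q))"
      proof (intro add_mono mult_left_mono s2)
        show "\<sigma> * ?\<phi> m1 \<le> sqrt (w ^ 3) * (sqrt (1 / r) * Q)"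
          by (rule order_trans[OF s1 mult_left_mono[OF Qr]]) (use w1 in simp)
      qed (use k s0 in auto)
      also have "\<dots> = (k * sqrt (w ^ 3) + 2 * \<sigma> * sqrt (w ^ 3) * sqrt (1 / r)) * Q"
        by (simp add: algebra_simps)
      also have "\<dots> < \<sigma> * ((1 - \<eta>) * sqrt (1 - 1 / r)) * Q"
        using gap' Q0 by (rule mult_strict_right_mono)
      also have "\<dots> = \<sigma> * ((1 - \<eta>) * level r j)" by (simp add: level mult_ac)
      finally show False by simp
    qed
  qed
qed

end

section \<open>Truncation and the lower half for general differences\<close>

context filtered_system
begin

lemma C_measurable [measurable]: "C f \<in> borel_measurable M"
  by (rule measurable_G_M) measurable

lemma square_integrable_C:
  assumes "square_integrable M f"
  shows "square_integrable M (C f)" and norm_L2_C_le: "norm_L2 M (C f) \<le> norm_L2 M f"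
proof -
  have f: "integrable M f" "integrable M (\<lambda>x. (f x)\<^sup>2)"
    using assms by (auto intro: square_integrable_integrable square_integrable_integrable_square)
  have conv: "convex_on UNIV (\<lambda>x::real. x\<^sup>2)" by (rule convex_power2)
  have int: "integrable M (\<lambda>x. (C f x)\<^sup>2)"
    by (rule G.integrable_convex_cond_exp[where I=UNIV, OF f(1) _ _ f(2) conv]) auto
  then show "square_integrable M (C f)" by (simp add: square_integrable_def)
  have "AE x in M. (C f x)\<^sup>2 \<le> C (\<lambda>x. (f x)\<^sup>2) x"
    by (rule G.real_cond_exp_jensens_inequality(2)[where I=UNIV, OF f(1) _ _ f(2) conv]) auto
  then have "(\<integral>x. (C f x)\<^sup>2 \<partial>M) \<le> (\<integral>x. C (\<lambda>x. (f x)\<^sup>2) x \<partial>M)"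
    using int G.real_cond_exp_int(1)[OF f(2)] by (intro integral_mono_AE)
  also have "\<dots> = (\<integral>x. (f x)\<^sup>2 \<partial>M)" by (rule G.real_cond_exp_int(2)[OF f(2)])
  finally show "norm_L2 M (C f) \<le> norm_L2 M f" unfolding norm_L2_def by (rule real_sqrt_le_mono)
qed

lemma martingale_difference_diff:
  assumes "martingale_difference D" "martingale_difference E"
  shows "martingale_difference (\<lambda>x. D x - E x)"
proof -
  have "AE x in M. C (\<lambda>x. D x - E x) x = C D x - C E x"
    using assms by (intro G.real_cond_exp_diff) (auto simp: martingale_difference_def intro: square_integrable_integrable)
  then show ?thesis using assms
    by (auto simp: martingale_difference_def square_integrable_diff)
qed

text \<open>Truncation destroys the centring, so the conditional mean of the truncated function is
  subtracted. As \<open>C D\<close> vanishes, that mean is minus the conditional mean of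
  \<open>D - T n\<close>, and recentring costs no more than truncating did.\<close>

lemma bounded_approximation:
  assumes D: "martingale_difference D" and t: "0 < t"
  obtains E c where "martingale_difference E" "\<And>x. \<bar>E x\<bar> \<le> c" "norm_L2 M (\<lambda>x. D x - E x) < t"
proof -
  have DF: "D \<in> borel_measurable (Filt 1)" and sqD: "square_integrable M D"
    using D by (auto simp: martingale_difference_def)
  note [measurable] = square_integrableD[OF sqD]
  define T where "T n x = (if \<bar>D x\<bar> \<le> real n then D x else 0)" for n x
  have T_F: "T n \<in> borel_measurable (Filt 1)" for n
    unfolding T_def[abs_def] using DF by measurable
  note [measurable] = measurable_Filt_M[OF T_F]
  have sqT: "square_integrable M (T n)" for n
    by (rule square_integrable_bound[OF sqD]) (auto simp: T_def)
  have "(\<lambda>n. \<integral>x. (D x - T n x)\<^sup>2 \<partial>M) \<longlonglongrightarrow> (\<integral>x. 0 \<partial>M)"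
  proof (rule integral_dominated_convergence[where w="\<lambda>x. (D x)\<^sup>2"])
    show "AE x in M. (\<lambda>n. (D x - T n x)\<^sup>2) \<longlonglongrightarrow> 0"
    proof (intro AE_I2 tendsto_eventually)
      fix x
      obtain k :: nat where "\<bar>D x\<bar> \<le> real k" using real_arch_simple by blast
      then have "(D x - T n x)\<^sup>2 = 0" if "k \<le> n" for n using that by (auto simp: T_def)
      then show "eventually (\<lambda>n. (D x - T n x)\<^sup>2 = 0) sequentially" unfolding eventually_sequentially by blast
    qed
  qed (use square_integrable_integrable_square[OF sqD] in \<open>auto simp: T_def\<close>)
  then have "(\<lambda>n. norm_L2 M (\<lambda>x. D x - T n x)) \<longlonglongrightarrow> sqrt 0"
    unfolding norm_L2_def by (intro tendsto_real_sqrt) simp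
  then have "eventually (\<lambda>n. norm_L2 M (\<lambda>x. D x - T n x) < t / 2) sequentially"
    by (rule order_tendstoD) (use t in simp)
  then obtain n where n: "norm_L2 M (\<lambda>x. D x - T n x) < t / 2" by (auto simp: eventually_sequentially)
  \<comment> \<open>A version of \<open>C (T n)\<close> clipped to the range of \<open>T n\<close>:
    the resulting bound holds at every point, as the locale of bounded differences requires.\<close>
  define P where "P x = max (- real n) (min (real n) (C (T n) x))" for x
  have PG: "P \<in> borel_measurable G" unfolding P_def[abs_def] by measurable
  have PF: "P \<in> borel_measurable (Filt 1)"
    using PG by (intro measurable_Filt_mono[OF measurable_G_Filt_0]) auto
  note [measurable] = measurable_G_M[OF PG]
  have intT: "integrable M (T n)" by (rule square_integrable_integrable[OF sqT])
  have P_AE: "AE x in M. P x = C (T n) x"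
  proof -
    have "AE x in M. - real n \<le> T n x" "AE x in M. T n x \<le> real n"
      by (auto intro!: AE_I2 simp: T_def)
    with G.real_cond_exp_ge_c[OF intT] G.real_cond_exp_le_c[OF intT]
    have "AE x in M. - real n \<le> C (T n) x" "AE x in M. C (T n) x \<le> real n" by blast+
    then show ?thesis by eventually_elim (simp add: P_def)
  qed
  have sqP: "square_integrable M P"
    by (rule square_integrable_cong_AE[OF square_integrable_C(1)[OF sqT] _ P_AE]) measurable
  define E where "E x = T n x - P x" for x
  have "AE x in M. C E x = C (T n) x - C P x"
    unfolding E_def[abs_def] using sqP by (intro G.real_cond_exp_diff intT square_integrable_integrable)
  moreover have "AE x in M. C P x = P x"
    using sqP PG by (intro G.real_cond_exp_F_meas square_integrable_integrable)
  ultimately have "AE x in M. C E x = 0" using P_AE by eventually_elim simp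
  then have mdE: "martingale_difference E"
    using T_F[of n] PF sqT sqP by (auto simp: martingale_difference_def E_def[abs_def] intro!: square_integrable_diff)
  have E_bd: "\<bar>E x\<bar> \<le> 2 * real n" for x
  proof -
    have "\<bar>T n x\<bar> \<le> real n" "\<bar>P x\<bar> \<le> real n" by (auto simp: T_def P_def)
    then show ?thesis unfolding E_def by linarith
  qed
  have sqDT: "square_integrable M (\<lambda>x. D x - T n x)" by (intro square_integrable_diff sqD sqT)
  have "norm_L2 M P \<le> norm_L2 M (\<lambda>x. D x - T n x)"
  proof -
    have "AE x in M. C (\<lambda>x. D x - T n x) x = C D x - C (T n) x"
      using sqD by (intro G.real_cond_exp_diff intT square_integrable_integrable)
    moreover have "AE x in M. C D x = 0" using D by (simp add: martingale_difference_def)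
    ultimately have "AE x in M. P x = - C (\<lambda>x. D x - T n x) x" using P_AE by eventually_elim simp
    then have "norm_L2 M P = norm_L2 M (\<lambda>x. - C (\<lambda>x. D x - T n x) x)" by (rule norm_L2_cong_AE) measurable
    then show ?thesis using norm_L2_C_le[OF sqDT] by (simp add: norm_L2_uminus)
  qed
  moreover have "norm_L2 M (\<lambda>x. (D x - T n x) + P x) \<le> norm_L2 M (\<lambda>x. D x - T n x) + norm_L2 M P"
    by (rule norm_L2_triangle[OF sqDT sqP])
  moreover have "(\<lambda>x. (D x - T n x) + P x) = (\<lambda>x. D x - E x)" by (auto simp: E_def)
  ultimately have "norm_L2 M (\<lambda>x. D x - E x) < t" using n by simp
  with mdE E_bd show thesis using that by blast
qed

theorem martingale_lil_lower:
  assumes D: "martingale_difference D" and \<kappa>: "\<kappa> < norm_L2 M D"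
  shows "AE x in M. frequently (\<lambda>n. \<kappa> * sqrt (2 * real n * ln (ln (real n))) \<le> B D n x) sequentially"
proof (cases "0 < norm_L2 M D")
  case True
  \<comment> \<open>One \<open>t\<close> is lost in the norm of \<open>E\<close>, another in the
    fluctuations of \<open>D - E\<close>, and the third leaves room for a strict inequality;
    \<open>t \<le> norm_L2 M D\<close> keeps \<open>E\<close> nondegenerate.\<close>
  define t where "t = min (norm_L2 M D) ((norm_L2 M D - \<kappa>) / 3)"
  have "t \<le> (norm_L2 M D - \<kappa>) / 3" unfolding t_def by (rule min.cobounded2)
  then have "3 * t \<le> norm_L2 M D - \<kappa>" by (simp add: pos_le_divide_eq mult.commute)
  moreover have "0 < t" "t \<le> norm_L2 M D" using True \<kappa> by (auto simp: t_def)
  ultimately have t: "0 < t" "t \<le> norm_L2 M D" "3 * t \<le> norm_L2 M D - \<kappa>" by blast+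
  obtain E c where E: "martingale_difference E" "\<And>x. \<bar>E x\<bar> \<le> c" "norm_L2 M (\<lambda>x. D x - E x) < t"
    using bounded_approximation[OF D t(1)] by blast
  have sq: "square_integrable M D" "square_integrable M E"
    using D E by (auto simp: martingale_difference_def)
  have "norm_L2 M (\<lambda>x. (D x - E x) + E x) \<le> norm_L2 M (\<lambda>x. D x - E x) + norm_L2 M E"
    using sq by (intro norm_L2_triangle square_integrable_diff)
  then have nE: "norm_L2 M D - t < norm_L2 M E" using E(3) by simp
  interpret E: nondegenerate_bounded_martingale_difference M \<theta> G E c
    by unfold_locales (use E nE t in auto)
  have "AE x in M. frequently (\<lambda>n. (\<kappa> + t) * sqrt (2 * real n * ln (ln (real n))) \<le> B E n x) sequentially"
    using nE t by (intro E.lil_lower_bounded) linarith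
  moreover have "AE x in M. eventually (\<lambda>n. \<bar>B (\<lambda>x. D x - E x) n x\<bar> \<le> t * sqrt (2 * real n * ln (ln (real n)))) sequentially"
    by (rule martingale_lil_upper_abs[OF martingale_difference_diff[OF D E(1)] E(3)])
  ultimately show ?thesis
  proof eventually_elim
    case (elim x)
    show ?case
    proof (rule frequently_rev_mp[OF elim(1)], rule eventually_mono[OF elim(2)], intro impI)
      fix n
      assume "\<bar>B (\<lambda>x. D x - E x) n x\<bar> \<le> t * sqrt (2 * real n * ln (ln (real n)))"
        "(\<kappa> + t) * sqrt (2 * real n * ln (ln (real n))) \<le> B E n x"
      then show "\<kappa> * sqrt (2 * real n * ln (ln (real n))) \<le> B D n x"
        by (simp add: birkhoff_sum_diff distrib_right)
    qed
  qed
next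
  case False
  \<comment> \<open>Here the norm is 0 and \<kappa> is negative, so the upper half for
    \<open>- D\<close> already gives the bound for all large \<open>n\<close>.\<close>
  then have n0: "norm_L2 M (\<lambda>x. - D x) < - \<kappa>" using \<kappa> norm_L2_nonneg[of M D] by (simp add: norm_L2_uminus)
  show ?thesis using martingale_lil_upper[OF martingale_difference_uminus[OF D] n0]
  proof eventually_elim
    case (elim x)
    then show ?case
      by (intro eventually_frequently) (auto simp: birkhoff_sum_uminus elim!: eventually_mono)
  qed
qed

end

section \<open>Martingale approximation\<close>

text \<open>The sum of the L2 norms dominates that of the L1 norms, so the series converges
  absolutely almost everywhere; Fatou's lemma carries the triangle inequality over to the tails.
  Taking \<open>s = 0\<close> yields square integrability of the sum.\<close>

lemma (in prob_space) square_integrable_series: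
  fixes f :: "nat \<Rightarrow> 'a \<Rightarrow> real"
  assumes f: "\<And>r. square_integrable M (f r)" and sum: "summable (\<lambda>r. norm_L2 M (f r))"
  shows "square_integrable M (\<lambda>x. \<Sum>r. f r x)"
    and "norm_L2 M (\<lambda>x. (\<Sum>r. f r x) - (\<Sum>r<s. f r x)) \<le> (\<Sum>r. norm_L2 M (f (r + s)))"
proof -
  note [measurable] = square_integrableD[OF f]
  define D where "D x = (\<Sum>r. f r x)" for x
  have [measurable]: "D \<in> borel_measurable M" unfolding D_def[abs_def] by measurable
  have "(\<integral>\<^sup>+x. (\<Sum>r. ennreal \<bar>f r x\<bar>) \<partial>M) = (\<Sum>r. \<integral>\<^sup>+x. ennreal \<bar>f r x\<bar> \<partial>M)"
    by (rule nn_integral_suminf) measurable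
  also have "\<dots> \<le> (\<Sum>r. ennreal (norm_L2 M (f r)))"
  proof (intro suminf_le)
    fix r
    have "(\<integral>\<^sup>+x. ennreal \<bar>f r x\<bar> \<partial>M) = ennreal (\<integral>x. \<bar>f r x\<bar> \<partial>M)"
      using square_integrable_integrable[OF f] by (intro nn_integral_eq_integral) auto
    also have "\<dots> \<le> ennreal (norm_L2 M (f r))" by (intro ennreal_leI integral_abs_le_norm_L2 f)
    finally show "(\<integral>\<^sup>+x. ennreal \<bar>f r x\<bar> \<partial>M) \<le> ennreal (norm_L2 M (f r))" .
  qed auto
  also have "\<dots> = ennreal (\<Sum>r. norm_L2 M (f r))" by (rule suminf_ennreal2[OF _ sum]) simp
  also have "\<dots> < \<infinity>" by simp
  finally have "AE x in M. (\<Sum>r. ennreal \<bar>f r x\<bar>) \<noteq> \<infinity>" by (intro nn_integral_PInf_AE) auto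
  then have conv: "AE x in M. (\<lambda>n. \<Sum>r<n. f r x) \<longlonglongrightarrow> D x"
  proof eventually_elim
    case (elim x)
    have "summable (\<lambda>r. \<bar>f r x\<bar>)"
      by (rule summable_suminf_not_top) (use elim in \<open>simp_all only: infinity_ennreal_def abs_ge_zero not_False_eq_True\<close>)
    then show ?case unfolding D_def by (rule summable_LIMSEQ[OF summable_rabs_cancel])
  qed
  have main: "square_integrable M (\<lambda>x. D x - (\<Sum>r<s. f r x)) \<and>
    norm_L2 M (\<lambda>x. D x - (\<Sum>r<s. f r x)) \<le> (\<Sum>r. norm_L2 M (f (r + s)))" for s
  proof -
    define K where "K = (\<Sum>r. norm_L2 M (f (r + s)))"
    have sums: "summable (\<lambda>r. norm_L2 M (f (r + s)))" using summable_ignore_initial_segment[OF sum] .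
    have K0: "0 \<le> K" unfolding K_def by (intro suminf_nonneg sums) simp
    define h where "h n x = (\<Sum>r<n. f (r + s) x)" for n x
    have sqh: "square_integrable M (h n)" for n
      unfolding h_def[abs_def] by (intro square_integrable_sum f)
    note [measurable] = square_integrableD[OF sqh]
    have h_le: "(\<integral>\<^sup>+x. ennreal ((h n x)\<^sup>2) \<partial>M) \<le> ennreal (K\<^sup>2)" for n
    proof -
      have "norm_L2 M (h n) \<le> (\<Sum>r<n. norm_L2 M (f (r + s)))"
        unfolding h_def[abs_def] by (intro norm_L2_sum f) auto
      also have "\<dots> \<le> K" unfolding K_def by (intro sum_le_suminf sums) auto
      finally have "(norm_L2 M (h n))\<^sup>2 \<le> K\<^sup>2" by (intro power_mono) auto
      moreover have "(\<integral>\<^sup>+x. ennreal ((h n x)\<^sup>2) \<partial>M) = ennreal ((norm_L2 M (h n))\<^sup>2)"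
        unfolding norm_L2_power2 using square_integrable_integrable_square[OF sqh]
        by (intro nn_integral_eq_integral) auto
      ultimately show ?thesis by (simp add: ennreal_leI)
    qed
    have lim: "AE x in M. (\<lambda>n. h n x) \<longlonglongrightarrow> D x - (\<Sum>r<s. f r x)"
      using conv
    proof eventually_elim
      case (elim x)
      have "(\<Sum>r<n + s. f r x) - (\<Sum>r<s. f r x) = h n x" for n
      proof -
        have "(\<Sum>r<n + s. f r x) = (\<Sum>r<s. f r x) + (\<Sum>r<n. f (r + s) x)"
          by (induction n) (auto simp: algebra_simps)
        then show ?thesis by (simp add: h_def)
      qed
      moreover have "(\<lambda>n. (\<Sum>r<n + s. f r x) - (\<Sum>r<s. f r x)) \<longlonglongrightarrow> D x - (\<Sum>r<s. f r x)"
        using LIMSEQ_ignore_initial_segment[OF elim, of s] by (intro tendsto_diff tendsto_const)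
      ultimately show ?case by simp
    qed
    have "(\<integral>\<^sup>+x. ennreal ((D x - (\<Sum>r<s. f r x))\<^sup>2) \<partial>M) = (\<integral>\<^sup>+x. liminf (\<lambda>n. ennreal ((h n x)\<^sup>2)) \<partial>M)"
    proof (rule nn_integral_cong_AE)
      show "AE x in M. ennreal ((D x - (\<Sum>r<s. f r x))\<^sup>2) = liminf (\<lambda>n. ennreal ((h n x)\<^sup>2))"
        using lim
      proof eventually_elim
        case (elim x)
        have "(\<lambda>n. ennreal ((h n x)\<^sup>2)) \<longlonglongrightarrow> ennreal ((D x - (\<Sum>r<s. f r x))\<^sup>2)"
          by (intro tendsto_ennrealI tendsto_power elim)
        then show ?case by (intro lim_imp_Liminf[symmetric]) auto
      qed
    qed
    also have "\<dots> \<le> liminf (\<lambda>n. \<integral>\<^sup>+x. ennreal ((h n x)\<^sup>2) \<partial>M)"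
      by (rule nn_integral_liminf) measurable
    also have "\<dots> \<le> ennreal (K\<^sup>2)"
      by (rule Liminf_le) (auto intro: always_eventually h_le)
    finally have le: "(\<integral>\<^sup>+x. ennreal ((D x - (\<Sum>r<s. f r x))\<^sup>2) \<partial>M) \<le> ennreal (K\<^sup>2)" .
    have int: "integrable M (\<lambda>x. (D x - (\<Sum>r<s. f r x))\<^sup>2)"
    proof (rule integrableI_bounded)
      show "(\<integral>\<^sup>+x. ennreal (norm ((D x - (\<Sum>r<s. f r x))\<^sup>2)) \<partial>M) < \<infinity>"
        using le by (simp add: le_less_trans[OF _ ennreal_less_top])
    qed measurable
    have "ennreal (\<integral>x. (D x - (\<Sum>r<s. f r x))\<^sup>2 \<partial>M) \<le> ennreal (K\<^sup>2)"
      using le int by (subst nn_integral_eq_integral[symmetric]) auto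
    then have "(norm_L2 M (\<lambda>x. D x - (\<Sum>r<s. f r x)))\<^sup>2 \<le> K\<^sup>2"
      by (simp add: norm_L2_power2 ennreal_le_iff)
    then have "norm_L2 M (\<lambda>x. D x - (\<Sum>r<s. f r x)) \<le> K" using K0 by (rule power2_le_imp_le)
    with int show ?thesis by (simp add: square_integrable_def K_def)
  qed
  from main[of 0] show "square_integrable M (\<lambda>x. \<Sum>r. f r x)" by (simp add: D_def)
  from main[of s] show "norm_L2 M (\<lambda>x. (\<Sum>r. f r x) - (\<Sum>r<s. f r x)) \<le> (\<Sum>r. norm_L2 M (f (r + s)))"
    by (simp add: D_def)
qed

text \<open>Interchanging the two sums counts each \<open>a q\<close> once for every
  \<open>s \<le> q\<close>, that is \<open>q + 1\<close> times. The logarithmic factor of the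
  hypothesis is spent here.\<close>

lemma summable_tails:
  fixes a :: "nat \<Rightarrow> real"
  assumes a: "\<And>q. 0 \<le> a q" and sum: "summable (\<lambda>q. real (Suc q) * a q)"
  shows "summable a" "summable (\<lambda>s. \<Sum>q. a (q + s))"
proof -
  show sa: "summable a"
  proof (rule summable_comparison_test'[OF sum])
    fix q :: nat
    have "1 * a q \<le> real (Suc q) * a q" using a by (intro mult_right_mono) auto
    then show "norm (a q) \<le> real (Suc q) * a q" using a[of q] by simp
  qed
  have tail: "(\<Sum>q. a (q + s)) = (\<Sum>q. if s \<le> q then a q else 0)"
    and tail_sum: "summable (\<lambda>q. if s \<le> q then a q else 0)" for s
  proof -
    show "summable (\<lambda>q. if s \<le> q then a q else 0)"
      by (rule summable_comparison_test'[OF sa]) (use a in auto)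
    from suminf_split_initial_segment[OF this, of s]
    show "(\<Sum>q. a (q + s)) = (\<Sum>q. if s \<le> q then a q else 0)" by simp
  qed
  have "(\<Sum>s<n. \<Sum>q. a (q + s)) \<le> (\<Sum>q. real (Suc q) * a q)" for n
  proof -
    have "(\<Sum>s<n. \<Sum>q. a (q + s)) = (\<Sum>q. \<Sum>s<n. if s \<le> q then a q else 0)"
      unfolding tail using tail_sum by (intro suminf_sum[symmetric])
    also have "\<dots> \<le> (\<Sum>q. real (Suc q) * a q)"
    proof (rule suminf_le)
      fix q
      have "(\<Sum>s<n. if s \<le> q then a q else 0) \<le> (\<Sum>s<max n (Suc q). if s \<le> q then a q else 0)"
        using a by (intro sum_mono2) auto
      also have "\<dots> = (\<Sum>s<Suc q. a q)"
        by (intro sum.mono_neutral_cong_right) auto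
      finally show "(\<Sum>s<n. if s \<le> q then a q else 0) \<le> real (Suc q) * a q" by simp
    qed (rule summable_sum tail_sum sum)+
    finally show ?thesis .
  qed
  then show "summable (\<lambda>s. \<Sum>q. a (q + s))"
  proof (intro summableI_nonneg_bounded)
    fix s show "0 \<le> (\<Sum>q. a (q + s))" unfolding tail using a by (intro suminf_nonneg tail_sum) auto
  qed
qed

section \<open>Innovations of conditional expectations\<close>

context filtered_system
begin

text \<open>The tower property: \<open>C f\<close> after one step is the conditional expectation of
  the shifted \<open>f\<close> given \<open>Filt 1\<close>, and \<open>G\<close> is the smaller
  \<sigma>-algebra. Concretely, a set of \<open>G\<close> is a preimage of another one, over which
  \<open>f\<close> and \<open>C f\<close> have equal integrals.\<close>

lemma C_shift:
  assumes f: "integrable M f"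
  shows "AE x in M. C (\<lambda>x. f (\<theta> x)) x = C (\<lambda>x. C f (\<theta> x)) x"
proof (rule G.real_cond_exp_charact)
  have [measurable]: "f \<in> borel_measurable M" using f by auto
  have intC: "integrable M (C f)" by (rule G.real_cond_exp_int(1)[OF f])
  show "integrable M (\<lambda>x. f (\<theta> x))" by (rule integrable_theta[OF f])
  have int2: "integrable M (\<lambda>x. C f (\<theta> x))" by (rule integrable_theta[OF intC])
  show "integrable M (C (\<lambda>x. C f (\<theta> x)))" by (rule G.real_cond_exp_int(1)[OF int2])
  show "C (\<lambda>x. C f (\<theta> x)) \<in> borel_measurable G" by measurable
  fix A assume A: "A \<in> sets G"
  obtain E where E: "E \<in> sets G" "A = \<theta> -` E \<inter> space M" using G_past[OF A] by blast
  have [measurable]: "E \<in> sets M" using E(1) by (rule sets_G_M)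
  have shift: "(\<integral>x\<in>A. h (\<theta> x) \<partial>M) = (\<integral>x\<in>E. h x \<partial>M)" if [measurable]: "h \<in> borel_measurable M" for h :: "'a \<Rightarrow> real"
  proof -
    have "(\<integral>x\<in>A. h (\<theta> x) \<partial>M) = (\<integral>x. indicator E (\<theta> x) * h (\<theta> x) \<partial>M)"
      unfolding set_lebesgue_integral_def E(2)
      by (intro Bochner_Integration.integral_cong) (auto simp: indicator_def)
    also have "\<dots> = (\<integral>x. indicator E x * h x \<partial>M)"
      by (rule integral_theta[of "\<lambda>x. indicator E x * h x"]) measurable
    finally show ?thesis by (simp add: set_lebesgue_integral_def)
  qed
  have "(\<integral>x\<in>A. f (\<theta> x) \<partial>M) = (\<integral>x\<in>A. C f (\<theta> x) \<partial>M)"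
    using G.real_cond_exp_intA[OF f E(1)] by (simp add: shift)
  also have "\<dots> = (\<integral>x\<in>A. C (\<lambda>x. C f (\<theta> x)) x \<partial>M)" by (rule G.real_cond_exp_intA[OF int2 A])
  finally show "(\<integral>x\<in>A. f (\<theta> x) \<partial>M) = (\<integral>x\<in>A. C (\<lambda>x. C f (\<theta> x)) x \<partial>M)" .
qed

text \<open>Iterates \<open>C_shift\<close>, since conditioning and shifting are both contractions:
  predicting the same quantity further ahead is never sharper in L2.\<close>

lemma norm_L2_C_shift:
  assumes f: "square_integrable M f"
  shows "norm_L2 M (C (\<lambda>x. f ((\<theta> ^^ n) x))) \<le> norm_L2 M (C f)"
proof (induction n)
  case (Suc n)
  let ?g = "\<lambda>x. f ((\<theta> ^^ n) x)"
  have sq: "square_integrable M ?g" by (rule square_integrable_theta_power[OF f])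
  have sqC: "square_integrable M (C ?g)" by (rule square_integrable_C(1)[OF sq])
  have eq: "(\<lambda>x. f ((\<theta> ^^ Suc n) x)) = (\<lambda>x. ?g (\<theta> x))"
    by (simp add: funpow_swap1)
  have "norm_L2 M (C (\<lambda>x. ?g (\<theta> x))) = norm_L2 M (C (\<lambda>x. C ?g (\<theta> x)))"
    by (rule norm_L2_cong_AE[OF C_shift]) (auto intro: square_integrable_integrable sq)
  also have "\<dots> \<le> norm_L2 M (\<lambda>x. C ?g (\<theta> x))"
    by (rule norm_L2_C_le[OF square_integrable_theta[OF sqC]])
  also have "\<dots> = norm_L2 M (C ?g)" by (rule norm_L2_theta) measurable
  finally show ?case unfolding eq using Suc by simp
qed simp

text \<open>With \<open>u = C w\<close> this is \<open>u\<close> one step later minus its prediction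
  from the present; by \<open>C_shift\<close> that prediction may be computed from \<open>w\<close>
  directly.\<close>

definition innovation :: "('a \<Rightarrow> real) \<Rightarrow> 'a \<Rightarrow> real" where
  "innovation w x = C w (\<theta> x) - C (\<lambda>x. w (\<theta> x)) x"

lemma martingale_difference_innovation:
  assumes w: "square_integrable M w"
  shows "martingale_difference (innovation w)"
proof -
  have sq1: "square_integrable M (\<lambda>x. C w (\<theta> x))"
    by (rule square_integrable_theta[OF square_integrable_C(1)[OF w]])
  have sq2: "square_integrable M (C (\<lambda>x. w (\<theta> x)))"
    by (rule square_integrable_C(1)[OF square_integrable_theta[OF w]])
  have G2: "C (\<lambda>x. w (\<theta> x)) \<in> borel_measurable G" by measurable
  have "C w \<in> borel_measurable (Filt 0)" by (rule measurable_G_Filt_0) measurable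
  then have F1: "(\<lambda>x. C w (\<theta> x)) \<in> borel_measurable (Filt 1)"
    using measurable_Filt_shift[of "C w" 0 borel 1 1] by simp
  have F2: "C (\<lambda>x. w (\<theta> x)) \<in> borel_measurable (Filt 1)"
    using G2 by (intro measurable_Filt_mono[OF measurable_G_Filt_0]) auto
  have "AE x in M. C (innovation w) x = C (\<lambda>x. C w (\<theta> x)) x - C (C (\<lambda>x. w (\<theta> x))) x"
    unfolding innovation_def[abs_def]
    by (intro G.real_cond_exp_diff square_integrable_integrable sq1 sq2)
  moreover have "AE x in M. C (C (\<lambda>x. w (\<theta> x))) x = C (\<lambda>x. w (\<theta> x)) x"
    by (intro G.real_cond_exp_F_meas square_integrable_integrable sq2 G2)
  moreover have "AE x in M. C (\<lambda>x. w (\<theta> x)) x = C (\<lambda>x. C w (\<theta> x)) x"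
    by (intro C_shift square_integrable_integrable w)
  ultimately have "AE x in M. C (innovation w) x = 0" by eventually_elim simp
  then show ?thesis
    using F1 F2 sq1 sq2
    by (auto simp: martingale_difference_def innovation_def[abs_def] intro!: square_integrable_diff)
qed

text \<open>By orthogonality the squared norm is the difference of the squares of
  \<open>u = C w\<close> and \<open>p = C (w \<circ> \<theta>)\<close>, that is the inner product of
  \<open>u - p\<close> and \<open>u + p\<close>. So an innovation is small as soon as
  \<open>u - p\<close> is, even when \<open>u\<close> itself is large.\<close>

lemma norm_L2_innovation:
  assumes w: "square_integrable M w"
  shows "(norm_L2 M (innovation w))\<^sup>2 \<le> norm_L2 M (C (\<lambda>x. w x - w (\<theta> x))) * (2 * norm_L2 M (C w))"
proof -
  define u where "u = C w"
  define p where "p = C (\<lambda>x. w (\<theta> x))"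
  have squ: "square_integrable M u" unfolding u_def by (rule square_integrable_C(1)[OF w])
  have squ\<theta>: "square_integrable M (\<lambda>x. u (\<theta> x))" by (rule square_integrable_theta[OF squ])
  have sqp: "square_integrable M p"
    unfolding p_def by (rule square_integrable_C(1)[OF square_integrable_theta[OF w]])
  note [measurable] = square_integrableD[OF squ] square_integrableD[OF sqp]
  have pG: "p \<in> borel_measurable G" unfolding p_def by measurable
  have "(\<integral>x. p x * u (\<theta> x) \<partial>M) = (\<integral>x. p x * C (\<lambda>x. u (\<theta> x)) x \<partial>M)"
    by (rule integral_mult_C[symmetric, OF square_integrable_mult[OF sqp squ\<theta>] pG]) measurable
  also have "\<dots> = (\<integral>x. (p x)\<^sup>2 \<partial>M)"
  proof (rule integral_cong_AE)
    have "AE x in M. p x = C (\<lambda>x. u (\<theta> x)) x"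
      unfolding p_def u_def by (intro C_shift square_integrable_integrable w)
    then show "AE x in M. p x * C (\<lambda>x. u (\<theta> x)) x = (p x)\<^sup>2"
      by eventually_elim (simp add: power2_eq_square)
  qed measurable
  finally have cross: "(\<integral>x. p x * u (\<theta> x) \<partial>M) = (\<integral>x. (p x)\<^sup>2 \<partial>M)" .
  have "(norm_L2 M (innovation w))\<^sup>2 = (\<integral>x. (u (\<theta> x))\<^sup>2 - 2 * (p x * u (\<theta> x)) + (p x)\<^sup>2 \<partial>M)"
    by (simp add: norm_L2_power2 innovation_def u_def[symmetric] p_def[symmetric] power2_diff algebra_simps)
  also have "\<dots> = (\<integral>x. (u (\<theta> x))\<^sup>2 \<partial>M) - 2 * (\<integral>x. p x * u (\<theta> x) \<partial>M) + (\<integral>x. (p x)\<^sup>2 \<partial>M)"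
    using square_integrable_integrable_square[OF squ\<theta>] square_integrable_integrable_square[OF sqp]
      square_integrable_mult[OF sqp squ\<theta>] by simp
  also have "\<dots> = (\<integral>x. (u x)\<^sup>2 \<partial>M) - (\<integral>x. (p x)\<^sup>2 \<partial>M)"
    using integral_theta[of "\<lambda>x. (u x)\<^sup>2"] cross by simp
  also have "\<dots> = (\<integral>x. (u x - p x) * (u x + p x) \<partial>M)"
    using square_integrable_integrable_square[OF squ] square_integrable_integrable_square[OF sqp]
    by (subst Bochner_Integration.integral_diff[symmetric]) (auto simp: power2_eq_square algebra_simps)
  also have "\<dots> \<le> norm_L2 M (\<lambda>x. u x - p x) * norm_L2 M (\<lambda>x. u x + p x)"
    using integral_mult_le_norm_L2[OF square_integrable_diff[OF squ sqp] square_integrable_add[OF squ sqp]]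
    by linarith
  also have "\<dots> \<le> norm_L2 M (C (\<lambda>x. w x - w (\<theta> x))) * (2 * norm_L2 M (C w))"
  proof (intro mult_mono)
    have "AE x in M. C (\<lambda>x. w x - w (\<theta> x)) x = u x - p x"
      unfolding u_def p_def by (intro G.real_cond_exp_diff square_integrable_integrable w square_integrable_theta)
    then have "norm_L2 M (C (\<lambda>x. w x - w (\<theta> x))) = norm_L2 M (\<lambda>x. u x - p x)"
      by (rule norm_L2_cong_AE) measurable
    then show "norm_L2 M (\<lambda>x. u x - p x) \<le> norm_L2 M (C (\<lambda>x. w x - w (\<theta> x)))" by simp
    have "norm_L2 M p \<le> norm_L2 M u"
      unfolding p_def u_def using norm_L2_C_shift[OF w, of 1] by simp
    then show "norm_L2 M (\<lambda>x. u x + p x) \<le> 2 * norm_L2 M (C w)"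
      using norm_L2_triangle[OF squ sqp] by (simp add: u_def)
  qed auto
  finally show ?thesis .
qed

lemma norm_L2_birkhoff_sum_martingale_difference:
  assumes D: "martingale_difference D"
  shows "norm_L2 M (B D n) = sqrt (real n) * norm_L2 M D"
proof -
  have sq: "square_integrable M D" and DF: "D \<in> borel_measurable (Filt 1)"
    using D by (auto simp: martingale_difference_def)
  have "(norm_L2 M (B D n))\<^sup>2 = real n * (norm_L2 M D)\<^sup>2"
  proof (induction n)
    case 0 then show ?case by (simp add: norm_L2_power2)
  next
    case (Suc n)
    have sqB: "square_integrable M (B D n)" by (rule square_integrable_birkhoff_sum[OF sq])
    have sqn: "square_integrable M (\<lambda>x. D ((\<theta> ^^ n) x))" by (rule square_integrable_theta_power[OF sq])
    have int: "integrable M (\<lambda>x. B D n x * D ((\<theta> ^^ n) x))" by (rule square_integrable_mult[OF sqB sqn])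
    have "(norm_L2 M (B D (Suc n)))\<^sup>2 = (\<integral>x. (B D n x)\<^sup>2 + (D ((\<theta> ^^ n) x))\<^sup>2 + 2 * (B D n x * D ((\<theta> ^^ n) x)) \<partial>M)"
      by (simp add: norm_L2_power2 birkhoff_sum_Suc power2_sum mult.assoc)
    also have "\<dots> = (norm_L2 M (B D n))\<^sup>2 + (norm_L2 M (\<lambda>x. D ((\<theta> ^^ n) x)))\<^sup>2"
      using square_integrable_integrable_square[OF sqB] square_integrable_integrable_square[OF sqn] int
        integral_mult_martingale_difference[OF D birkhoff_sum_measurable_Filt[OF DF] int]
      by (simp add: norm_L2_power2)
    also have "norm_L2 M (\<lambda>x. D ((\<theta> ^^ n) x)) = norm_L2 M D"
      using sq by (intro norm_L2_theta_power) (rule square_integrableD)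
    finally show ?case using Suc by (simp add: algebra_simps)
  qed
  then have "sqrt ((norm_L2 M (B D n))\<^sup>2) = sqrt (real n * (norm_L2 M D)\<^sup>2)" by simp
  then show ?thesis by (simp add: real_sqrt_mult)
qed

lemma martingale_difference_zero: "martingale_difference (\<lambda>x. 0)"
proof -
  have "AE x in M. C (\<lambda>x. 0) x = 0" by (rule G.real_cond_exp_F_meas) auto
  then show ?thesis by (simp add: martingale_difference_def square_integrable_zero)
qed

lemma martingale_difference_sum:
  assumes "\<And>r. martingale_difference (f r)"
  shows "martingale_difference (\<lambda>x. \<Sum>r<(s::nat). f r x)"
proof (induction s)
  case 0 show ?case by (simp add: martingale_difference_zero)
next
  case (Suc s)
  from martingale_difference_diff[OF Suc martingale_difference_uminus[OF assms[of s]]]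
  show ?case by simp
qed

text \<open>Partial sums are centred, so the conditional mean of the limit equals that of each tail
  and its norm is below every tail of the norms.\<close>

lemma martingale_difference_series:
  assumes f: "\<And>r. martingale_difference (f r)" and sum: "summable (\<lambda>r. norm_L2 M (f r))"
  shows "martingale_difference (\<lambda>x. \<Sum>r. f r x)"
proof -
  have sq: "square_integrable M (f r)" and F: "f r \<in> borel_measurable (Filt 1)" for r
    using f[of r] by (auto simp: martingale_difference_def)
  let ?D = "\<lambda>x. \<Sum>r. f r x"
  note series = square_integrable_series[OF sq sum]
  have DF: "?D \<in> borel_measurable (Filt 1)" using F by measurable
  have sqS: "square_integrable M (\<lambda>x. \<Sum>r<s. f r x)" for s by (intro square_integrable_sum sq)
  have le: "norm_L2 M (C ?D) \<le> (\<Sum>r. norm_L2 M (f (r + s)))" for s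
  proof -
    have "AE x in M. C (\<lambda>x. ?D x - (\<Sum>r<s. f r x)) x = C ?D x - C (\<lambda>x. \<Sum>r<s. f r x) x"
      by (intro G.real_cond_exp_diff square_integrable_integrable series(1) sqS)
    moreover have "AE x in M. C (\<lambda>x. \<Sum>r<s. f r x) x = 0"
      using martingale_difference_sum[of f s] f by (simp add: martingale_difference_def)
    ultimately have "AE x in M. C ?D x = C (\<lambda>x. ?D x - (\<Sum>r<s. f r x)) x" by eventually_elim simp
    then have "norm_L2 M (C ?D) = norm_L2 M (C (\<lambda>x. ?D x - (\<Sum>r<s. f r x)))"
      by (rule norm_L2_cong_AE) measurable
    also have "\<dots> \<le> norm_L2 M (\<lambda>x. ?D x - (\<Sum>r<s. f r x))"
      by (intro norm_L2_C_le square_integrable_diff series(1) sqS)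
    also have "\<dots> \<le> (\<Sum>r. norm_L2 M (f (r + s)))" by (rule series(2))
    finally show ?thesis .
  qed
  have "(\<lambda>s. \<Sum>r. norm_L2 M (f (r + s))) \<longlonglongrightarrow> 0" by (rule suminf_exist_split2[OF sum])
  then have "norm_L2 M (C ?D) \<le> 0" by (rule LIMSEQ_le_const) (use le in auto)
  then have "norm_L2 M (C ?D) = 0" by (simp add: order_antisym)
  then have "(\<integral>x. (C ?D x)\<^sup>2 \<partial>M) = 0" using norm_L2_power2[of M "C ?D"] by simp
  then have "AE x in M. (C ?D x)\<^sup>2 = 0"
    using square_integrable_integrable_square[OF square_integrable_C(1)[OF series(1)]]
    by (subst (asm) integral_nonneg_eq_0_iff_AE) auto
  then have "AE x in M. C ?D x = 0" by simp
  with DF series(1) show ?thesis by (simp add: martingale_difference_def)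
qed

end

lemma limsup_ereal_eqI:
  fixes y :: "nat \<Rightarrow> real"
  assumes up: "\<And>e. 0 < e \<Longrightarrow> eventually (\<lambda>n. y n \<le> s + e) sequentially"
    and low: "\<And>e. 0 < e \<Longrightarrow> frequently (\<lambda>n. s - e \<le> y n) sequentially"
  shows "limsup (\<lambda>n. ereal (y n)) = ereal s"
proof (rule antisym)
  show "limsup (\<lambda>n. ereal (y n)) \<le> ereal s"
  proof (rule ereal_le_epsilon2)
    fix e :: real assume "0 < e"
    then show "limsup (\<lambda>n. ereal (y n)) \<le> ereal s + ereal e"
      by (intro Limsup_bounded eventually_mono[OF up]) auto
  qed
  show "ereal s \<le> limsup (\<lambda>n. ereal (y n))"
  proof (rule ccontr)
    assume "\<not> ereal s \<le> limsup (\<lambda>n. ereal (y n))"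
    then have "limsup (\<lambda>n. ereal (y n)) < ereal s" by (simp only: not_le)
    from ereal_dense2[OF this] obtain z where z: "limsup (\<lambda>n. ereal (y n)) < ereal z" "ereal z < ereal s"
      by (elim exE conjE)
    have ev: "eventually (\<lambda>n. ereal (y n) < ereal z) sequentially" by (rule Limsup_lessD[OF z(1)])
    have "frequently (\<lambda>n. s - (s - z) \<le> y n) sequentially" using z(2) by (intro low) simp
    then have "frequently (\<lambda>n. False) sequentially"
      by (rule frequently_rev_mp) (use ev in \<open>rule eventually_mono, simp\<close>)
    then show False by simp
  qed
qed

lemma birkhoff_sum_sum:
  "birkhoff_sum \<theta> (\<lambda>x. \<Sum>r\<in>I. f r x) n x = (\<Sum>r\<in>I. birkhoff_sum \<theta> (f r) n x)"
  unfolding birkhoff_sum_def by (rule sum.swap)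

section \<open>Dyadic Poisson equations and the approximating martingale\<close>

locale adapted_process = filtered_system +
  fixes X :: "'a \<Rightarrow> real"
  assumes X_G: "X \<in> borel_measurable G" and X_square_integrable: "square_integrable M X"
begin

text \<open>Composing with \<theta> makes the sum run over times 1 to \<open>n\<close>, while
  \<open>X\<close> itself belongs to time 0.\<close>

definition S :: "nat \<Rightarrow> 'a \<Rightarrow> real" where
  "S = B (\<lambda>x. X (\<theta> x))"

definition V :: "nat \<Rightarrow> real" where
  "V n = norm_L2 M (C (S n))"

lemma square_integrable_S: "square_integrable M (S n)"
  unfolding S_def by (intro square_integrable_birkhoff_sum square_integrable_theta X_square_integrable)

lemma V_nonneg: "0 \<le> V n" by (simp add: V_def)

lemma S_plus: "S (m + n) x = S m x + S n ((\<theta> ^^ m) x)"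
  by (simp add: S_def birkhoff_sum_plus)

text \<open>Writing \<open>S m\<close> as \<open>S (m + n)\<close> minus a shifted
  \<open>S n\<close> bounds \<open>V m\<close> by values at later times. It stands in for
  monotonicity, which \<open>V\<close> may lack.\<close>

lemma V_le: "V m \<le> V (m + n) + V n"
proof -
  note sqm = square_integrable_S[of m] and sqn = square_integrable_theta_power[OF square_integrable_S[of n], of m]
  have "S m = (\<lambda>x. S (m + n) x - S n ((\<theta> ^^ m) x))" by (auto simp: S_plus)
  moreover have "AE x in M. C (\<lambda>x. S (m + n) x - S n ((\<theta> ^^ m) x)) x = C (S (m + n)) x - C (\<lambda>x. S n ((\<theta> ^^ m) x)) x"
    by (intro G.real_cond_exp_diff square_integrable_integrable square_integrable_S sqn)
  ultimately have "V m = norm_L2 M (\<lambda>x. C (S (m + n)) x - C (\<lambda>x. S n ((\<theta> ^^ m) x)) x)"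
    unfolding V_def by (intro norm_L2_cong_AE) auto
  also have "\<dots> \<le> V (m + n) + norm_L2 M (C (\<lambda>x. S n ((\<theta> ^^ m) x)))"
    unfolding V_def by (intro norm_L2_triangle_diff square_integrable_C(1) square_integrable_S sqn)
  also have "norm_L2 M (C (\<lambda>x. S n ((\<theta> ^^ m) x))) \<le> V n"
    unfolding V_def by (rule norm_L2_C_shift[OF square_integrable_S])
  finally show ?thesis by simp
qed

text \<open>With \<open>Q u = C (u \<circ> \<theta>)\<close>, the function \<open>u = C (corrector r)\<close> solves the Poisson equation
  \<open>u - Q u = residual r - residual (r + 1)\<close>: averaging over the dyadic block of length \<open>2 ^ r\<close>
  replaces the resolvent of \<open>Q\<close>.\<close>

fun corrector :: "nat \<Rightarrow> 'a \<Rightarrow> real" where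
  "corrector 0 x = X x"
| "corrector (Suc r) x = (1 / (2 * 2 ^ r)) * (\<Sum>i<2 ^ r. S (2 ^ r) ((\<theta> ^^ i) x))"

text \<open>From level 1 on, the conditional mean of a dyadic average of the process. The equations
  telescope from \<open>X\<close> to \<open>residual t\<close>, so this is what remains unsolved
  after \<open>t\<close> levels.\<close>

fun residual :: "nat \<Rightarrow> 'a \<Rightarrow> real" where
  "residual 0 x = X x"
| "residual (Suc r) x = C (S (2 ^ r)) x / 2 ^ r"

lemma corrector_0: "corrector 0 = X" and residual_0: "residual 0 = X" by auto

definition correction :: "nat \<Rightarrow> 'a \<Rightarrow> real" where
  "correction r = C (\<lambda>x. corrector r (\<theta> x))"

lemma square_integrable_corrector: "square_integrable M (corrector r)"
proof (cases r)
  case 0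
  then show ?thesis using X_square_integrable by (simp add: corrector_0 residual_0)
next
  case (Suc q)
  show ?thesis unfolding Suc corrector.simps(2)[abs_def]
    by (intro square_integrable_cmult square_integrable_sum square_integrable_theta_power square_integrable_S)
qed

lemma square_integrable_residual: "square_integrable M (residual r)"
proof (cases r)
  case 0
  then show ?thesis using X_square_integrable by (simp add: corrector_0 residual_0)
next
  case (Suc q)
  have "residual r = (\<lambda>x. (1 / 2 ^ q) * C (S (2 ^ q)) x)" by (auto simp: Suc)
  then show ?thesis by (simp only:) (intro square_integrable_cmult square_integrable_C(1) square_integrable_S)
qed

lemma square_integrable_correction: "square_integrable M (correction r)"
  unfolding correction_def
  by (intro square_integrable_C(1) square_integrable_theta square_integrable_corrector)

text \<open>A moving sum minus its shift telescopes to \<open>S m x\<close> minus its shift by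
  \<open>m\<close>, and that shift is \<open>S (2 * m) x - S m x\<close>, where
  \<open>m = 2 ^ r\<close>.\<close>

lemma corrector_Suc_diff:
  "corrector (Suc r) x - corrector (Suc r) (\<theta> x) = S (2 ^ r) x / 2 ^ r - S (2 ^ Suc r) x / 2 ^ Suc r"
proof -
  let ?m = "2 ^ r :: nat"
  have "(\<Sum>i<?m. S ?m ((\<theta> ^^ i) x)) - (\<Sum>i<?m. S ?m ((\<theta> ^^ i) (\<theta> x)))
      = (\<Sum>i<?m. S ?m ((\<theta> ^^ i) x) - S ?m ((\<theta> ^^ Suc i) x))"
    unfolding sum_subtractf funpow_Suc_right comp_apply ..
  also have "\<dots> = S ?m x - S ?m ((\<theta> ^^ ?m) x)"
    using sum_lessThan_telescope'[of "\<lambda>i. S ?m ((\<theta> ^^ i) x)" ?m] by (simp only: funpow_0)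
  also have "\<dots> = 2 * S ?m x - S (2 ^ Suc r) x"
    unfolding power_Suc mult_2 S_plus by simp
  finally have "corrector (Suc r) x - corrector (Suc r) (\<theta> x) = (1 / (2 * 2 ^ r)) * (2 * S ?m x - S (2 ^ Suc r) x)"
    by (simp only: corrector.simps right_diff_distrib[symmetric])
  also have "\<dots> = S (2 ^ r) x / 2 ^ r - S (2 ^ Suc r) x / 2 ^ Suc r"
    by (simp add: diff_divide_distrib)
  finally show ?thesis .
qed

lemma poisson_equation: "AE x in M. C (corrector r) x - correction r x = residual r x - residual (Suc r) x"
proof (cases r)
  case 0
  have "AE x in M. C X x = X x"
    by (intro G.real_cond_exp_F_meas square_integrable_integrable X_square_integrable X_G)
  moreover have "S 1 = (\<lambda>x. X (\<theta> x))" by (auto simp: S_def)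
  ultimately show ?thesis by (simp add: 0 correction_def corrector_0)
next
  case (Suc q)
  note sq = square_integrable_integrable[OF square_integrable_corrector]
    square_integrable_integrable[OF square_integrable_theta[OF square_integrable_corrector]]
  have diff: "AE x in M. C (\<lambda>x. corrector r x - corrector r (\<theta> x)) x = C (corrector r) x - correction r x"
    unfolding correction_def by (intro G.real_cond_exp_diff sq)
  have eq: "(\<lambda>x. corrector r x - corrector r (\<theta> x)) = (\<lambda>x. S (2 ^ q) x / 2 ^ q - S (2 ^ r) x / 2 ^ r)"
    unfolding Suc by (rule ext, rule corrector_Suc_diff)
  have "AE x in M. C (\<lambda>x. S (2 ^ q) x / 2 ^ q - S (2 ^ r) x / 2 ^ r) x
      = C (\<lambda>x. S (2 ^ q) x / 2 ^ q) x - C (\<lambda>x. S (2 ^ r) x / 2 ^ r) x"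
    by (intro G.real_cond_exp_diff integrable_divide square_integrable_integrable square_integrable_S)
  moreover have "AE x in M. C (\<lambda>x. S (2 ^ q) x / 2 ^ q) x = C (S (2 ^ q)) x / 2 ^ q"
    by (intro G.real_cond_exp_cdiv square_integrable_integrable square_integrable_S)
  moreover have "AE x in M. C (\<lambda>x. S (2 ^ r) x / 2 ^ r) x = C (S (2 ^ r)) x / 2 ^ r"
    by (intro G.real_cond_exp_cdiv square_integrable_integrable square_integrable_S)
  ultimately have "AE x in M. C (corrector r) x - correction r x = C (S (2 ^ q)) x / 2 ^ q - C (S (2 ^ r)) x / 2 ^ r"
    using diff unfolding eq by eventually_elim simp
  then show ?thesis unfolding Suc residual.simps .
qed

lemma norm_L2_residual_Suc: "norm_L2 M (residual (Suc r)) = V (2 ^ r) / 2 ^ r"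
proof -
  have "residual (Suc r) = (\<lambda>x. (1 / 2 ^ r) * C (S (2 ^ r)) x)" by auto
  then show ?thesis by (simp only: norm_L2_cmult V_def) simp
qed

lemma norm_L2_C_corrector_Suc: "norm_L2 M (C (corrector (Suc r))) \<le> V (2 ^ r) / 2"
proof -
  let ?m = "2 ^ r :: nat"
  let ?f = "\<lambda>i x. S ?m ((\<theta> ^^ i) x)"
  have sqf: "square_integrable M (?f i)" for i by (intro square_integrable_theta_power square_integrable_S)
  have sqs: "square_integrable M (\<lambda>x. \<Sum>i<?m. ?f i x)" by (intro square_integrable_sum sqf)
  have "AE x in M. C (\<lambda>x. (1 / (2 * 2 ^ r)) * (\<Sum>i<?m. ?f i x)) x = (1 / (2 * 2 ^ r)) * C (\<lambda>x. \<Sum>i<?m. ?f i x) x"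
    by (intro G.real_cond_exp_cmult square_integrable_integrable sqs)
  moreover have "AE x in M. C (\<lambda>x. \<Sum>i<?m. ?f i x) x = (\<Sum>i<?m. C (?f i) x)"
    by (intro G.real_cond_exp_sum square_integrable_integrable sqf)
  ultimately have "AE x in M. C (corrector (Suc r)) x = (1 / (2 * 2 ^ r)) * (\<Sum>i<?m. C (?f i) x)"
    unfolding corrector.simps(2)[abs_def] by eventually_elim simp
  then have "norm_L2 M (C (corrector (Suc r))) = norm_L2 M (\<lambda>x. (1 / (2 * 2 ^ r)) * (\<Sum>i<?m. C (?f i) x))"
    by (rule norm_L2_cong_AE) measurable
  also have "\<dots> = (1 / (2 * 2 ^ r)) * norm_L2 M (\<lambda>x. \<Sum>i<?m. C (?f i) x)"
    by (subst norm_L2_cmult) simp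
  also have "\<dots> \<le> (1 / (2 * 2 ^ r)) * (\<Sum>i<?m. V ?m)"
  proof (intro mult_left_mono)
    have "norm_L2 M (\<lambda>x. \<Sum>i<?m. C (?f i) x) \<le> (\<Sum>i<?m. norm_L2 M (C (?f i)))"
      by (intro norm_L2_sum square_integrable_C(1) sqf) auto
    also have "\<dots> \<le> (\<Sum>i<?m. V ?m)"
      unfolding V_def by (intro sum_mono norm_L2_C_shift square_integrable_S)
    finally show "norm_L2 M (\<lambda>x. \<Sum>i<?m. C (?f i) x) \<le> (\<Sum>i<?m. V ?m)" .
  qed simp
  also have "\<dots> = V ?m / 2" by simp
  finally show ?thesis .
qed

lemma norm_L2_correction: "norm_L2 M (correction r) \<le> norm_L2 M (C (corrector r))"
  unfolding correction_def using norm_L2_C_shift[OF square_integrable_corrector[of r], of 1] by simp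

text \<open>For \<open>m = 2 ^ r\<close> the difference in the Poisson equation has norm at most
  \<open>V m / m\<close>, the solution itself at most \<open>V m / 2\<close>;
  \<open>norm_L2_innovation\<close> takes the geometric mean of the first and twice the
  second.\<close>

lemma norm_L2_innovation_corrector: "norm_L2 M (innovation (corrector (Suc r))) \<le> V (2 ^ r) / sqrt (2 ^ r)"
proof -
  let ?m = "2 ^ r :: nat"
  have eq: "(\<lambda>x. corrector (Suc r) x - corrector (Suc r) (\<theta> x)) = (\<lambda>x. (1 / (2 * 2 ^ r)) * (S ?m x - S ?m ((\<theta> ^^ ?m) x)))"
  proof
    fix x
    show "corrector (Suc r) x - corrector (Suc r) (\<theta> x) = (1 / (2 * 2 ^ r)) * (S ?m x - S ?m ((\<theta> ^^ ?m) x))"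
    proof -
      have "S (2 ^ Suc r) x = S ?m x + S ?m ((\<theta> ^^ ?m) x)" unfolding power_Suc mult_2 S_plus ..
      then show ?thesis unfolding corrector_Suc_diff by (simp only: power_Suc) (simp add: field_simps)
    qed
  qed
  note sqm = square_integrable_S[of ?m] and sqs = square_integrable_theta_power[OF square_integrable_S[of ?m], of ?m]
  have "AE x in M. C (\<lambda>x. (1 / (2 * 2 ^ r)) * (S ?m x - S ?m ((\<theta> ^^ ?m) x))) x
      = (1 / (2 * 2 ^ r)) * C (\<lambda>x. S ?m x - S ?m ((\<theta> ^^ ?m) x)) x"
    by (intro G.real_cond_exp_cmult square_integrable_integrable square_integrable_diff sqm sqs)
  moreover have "AE x in M. C (\<lambda>x. S ?m x - S ?m ((\<theta> ^^ ?m) x)) x = C (S ?m) x - C (\<lambda>x. S ?m ((\<theta> ^^ ?m) x)) x"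
    by (intro G.real_cond_exp_diff square_integrable_integrable sqm sqs)
  ultimately have "AE x in M. C (\<lambda>x. corrector (Suc r) x - corrector (Suc r) (\<theta> x)) x
      = (1 / (2 * 2 ^ r)) * (C (S ?m) x - C (\<lambda>x. S ?m ((\<theta> ^^ ?m) x)) x)"
    unfolding eq by eventually_elim simp
  then have "norm_L2 M (C (\<lambda>x. corrector (Suc r) x - corrector (Suc r) (\<theta> x)))
      = norm_L2 M (\<lambda>x. (1 / (2 * 2 ^ r)) * (C (S ?m) x - C (\<lambda>x. S ?m ((\<theta> ^^ ?m) x)) x))"
    by (rule norm_L2_cong_AE) measurable
  also have "\<dots> = (1 / (2 * 2 ^ r)) * norm_L2 M (\<lambda>x. C (S ?m) x - C (\<lambda>x. S ?m ((\<theta> ^^ ?m) x)) x)"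
    by (subst norm_L2_cmult) simp
  also have "\<dots> \<le> (1 / (2 * 2 ^ r)) * (V ?m + V ?m)"
  proof (intro mult_left_mono)
    have "norm_L2 M (\<lambda>x. C (S ?m) x - C (\<lambda>x. S ?m ((\<theta> ^^ ?m) x)) x)
        \<le> norm_L2 M (C (S ?m)) + norm_L2 M (C (\<lambda>x. S ?m ((\<theta> ^^ ?m) x)))"
      by (intro norm_L2_triangle_diff square_integrable_C(1) sqm sqs)
    also have "\<dots> \<le> V ?m + V ?m"
      unfolding V_def by (intro add_left_mono norm_L2_C_shift sqm)
    finally show "norm_L2 M (\<lambda>x. C (S ?m) x - C (\<lambda>x. S ?m ((\<theta> ^^ ?m) x)) x) \<le> V ?m + V ?m" .
  qed simp
  also have "\<dots> = V ?m / 2 ^ r" by simp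
  finally have 1: "norm_L2 M (C (\<lambda>x. corrector (Suc r) x - corrector (Suc r) (\<theta> x))) \<le> V ?m / 2 ^ r" .
  have "(norm_L2 M (innovation (corrector (Suc r))))\<^sup>2 \<le> V ?m / 2 ^ r * (2 * (V ?m / 2))"
    using norm_L2_C_corrector_Suc[of r] V_nonneg
    by (intro order_trans[OF norm_L2_innovation[OF square_integrable_corrector]] mult_mono 1) auto
  also have "\<dots> = (V ?m / sqrt (2 ^ r))\<^sup>2" by (simp add: power_divide power2_eq_square)
  finally show ?thesis by (rule power2_le_imp_le) (simp add: V_nonneg)
qed

theorem martingale_approximation:
  assumes sum: "summable (\<lambda>q. real (Suc q) * (V (2 ^ q) / sqrt (2 ^ q)))"
  obtains D where "martingale_difference D"
    and "(\<lambda>n. norm_L2 M (B (\<lambda>x. X (\<theta> x) - D x) n) / sqrt (real n)) \<longlonglongrightarrow> 0"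
    and "AE x in M. \<exists>K. \<forall>n. \<bar>B (\<lambda>x. X (\<theta> x) - D x) n x\<bar> \<le> K * sqrt (real n)"
proof -
  define a where "a q = V (2 ^ q) / sqrt (2 ^ q)" for q
  have a0: "0 \<le> a q" for q by (simp add: a_def V_nonneg)
  have Va: "V (2 ^ q) = sqrt (2 ^ q) * a q" for q by (simp add: a_def)
  have sum_a: "summable (\<lambda>q. real (Suc q) * a q)" using sum by (simp add: a_def)
  have sa: "summable a" and tails: "summable (\<lambda>s. \<Sum>q. a (q + s))"
    using summable_tails[OF a0 sum_a] by auto
  define \<Delta> where "\<Delta> r = innovation (corrector r)" for r
  have md: "martingale_difference (\<Delta> r)" for r
    unfolding \<Delta>_def by (intro martingale_difference_innovation square_integrable_corrector)
  have nD: "norm_L2 M (\<Delta> (Suc q)) \<le> a q" for q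
    unfolding \<Delta>_def a_def by (rule norm_L2_innovation_corrector)
  have "summable (\<lambda>q. norm_L2 M (\<Delta> (Suc q)))"
    by (rule summable_comparison_test'[OF sa, of 0]) (simp add: nD)
  then have sD: "summable (\<lambda>r. norm_L2 M (\<Delta> r))" by (subst (asm) summable_Suc_iff)
  define D where "D x = (\<Sum>r. \<Delta> r x)" for x
  have mdD: "martingale_difference D" unfolding D_def[abs_def] by (rule martingale_difference_series[OF md sD])
  have sq\<Delta>: "square_integrable M (\<Delta> r)" for r using md[of r] by (simp add: martingale_difference_def)
  have sqD: "square_integrable M D" using mdD by (simp add: martingale_difference_def)
  define \<xi> where "\<xi> x = X (\<theta> x) - D x" for x
  have sq\<xi>: "square_integrable M \<xi>"
    unfolding \<xi>_def[abs_def] by (intro square_integrable_diff square_integrable_theta X_square_integrable sqD)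
  \<comment> \<open>The first \<open>t\<close> Poisson equations, taken one step later, split the
    remainder into a coboundary, the unsolved residual and the innovations not yet used.\<close>
  have decomp: "AE x in M. \<xi> x = (\<Sum>r<t. correction r x - correction r (\<theta> x)) + residual t (\<theta> x) - (D x - (\<Sum>r<t. \<Delta> r x))" for t
  proof -
    have "AE x in M. \<forall>r. C (corrector r) (\<theta> x) - correction r (\<theta> x) = residual r (\<theta> x) - residual (Suc r) (\<theta> x)"
      unfolding AE_all_countable using AE_theta[OF poisson_equation] by blast
    then show ?thesis
    proof eventually_elim
      case (elim x)
      have "(\<Sum>r<t. correction r x - correction r (\<theta> x)) + (\<Sum>r<t. \<Delta> r x)
          = (\<Sum>r<t. residual r (\<theta> x) - residual (Suc r) (\<theta> x))"
        unfolding sum.distrib[symmetric]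
        using elim by (intro sum.cong) (auto simp: \<Delta>_def innovation_def correction_def)
      also have "\<dots> = X (\<theta> x) - residual t (\<theta> x)" by (subst sum_lessThan_telescope') simp
      finally show ?case by (simp add: \<xi>_def)
    qed
  qed
  \<comment> \<open>The coboundary does not accumulate, the residual is bounded linearly in
    \<open>n\<close>, and the martingale tail grows like \<open>sqrt n\<close>. The number
    \<open>t\<close> of levels is still free; \<open>main\<close> takes \<open>t = s + 1\<close> for
    \<open>n\<close> of order \<open>2 ^ s\<close>.\<close>
  have bound: "norm_L2 M (B \<xi> n) \<le> (\<Sum>r<t. 2 * norm_L2 M (correction r)) + real n * norm_L2 M (residual t)
      + sqrt (real n) * (\<Sum>r. norm_L2 M (\<Delta> (r + t)))" for n t
  proof -
    let ?E = "\<lambda>x. D x - (\<Sum>r<t. \<Delta> r x)"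
    let ?P = "\<lambda>x. \<Sum>r<t. correction r x - correction r ((\<theta> ^^ n) x)"
    let ?R = "B (\<lambda>x. residual t (\<theta> x)) n"
    note sqc = square_integrable_correction square_integrable_theta_power[OF square_integrable_correction]
    have mdE: "martingale_difference ?E"
      by (intro martingale_difference_diff mdD martingale_difference_sum md)
    have sqP: "square_integrable M ?P" by (intro square_integrable_sum square_integrable_diff sqc)
    have sqR1: "square_integrable M (\<lambda>x. residual t (\<theta> x))"
      by (intro square_integrable_theta square_integrable_residual)
    have sqR: "square_integrable M ?R" by (rule square_integrable_birkhoff_sum[OF sqR1])
    have sqE: "square_integrable M (B ?E n)"
      using mdE by (intro square_integrable_birkhoff_sum) (simp add: martingale_difference_def)
    have eq: "B (\<lambda>x. (\<Sum>r<t. correction r x - correction r (\<theta> x)) + residual t (\<theta> x) - ?E x) n x = ?P x + ?R x - B ?E n x" for x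
      by (simp only: birkhoff_sum_diff birkhoff_sum_add birkhoff_sum_sum birkhoff_sum_coboundary[unfolded birkhoff_sum_diff])
    have "AE x in M. B \<xi> n x = ?P x + ?R x - B ?E n x"
      using birkhoff_sum_cong_AE[OF decomp[of t]] by eventually_elim (simp only: eq)
    then have "norm_L2 M (B \<xi> n) = norm_L2 M (\<lambda>x. ?P x + ?R x - B ?E n x)"
      using square_integrable_diff[OF square_integrable_add[OF sqP sqR] sqE] square_integrable_birkhoff_sum[OF sq\<xi>]
      by (intro norm_L2_cong_AE square_integrableD)
    also have "\<dots> \<le> norm_L2 M ?P + norm_L2 M ?R + norm_L2 M (B ?E n)"
      using norm_L2_triangle_diff[OF square_integrable_add[OF sqP sqR] sqE] norm_L2_triangle[OF sqP sqR] by linarith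
    also have "\<dots> \<le> (\<Sum>r<t. 2 * norm_L2 M (correction r)) + real n * norm_L2 M (residual t)
      + sqrt (real n) * (\<Sum>r. norm_L2 M (\<Delta> (r + t)))"
    proof (intro add_mono)
      have "norm_L2 M ?P \<le> (\<Sum>r<t. norm_L2 M (\<lambda>x. correction r x - correction r ((\<theta> ^^ n) x)))"
        by (intro norm_L2_sum square_integrable_diff sqc) auto
      also have "\<dots> \<le> (\<Sum>r<t. 2 * norm_L2 M (correction r))"
      proof (rule sum_mono)
        fix r
        have "norm_L2 M (\<lambda>x. correction r ((\<theta> ^^ n) x)) = norm_L2 M (correction r)"
          by (intro norm_L2_theta_power square_integrableD sqc)
        then show "norm_L2 M (\<lambda>x. correction r x - correction r ((\<theta> ^^ n) x)) \<le> 2 * norm_L2 M (correction r)"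
          using norm_L2_triangle_diff[OF sqc(1)[of r] sqc(2)[of r n]] by simp
      qed
      finally show "norm_L2 M ?P \<le> (\<Sum>r<t. 2 * norm_L2 M (correction r))" .
      have "norm_L2 M ?R \<le> (\<Sum>k<n. norm_L2 M (\<lambda>x. residual t (\<theta> ((\<theta> ^^ k) x))))"
        unfolding birkhoff_sum_def[abs_def] using square_integrable_theta_power[OF sqR1]
        by (intro norm_L2_sum) auto
      also have "\<dots> = (\<Sum>k<n. norm_L2 M (residual t))"
      proof (rule sum.cong[OF refl])
        fix k
        show "norm_L2 M (\<lambda>x. residual t (\<theta> ((\<theta> ^^ k) x))) = norm_L2 M (residual t)"
          using norm_L2_theta_power[OF square_integrableD[OF square_integrable_residual[of t]], of "Suc k"] by simp
      qed
      finally show "norm_L2 M ?R \<le> real n * norm_L2 M (residual t)" by simp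
      have "norm_L2 M ?E \<le> (\<Sum>r. norm_L2 M (\<Delta> (r + t)))"
        unfolding D_def by (rule square_integrable_series(2)[OF sq\<Delta> sD])
      then show "norm_L2 M (B ?E n) \<le> sqrt (real n) * (\<Sum>r. norm_L2 M (\<Delta> (r + t)))"
        unfolding norm_L2_birkhoff_sum_martingale_difference[OF mdE] by (intro mult_left_mono) auto
    qed
    finally show ?thesis .
  qed
  define g where "g = 1 / sqrt (2::real)"
  have g: "0 < g" "g < 1" by (auto simp: g_def)
  have g_pow: "g ^ k = 1 / sqrt (2 ^ k)" for k by (simp add: g_def power_one_over real_sqrt_power)
  define \<delta> where "\<delta> s = 2 * norm_L2 M (C X) * g ^ s + (\<Sum>q\<le>s. a q * g ^ (s - q)) + 2 * a s + (\<Sum>q. a (q + s))" for s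
  have sum\<delta>: "summable \<delta>"
  proof -
    have sg: "summable (\<lambda>k. g ^ k)" using g by (intro summable_geometric) auto
    have "summable (\<lambda>s. \<Sum>q\<le>s. a q * g ^ (s - q))"
      using sa sg a0 g by (intro summable_Cauchy_product) (auto simp: abs_of_nonneg)
    then show ?thesis unfolding \<delta>_def[abs_def]
      by (intro summable_add summable_mult sg sa tails)
  qed
  \<comment> \<open>Covering all \<open>n\<close> from \<open>2 ^ s\<close> to
    \<open>2 ^ (s + 1)\<close> serves both conclusions: convergence along all \<open>n\<close>, and
    summability along \<open>n = 2 ^ s\<close>.\<close>
  have main: "norm_L2 M (B \<xi> n) / sqrt (real n) \<le> \<delta> s" if n: "2 ^ s \<le> n" "n \<le> 2 * 2 ^ s" for n s
  proof -
    have n2: "2 ^ s \<le> real n" "real n \<le> 2 * 2 ^ s"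
      using of_nat_mono[OF n(1), where 'a=real] of_nat_mono[OF n(2), where 'a=real] by auto
    have n0: "0 < real n" using n2(1) by (rule less_le_trans[rotated]) simp
    define sn where "sn = sqrt (real n)"
    have sn0: "0 < sn" using n0 by (simp add: sn_def)
    have sn_ge: "sqrt (2 ^ s) \<le> sn" unfolding sn_def using n2(1) by (rule real_sqrt_le_mono)
    have sn_le: "sn \<le> 2 * sqrt (2 ^ s)"
    proof -
      have "sn \<le> sqrt (2 ^ 2 * 2 ^ s)" unfolding sn_def using n2(2) by (intro real_sqrt_le_mono) simp
      then show ?thesis by (simp only: real_sqrt_mult real_sqrt_abs abs_numeral)
    qed
    have inv: "1 / sn \<le> g ^ s" unfolding g_pow using sn_ge by (intro divide_left_mono) (auto simp: sn0)
    have T1: "(\<Sum>r<Suc s. 2 * norm_L2 M (correction r)) / sn \<le> 2 * norm_L2 M (C X) * g ^ s + (\<Sum>q\<le>s. a q * g ^ (s - q))"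
    proof -
      have c0: "norm_L2 M (correction 0) \<le> norm_L2 M (C X)"
        using norm_L2_correction[of 0] by (simp add: corrector_0)
      have "(\<Sum>r<Suc s. 2 * norm_L2 M (correction r)) = 2 * norm_L2 M (correction 0) + (\<Sum>q<s. 2 * norm_L2 M (correction (Suc q)))"
        by (rule sum.lessThan_Suc_shift)
      also have "\<dots> \<le> 2 * norm_L2 M (C X) + (\<Sum>q<s. V (2 ^ q))"
      proof (intro add_mono sum_mono)
        fix q
        show "2 * norm_L2 M (correction (Suc q)) \<le> V (2 ^ q)"
          using norm_L2_correction[of "Suc q"] norm_L2_C_corrector_Suc[of q] by linarith
      qed (use c0 in simp)
      finally have "(\<Sum>r<Suc s. 2 * norm_L2 M (correction r)) * (1 / sn) \<le> (2 * norm_L2 M (C X) + (\<Sum>q<s. V (2 ^ q))) * g ^ s"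
        using inv sn0 by (intro mult_mono) (auto intro!: add_nonneg_nonneg sum_nonneg V_nonneg)
      also have "\<dots> = 2 * norm_L2 M (C X) * g ^ s + (\<Sum>q<s. a q * g ^ (s - q))"
      proof -
        have "V (2 ^ q) * g ^ s = a q * g ^ (s - q)" if "q < s" for q
        proof -
          have "g ^ s = g ^ q * g ^ (s - q)" using that by (simp add: power_add[symmetric])
          then show ?thesis by (simp add: Va g_pow[of q])
        qed
        then show ?thesis by (simp add: distrib_right sum_distrib_right)
      qed
      also have "\<dots> \<le> 2 * norm_L2 M (C X) * g ^ s + (\<Sum>q\<le>s. a q * g ^ (s - q))"
        using a0 g by (intro add_left_mono sum_mono2) auto
      finally show ?thesis by simp
    qed
    have T2: "real n * norm_L2 M (residual (Suc s)) / sn \<le> 2 * a s"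
    proof -
      have "real n = sn * sn" using n0 by (simp add: sn_def)
      then have "real n * norm_L2 M (residual (Suc s)) / sn = sn * (V (2 ^ s) / 2 ^ s)"
        unfolding norm_L2_residual_Suc using sn0 by simp
      also have "\<dots> \<le> (2 * sqrt (2 ^ s)) * (V (2 ^ s) / 2 ^ s)"
        using sn_le V_nonneg by (intro mult_right_mono) auto
      also have "\<dots> = 2 * a s * (sqrt (2 ^ s) * sqrt (2 ^ s) / 2 ^ s)"
        unfolding Va by (simp only: mult_ac times_divide_eq_right times_divide_eq_left)
      also have "\<dots> = 2 * a s" by simp
      finally show ?thesis .
    qed
    have T3: "(\<Sum>r. norm_L2 M (\<Delta> (r + Suc s))) \<le> (\<Sum>q. a (q + s))"
    proof (rule suminf_le)
      show "norm_L2 M (\<Delta> (r + Suc s)) \<le> a (r + s)" for r using nD[of "r + s"] by simp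
      show "summable (\<lambda>r. norm_L2 M (\<Delta> (r + Suc s)))" using summable_ignore_initial_segment[OF sD] .
      show "summable (\<lambda>q. a (q + s))" using summable_ignore_initial_segment[OF sa] .
    qed
    have "norm_L2 M (B \<xi> n) / sn \<le> ((\<Sum>r<Suc s. 2 * norm_L2 M (correction r)) + real n * norm_L2 M (residual (Suc s))
      + sn * (\<Sum>r. norm_L2 M (\<Delta> (r + Suc s)))) / sn"
      using bound[of n "Suc s"] sn0 unfolding sn_def by (intro divide_right_mono) auto
    also have "\<dots> = (\<Sum>r<Suc s. 2 * norm_L2 M (correction r)) / sn + real n * norm_L2 M (residual (Suc s)) / sn
      + (\<Sum>r. norm_L2 M (\<Delta> (r + Suc s)))"
      using sn0 unfolding add_divide_distrib by simp
    also have "\<dots> \<le> \<delta> s" unfolding \<delta>_def by (intro add_mono T1 T2 T3)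
    finally show ?thesis by (simp add: sn_def)
  qed
  have lim: "(\<lambda>n. norm_L2 M (B \<xi> n) / sqrt (real n)) \<longlonglongrightarrow> 0"
  proof (rule LIMSEQ_I)
    fix e :: real assume "0 < e"
    with summable_LIMSEQ_zero[OF sum\<delta>] have "eventually (\<lambda>s. \<delta> s < e) sequentially"
      by (rule order_tendstoD(2))
    then obtain s0 where s0: "\<And>s. s0 \<le> s \<Longrightarrow> \<delta> s < e" by (auto simp: eventually_sequentially)
    show "\<exists>no. \<forall>n\<ge>no. norm (norm_L2 M (B \<xi> n) / sqrt (real n) - 0) < e"
    proof (intro exI allI impI)
      fix n :: nat assume n: "2 ^ s0 \<le> n"
      then have "1 \<le> n" using one_le_power[of "2::nat" s0] by linarith
      then obtain s where s: "2 ^ s \<le> n" "n < 2 ^ (s + 1)" using ex_power_ivl1[of 2 n] by auto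
      have "(2::nat) ^ s0 < 2 ^ (s + 1)" using n s(2) by linarith
      then have "s0 < s + 1" by (rule power_less_imp_less_exp[rotated]) simp
      then show "norm (norm_L2 M (B \<xi> n) / sqrt (real n) - 0) < e"
        using main[of s n] s s0[of s] by simp
    qed
  qed
  have "summable (\<lambda>j. norm_L2 M (B \<xi> (2 ^ j)) / sqrt (2 ^ j))"
    by (rule summable_comparison_test'[OF sum\<delta>, of 0]) (use main[of _ "2 ^ _"] in simp)
  then have "AE x in M. \<exists>K. \<forall>n. \<bar>B \<xi> n x\<bar> \<le> K * sqrt (real n)"
    by (rule birkhoff_sum_sqrt_bound[OF sq\<xi>])
  with that[OF mdD] lim show thesis unfolding \<xi>_def[abs_def] by blast
qed

theorem law_of_iterated_logarithm:
  assumes "summable (\<lambda>q. real (Suc q) * (V (2 ^ q) / sqrt (2 ^ q)))"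
  obtains \<sigma> where "0 \<le> \<sigma>"
    and "(\<lambda>n. (norm_L2 M (S n))\<^sup>2 / real n) \<longlonglongrightarrow> \<sigma>\<^sup>2"
    and "AE x in M. limsup (\<lambda>n. ereal (S n x / sqrt (2 * real n * ln (ln (real n))))) = ereal \<sigma>"
proof -
  obtain D where D: "martingale_difference D"
    and small: "(\<lambda>n. norm_L2 M (B (\<lambda>x. X (\<theta> x) - D x) n) / sqrt (real n)) \<longlonglongrightarrow> 0"
    and bounded: "AE x in M. \<exists>K. \<forall>n. \<bar>B (\<lambda>x. X (\<theta> x) - D x) n x\<bar> \<le> K * sqrt (real n)"
    using martingale_approximation[OF assms] by blast
  define \<xi> where "\<xi> x = X (\<theta> x) - D x" for x
  define \<sigma> where "\<sigma> = norm_L2 M D"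
  have sqD: "square_integrable M D" using D by (simp add: martingale_difference_def)
  have sq\<xi>: "square_integrable M \<xi>"
    unfolding \<xi>_def[abs_def] by (intro square_integrable_diff square_integrable_theta X_square_integrable sqD)
  have S_eq: "S n x = B D n x + B \<xi> n x" for n x
    by (simp add: S_def \<xi>_def[abs_def] birkhoff_sum_diff)
  have variance: "(\<lambda>n. (norm_L2 M (S n))\<^sup>2 / real n) \<longlonglongrightarrow> \<sigma>\<^sup>2"
  proof -
    \<comment> \<open>By orthogonality the norm of the martingale is exactly
      \<open>sqrt n * \<sigma>\<close>, so the reverse triangle inequality compares it with that of
      \<open>S n\<close> up to the remainder.\<close>
    have "(\<lambda>n. norm_L2 M (S n) / sqrt (real n) - \<sigma>) \<longlonglongrightarrow> 0"
    proof (rule Lim_null_comparison[OF _ small[folded \<xi>_def]])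
      show "eventually (\<lambda>n. norm (norm_L2 M (S n) / sqrt (real n) - \<sigma>) \<le> norm_L2 M (B \<xi> n) / sqrt (real n)) sequentially"
        using eventually_gt_at_top[of 0]
      proof eventually_elim
        case (elim n)
        note sq = square_integrable_birkhoff_sum[OF sqD, of n] square_integrable_birkhoff_sum[OF sq\<xi>, of n]
        have "norm_L2 M (S n) \<le> norm_L2 M (B D n) + norm_L2 M (B \<xi> n)"
          using norm_L2_triangle[OF sq] by (simp add: S_eq[abs_def])
        moreover have "norm_L2 M (B D n) \<le> norm_L2 M (S n) + norm_L2 M (B \<xi> n)"
        proof -
          have "B D n = (\<lambda>x. S n x - B \<xi> n x)" by (simp add: S_eq)
          then show ?thesis using norm_L2_triangle_diff[OF square_integrable_S[of n] sq(2)] by simp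
        qed
        ultimately have "\<bar>norm_L2 M (S n) - sqrt (real n) * \<sigma>\<bar> \<le> norm_L2 M (B \<xi> n)"
          unfolding \<sigma>_def norm_L2_birkhoff_sum_martingale_difference[OF D] by linarith
        then have "\<bar>norm_L2 M (S n) - sqrt (real n) * \<sigma>\<bar> / sqrt (real n) \<le> norm_L2 M (B \<xi> n) / sqrt (real n)"
          by (rule divide_right_mono) simp
        moreover have "norm_L2 M (S n) / sqrt (real n) - \<sigma> = (norm_L2 M (S n) - sqrt (real n) * \<sigma>) / sqrt (real n)"
          using elim by (simp add: diff_divide_distrib)
        ultimately show ?case by simp
      qed
    qed
    then have "(\<lambda>n. norm_L2 M (S n) / sqrt (real n)) \<longlonglongrightarrow> \<sigma>" by (simp add: LIM_zero_iff)
    then have "(\<lambda>n. (norm_L2 M (S n) / sqrt (real n))\<^sup>2) \<longlonglongrightarrow> \<sigma>\<^sup>2" by (rule tendsto_power)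
    then show ?thesis by (simp add: power_divide)
  qed
  have up: "AE x in M. \<forall>k. eventually (\<lambda>n. B D n x \<le> (\<sigma> + 1 / real (Suc k)) * sqrt (2 * real n * ln (ln (real n)))) sequentially"
    unfolding AE_all_countable by (intro allI martingale_lil_upper D) (simp add: \<sigma>_def)
  have low: "AE x in M. \<forall>k. frequently (\<lambda>n. (\<sigma> - 1 / real (Suc k)) * sqrt (2 * real n * ln (ln (real n))) \<le> B D n x) sequentially"
    unfolding AE_all_countable by (intro allI martingale_lil_lower D) (simp add: \<sigma>_def)
  have lil: "AE x in M. limsup (\<lambda>n. ereal (S n x / sqrt (2 * real n * ln (ln (real n))))) = ereal \<sigma>"
    using up low bounded[folded \<xi>_def]
  proof eventually_elim
    case (elim x)
    define \<phi> where "\<phi> n = sqrt (2 * real n * ln (ln (real n)))" for n :: nat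
    obtain K where K: "\<bar>B \<xi> n x\<bar> \<le> K * sqrt (real n)" for n using elim(3) by blast
    have \<phi>0: "eventually (\<lambda>n. 0 < \<phi> n) sequentially"
      unfolding \<phi>_def by real_asymp
    have "(\<lambda>n. sqrt (real n) / \<phi> n) \<longlonglongrightarrow> 0" unfolding \<phi>_def by real_asymp
    then have lim: "(\<lambda>n. K * (sqrt (real n) / \<phi> n)) \<longlonglongrightarrow> 0" by (rule tendsto_mult_right_zero)
    have R: "eventually (\<lambda>n. \<bar>B \<xi> n x\<bar> \<le> e * \<phi> n) sequentially" if "0 < e" for e
    proof -
      have "eventually (\<lambda>n. K * (sqrt (real n) / \<phi> n) < e) sequentially"
        using lim that by (rule order_tendstoD(2))
      with \<phi>0 show ?thesis
      proof eventually_elim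
        case (elim n)
        then have "K * sqrt (real n) \<le> e * \<phi> n" by (simp add: pos_divide_less_eq)
        with K[of n] show ?case by linarith
      qed
    qed
    show ?case unfolding \<phi>_def[symmetric]
    proof (rule limsup_ereal_eqI)
      fix e :: real assume e: "0 < e"
      obtain k :: nat where k: "1 / real (Suc k) < e / 2" using nat_approx_posE[of "e / 2"] e by auto
      have e2: "0 < e / 2" using e by simp
      show "eventually (\<lambda>n. S n x / \<phi> n \<le> \<sigma> + e) sequentially"
        using elim(1)[rule_format, of k, folded \<phi>_def] R[OF e2] \<phi>0
      proof eventually_elim
        case (elim n)
        have "(\<sigma> + 1 / real (Suc k)) * \<phi> n \<le> (\<sigma> + e / 2) * \<phi> n" using k elim(3) by (intro mult_right_mono) auto
        moreover have "(\<sigma> + e) * \<phi> n = (\<sigma> + e / 2) * \<phi> n + e / 2 * \<phi> n" by (simp add: algebra_simps)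
        ultimately have "S n x \<le> (\<sigma> + e) * \<phi> n" using elim(1,2) unfolding S_eq by linarith
        then show ?case using elim(3) by (simp add: pos_divide_le_eq)
      qed
      have "eventually (\<lambda>n. (\<sigma> - 1 / real (Suc k)) * \<phi> n \<le> B D n x \<longrightarrow> \<sigma> - e \<le> S n x / \<phi> n) sequentially"
        using R[OF e2] \<phi>0
      proof eventually_elim
        case (elim n)
        show ?case
        proof
          assume "(\<sigma> - 1 / real (Suc k)) * \<phi> n \<le> B D n x"
          moreover have "(\<sigma> - e / 2) * \<phi> n \<le> (\<sigma> - 1 / real (Suc k)) * \<phi> n"
            using k elim(2) by (intro mult_right_mono) auto
          moreover have "(\<sigma> - e) * \<phi> n = (\<sigma> - e / 2) * \<phi> n - e / 2 * \<phi> n" by (simp add: algebra_simps)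
          ultimately have "(\<sigma> - e) * \<phi> n \<le> S n x" using elim(1) unfolding S_eq by linarith
          then show "\<sigma> - e \<le> S n x / \<phi> n" using elim(2) by (simp add: pos_le_divide_eq)
        qed
      qed
      then show "frequently (\<lambda>n. \<sigma> - e \<le> S n x / \<phi> n) sequentially"
        using elim(2)[rule_format, of k, folded \<phi>_def] by (rule frequently_rev_mp[rotated])
    qed
  qed
  show thesis using that[of \<sigma>] variance lil by (simp add: \<sigma>_def)
qed

text \<open>A single dyadic value \<open>V m\<close> cannot be read off the series, as
  \<open>V\<close> need not be monotone. By \<open>V_le\<close> it is at most
  \<open>V (2 * m + i) + V (m + i)\<close> for every \<open>i < m\<close>; averaging over
  \<open>i\<close> produces parts of the series from two consecutive dyadic blocks.\<close>

lemma summable_dyadic: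
  assumes h: "(\<lambda>n::nat. real n powr (-3/2) * sqrt (max 1 (ln (real n))) * ln (real n) * V n) summable_on {1..}"
  shows "summable (\<lambda>q. real (Suc q) * (V (2 ^ q) / sqrt (2 ^ q)))"
proof -
  define h where "h n = real n powr (-3/2) * sqrt (max 1 (ln (real n))) * ln (real n) * V n" for n :: nat
  have h0: "0 \<le> h n" if "1 \<le> n" for n using that V_nonneg by (simp add: h_def)
  define H where "H q = (\<Sum>n\<in>{2 ^ q..<2 ^ Suc q}. h n)" for q :: nat
  have H0: "0 \<le> H q" for q
    unfolding H_def
  proof (rule sum_nonneg)
    fix n :: nat assume "n \<in> {2 ^ q..<2 ^ Suc q}"
    then have "1 \<le> n" using one_le_power[of "2::nat" q] by (auto intro: order_trans)
    then show "0 \<le> h n" by (rule h0)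
  qed
  have "(\<Sum>q<Q. H q) \<le> infsum h {1..}" for Q
  proof -
    have "(\<Sum>q<Q. H q) = (\<Sum>n\<in>{1..<2 ^ Q}. h n)"
    proof (induction Q)
      case (Suc Q)
      have "(1::nat) \<le> 2 ^ Q" "(2::nat) ^ Q \<le> 2 ^ Suc Q" by auto
      then show ?case by (simp only: sum.lessThan_Suc Suc) (simp only: H_def sum.atLeastLessThan_concat)
    qed simp
    also have "\<dots> \<le> infsum h {1..}"
      by (rule finite_sum_le_infsum) (use h h0 in \<open>auto simp: h_def[abs_def]\<close>)
    finally show ?thesis .
  qed
  then have sumH: "summable H" by (intro summableI_nonneg_bounded H0)
  have key: "real q * (V (2 ^ q) / sqrt (2 ^ q)) \<le> 8 / ln 2 * (H q + H (Suc q))" for q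
  proof -
    let ?m = "2 ^ q :: nat"
    \<comment> \<open>Here \<open>n < 4 * 2 ^ q\<close>, and 8 is \<open>4 powr (3 / 2)\<close>;
      \<open>ln n\<close> is bounded below by \<open>q * ln 2\<close>.\<close>
    have coeff: "real q * ln 2 / (8 * (2 ^ q * sqrt (2 ^ q))) * V n \<le> h n" if n: "?m \<le> n" "n < 4 * ?m" for n
    proof -
      have n1: "1 \<le> n" using n(1) one_le_power[of "2::nat" q] by linarith
      have rn: "2 ^ q \<le> real n" "real n \<le> 4 * 2 ^ q"
        using of_nat_mono[OF n(1), where 'a=real] of_nat_mono[OF less_imp_le[OF n(2)], where 'a=real] by auto
      have "real q * ln 2 = ln (2 ^ q)" by (simp add: ln_realpow)
      also have "\<dots> \<le> ln (real n)" using rn(1) n1 by (intro ln_mono) auto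
      finally have l: "real q * ln 2 \<le> ln (real n)" .
      have p: "1 / (8 * (2 ^ q * sqrt (2 ^ q))) \<le> real n powr (-3/2)"
      proof -
        have "(4 * 2 ^ q) powr (3/2) = (4 * 2 ^ q) * sqrt (4 * 2 ^ q :: real)"
          using powr_add[of "4 * 2 ^ q :: real" 1 "1/2"] by (simp add: powr_half_sqrt)
        also have "\<dots> = 8 * (2 ^ q * sqrt (2 ^ q))" by (simp add: real_sqrt_mult)
        finally have "1 / (8 * (2 ^ q * sqrt (2 ^ q))) = (4 * 2 ^ q) powr (-3/2)"
          by (simp add: powr_minus_divide)
        also have "\<dots> \<le> real n powr (-3/2)" using rn n1 by (intro powr_mono2') auto
        finally show ?thesis .
      qed
      have "1 / (8 * (2 ^ q * sqrt (2 ^ q))) * 1 * (real q * ln 2) * V n \<le> h n"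
        unfolding h_def using p l V_nonneg n1 by (intro mult_mono mult_nonneg_nonneg) auto
      then show ?thesis by simp
    qed
    let ?c = "real q * ln 2 / (8 * (2 ^ q * sqrt (2 ^ q)))"
    have "?c * (2 ^ q * V ?m) = (\<Sum>i<?m. ?c * V ?m)" by simp
    also have "\<dots> \<le> (\<Sum>i<?m. h (2 * ?m + i) + h (?m + i))"
    proof (rule sum_mono)
      fix i assume i: "i \<in> {..<?m}"
      have "V ?m \<le> V (2 * ?m + i) + V (?m + i)" using V_le[of ?m "?m + i"] by (simp add: mult_2 add.assoc)
      then have "?c * V ?m \<le> ?c * (V (2 * ?m + i) + V (?m + i))" by (intro mult_left_mono) auto
      also have "\<dots> \<le> h (2 * ?m + i) + h (?m + i)"
        unfolding distrib_left using i by (intro add_mono coeff) auto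
      finally show "?c * V ?m \<le> h (2 * ?m + i) + h (?m + i)" .
    qed
    also have "\<dots> = (\<Sum>i<?m. h (2 * ?m + i)) + (\<Sum>i<?m. h (?m + i))" by (rule sum.distrib)
    also have "\<dots> \<le> H (Suc q) + H q"
    proof (rule add_mono)
      have "(\<Sum>i<?m. h (2 * ?m + i)) \<le> (\<Sum>i<2 * ?m. h (2 * ?m + i))"
        by (rule sum_mono2) (auto intro!: h0 simp: Suc_le_eq)
      also have "\<dots> = H (Suc q)"
        unfolding H_def using sum.shift_bounds_nat_ivl[of h 0 "2 * ?m" "2 * ?m"]
        by (simp add: lessThan_atLeast0 add.commute)
      finally show "(\<Sum>i<?m. h (2 * ?m + i)) \<le> H (Suc q)" .
      show "(\<Sum>i<?m. h (?m + i)) \<le> H q"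
        unfolding H_def using sum.shift_bounds_nat_ivl[of h 0 ?m ?m]
        by (simp add: lessThan_atLeast0 add.commute mult_2)
    qed
    finally have "8 / ln 2 * (?c * (2 ^ q * V ?m)) \<le> 8 / ln 2 * (H (Suc q) + H q)"
      by (intro mult_left_mono) auto
    moreover have "8 / ln 2 * (?c * (2 ^ q * V ?m)) = real q * (V ?m / sqrt (2 ^ q))" by simp
    ultimately show ?thesis by (simp add: add.commute)
  qed
  have "summable (\<lambda>q. 2 * (8 / ln 2 * (H q + H (Suc q))))"
    using sumH by (intro summable_mult summable_add) (auto simp: summable_Suc_iff)
  then show ?thesis
  proof (rule summable_comparison_test'[where N = 1])
    \<comment> \<open>From \<open>q = 1\<close> on, \<open>q + 1 \<le> 2 * q\<close>; this is why
      the comparison starts there.\<close>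
    fix q :: nat assume "1 \<le> q"
    then have "real (Suc q) * (V (2 ^ q) / sqrt (2 ^ q)) \<le> (2 * real q) * (V (2 ^ q) / sqrt (2 ^ q))"
      using V_nonneg by (intro mult_right_mono) auto
    also have "\<dots> = 2 * (real q * (V (2 ^ q) / sqrt (2 ^ q)))" by (simp only: mult.assoc)
    also have "\<dots> \<le> 2 * (8 / ln 2 * (H q + H (Suc q)))" by (intro mult_left_mono key) simp
    finally show "norm (real (Suc q) * (V (2 ^ q) / sqrt (2 ^ q))) \<le> 2 * (8 / ln 2 * (H q + H (Suc q)))"
      using V_nonneg by (simp only: real_norm_def abs_mult abs_divide abs_of_nonneg real_sqrt_ge_zero zero_le_power zero_le_numeral of_nat_0_le_iff)
  qed
qed

end

section \<open>The past of the chain as a filtration\<close>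

lemma sets_past:
  "sets (past M N W k) = sigma_sets (space M) (\<Union>j\<in>{..k}. {W j -` A \<inter> space M |A. A \<in> sets N})"
  unfolding past_def by (rule sets_measure_of) auto

lemma subalgebra_past:
  assumes "\<And>k. W k \<in> measurable M N"
  shows "subalgebra M (past M N W k)"
proof -
  have "(\<Union>j\<in>{..k}. {W j -` A \<inter> space M |A. A \<in> sets N}) \<subseteq> sets M"
    using measurable_sets[OF assms] by auto
  from sets.sigma_sets_subset[OF this] show ?thesis
    unfolding subalgebra_def sets_past by (simp add: past_def space_measure_of_conv)
qed

text \<open>\<open>W j\<close> is \<open>W (j - 1)\<close> after one step, and \<open>j - 1\<close>
  still belongs to the past; preimages commute with the set operations that generate the
  \<sigma>-algebra.\<close>

lemma past_eq_vimage:
  assumes W: "\<And>k x. x \<in> space M \<Longrightarrow> W k (\<theta> x) = W (k + 1) x"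
    and \<theta>: "\<theta> \<in> measurable M M" and A: "A \<in> sets (past M N W k)"
  shows "\<exists>E\<in>sets (past M N W k). A = \<theta> -` E \<inter> space M"
proof -
  have \<theta>s: "\<theta> x \<in> space M" if "x \<in> space M" for x using \<theta> that by (rule measurable_space)
  show ?thesis using A unfolding sets_past
  proof (induction rule: sigma_sets.induct)
    case (Basic A)
    then obtain j E where jE: "j \<le> k" "E \<in> sets N" "A = W j -` E \<inter> space M" by auto
    have "A = \<theta> -` (W (j - 1) -` E \<inter> space M) \<inter> space M"
      unfolding jE(3) using W[of _ "j - 1"] \<theta>s by (auto simp del: vimage_Int)
    moreover have "W (j - 1) -` E \<inter> space M \<in> (\<Union>j\<in>{..k}. {W j -` A \<inter> space M |A. A \<in> sets N})"
      using jE by (intro UN_I[of "j - 1"]) auto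
    ultimately show ?case by (blast intro: sigma_sets.Basic)
  next
    case Empty
    show ?case by (intro bexI[of _ "{}"] sigma_sets.Empty) simp
  next
    case (Compl A)
    then obtain E where E: "E \<in> sigma_sets (space M) (\<Union>j\<in>{..k}. {W j -` A \<inter> space M |A. A \<in> sets N})"
      "A = \<theta> -` E \<inter> space M" by blast
    show ?case by (rule bexI[OF _ sigma_sets.Compl[OF E(1)]]) (use \<theta>s E(2) in auto)
  next
    case (Union A)
    then have "\<forall>i. \<exists>E. E \<in> sigma_sets (space M) (\<Union>j\<in>{..k}. {W j -` A \<inter> space M |A. A \<in> sets N}) \<and>
      A i = \<theta> -` E \<inter> space M" by blast
    from choice[OF this] obtain E
      where E: "\<And>i. E i \<in> sigma_sets (space M) (\<Union>j\<in>{..k}. {W j -` A \<inter> space M |A. A \<in> sets N})"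
        "\<And>i. A i = \<theta> -` E i \<inter> space M" by auto
    show ?case by (rule bexI[OF _ sigma_sets.Union[of E, OF E(1)]]) (use E(2) in auto)
  qed
qed

lemma measurable_past:
  assumes "W k \<in> measurable M N" "k \<le> l"
  shows "W k \<in> measurable (past M N W l) N"
proof (rule measurableI)
  have sp: "space (past M N W l) = space M" by (simp add: past_def space_measure_of_conv)
  show "W k x \<in> space N" if "x \<in> space (past M N W l)" for x
    using measurable_space[OF assms(1)] that by (simp add: sp)
  show "W k -` A \<inter> space (past M N W l) \<in> sets (past M N W l)" if "A \<in> sets N" for A
    unfolding sp sets_past using that assms(2) by (intro sigma_sets.Basic) auto
qed

theorem corollary1:
  fixes M :: "'a measure" and N :: "'b measure"
    and W :: "int \<Rightarrow> 'a \<Rightarrow> 'b" and \<theta> :: "'a \<Rightarrow> 'a" and g :: "'b \<Rightarrow> real"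
  assumes "prob_space M"
    and "ergodic_map M \<theta>"
    and "markov_chain M N W"
    and "strictly_stationary M N W"
    and "ergodic_process M N W"
    and "\<And>k \<omega>. \<omega> \<in> space M \<Longrightarrow> W k (\<theta> \<omega>) = W (k + 1) \<omega>"
    and "g \<in> borel_measurable N"
    and "integrable M (\<lambda>\<omega>. (g (W 0 \<omega>))\<^sup>2)"
    and "integral\<^sup>L M (\<lambda>\<omega>. g (W 0 \<omega>)) = 0"
    and "(\<lambda>n::nat. real n powr (-3/2) * sqrt (max 1 (ln (real n))) * ln (real n) *
            norm_L2 M (real_cond_exp M (past M N W 0) (partial_sum g W n))) summable_on {1..}"
  shows "\<exists>\<sigma>\<ge>0.
      (\<lambda>n. integral\<^sup>L M (\<lambda>\<omega>. (partial_sum g W n \<omega>)\<^sup>2) / real n) \<longlonglongrightarrow> \<sigma>\<^sup>2 \<and>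
      (AE \<omega> in M. limsup (\<lambda>n. ereal (partial_sum g W n \<omega> /
          sqrt (2 * real n * ln (ln (real n))))) = ereal \<sigma>)"
proof -
  have W: "W k \<in> measurable M N" for k using assms(3) by (simp add: markov_chain_def)
  have \<theta>: "\<theta> \<in> measurable M M" "distr M M \<theta> = M"
    using assms(2) by (auto simp: ergodic_map_def measure_preserving_map_def)
  define X where "X x = g (W 0 x)" for x
  have XG: "X \<in> borel_measurable (past M N W 0)"
    unfolding X_def[abs_def] by (rule measurable_compose[OF measurable_past[OF W] assms(7)]) simp
  have Xm: "X \<in> borel_measurable M" by (rule measurable_from_subalg[OF subalgebra_past[OF W] XG])
  have sqX: "square_integrable M X" using Xm assms(8) by (simp add: square_integrable_def X_def)
  interpret prob_space M by (rule assms(1))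
  interpret adapted_process M \<theta> "past M N W 0" X
  proof unfold_locales
    show "A \<in> null_sets M \<or> space M - A \<in> null_sets M" if "A \<in> sets M" "\<theta> -` A \<inter> space M = A" for A
      using assms(2) that by (simp add: ergodic_map_def)
    show "subalgebra M (past M N W 0)" by (rule subalgebra_past[OF W])
    show "\<exists>B\<in>sets (past M N W 0). A = \<theta> -` B \<inter> space M" if "A \<in> sets (past M N W 0)" for A
      by (rule past_eq_vimage[OF assms(6) \<theta>(1) that])
  qed (rule \<theta> XG sqX)+
  have shift: "W 0 ((\<theta> ^^ n) x) = W (int n) x" if x: "x \<in> space M" for n x
    using x
  proof (induction n arbitrary: x)
    case (Suc n)
    have "W 0 ((\<theta> ^^ Suc n) x) = W 0 ((\<theta> ^^ n) (\<theta> x))" by (simp only: funpow_Suc_right comp_apply)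
    also have "\<dots> = W (int n) (\<theta> x)" by (rule Suc.IH) (use Suc.prems \<theta>(1) in \<open>rule measurable_space[rotated]\<close>)
    also have "\<dots> = W (int (Suc n)) x" using assms(6)[OF Suc.prems, of "int n"] by (simp add: add.commute)
    finally show ?case .
  qed simp
  have S_eq: "S n x = partial_sum g W n x" if x: "x \<in> space M" for n x
  proof -
    have "S n x = (\<Sum>k<n. g (W (int (Suc k)) x))"
      unfolding S_def birkhoff_sum_def X_def using shift[OF x, of "Suc _"] by simp
    also have "\<dots> = partial_sum g W n x"
      unfolding partial_sum_def by (rule sum.reindex_bij_witness[of _ "\<lambda>i. i - 1" Suc]) auto
    finally show ?thesis .
  qed
  have psm: "partial_sum g W n \<in> borel_measurable M" for n
    unfolding partial_sum_def[abs_def]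
    by (intro borel_measurable_sum measurable_compose[OF W assms(7)])
  \<comment> \<open>\<open>S n\<close> and the partial sum agree on \<open>space M\<close> only, so
    the two conditional expectations are compared almost everywhere.\<close>
  have V_eq: "norm_L2 M (C (partial_sum g W n)) = V n" for n
  proof -
    have "AE x in M. C (partial_sum g W n) x = C (S n) x"
      by (rule G.real_cond_exp_cong) (use S_eq psm square_integrableD[OF square_integrable_S] in \<open>auto intro!: AE_I2\<close>)
    then show ?thesis unfolding V_def by (rule norm_L2_cong_AE) measurable
  qed
  obtain \<sigma> where s: "0 \<le> \<sigma>" "(\<lambda>n. (norm_L2 M (S n))\<^sup>2 / real n) \<longlonglongrightarrow> \<sigma>\<^sup>2"
    "AE x in M. limsup (\<lambda>n. ereal (S n x / sqrt (2 * real n * ln (ln (real n))))) = ereal \<sigma>"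
    using law_of_iterated_logarithm[OF summable_dyadic[OF assms(10)[unfolded V_eq]]] by blast
  have "(norm_L2 M (S n))\<^sup>2 = (\<integral>x. (partial_sum g W n x)\<^sup>2 \<partial>M)" for n
    unfolding norm_L2_power2 by (intro Bochner_Integration.integral_cong) (auto simp: S_eq)
  moreover have "AE x in M. limsup (\<lambda>n. ereal (partial_sum g W n x / sqrt (2 * real n * ln (ln (real n))))) = ereal \<sigma>"
    using s(3) by (rule AE_mp) (intro AE_I2, simp add: S_eq)
  ultimately show ?thesis using s(1,2) by auto
qed

end
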